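(* For $\lambda>1$ and $\theta\in\mathbb{R}\setminus\mathbb{Q}$, let $$A_1:=\begin{pmatrix}\lambda&0\\0&1/\lambda\end{pmatrix},\qquad A_2:=\begin{pmatrix}\cos(2\pi\theta)&-\sin(2\pi\theta)\\ \sin(2\pi\theta)&\cos(2\pi\theta)\end{pmatrix}.$$ Let $(\Sigma,\sigma)$ be the one-sided full shift on the alphabet $\{1,2\}$. For $t\in\mathbb{R}$ and $n\in\mathbb{N}$ define $\varphi_{t,n}:\Sigma\to\mathbb{R}$ by $\varphi_{t,n}(x):=t\log\|\mathcal{A}^n(x)\|$, where $\mathcal{A}^n(x):=A_{x_{n-1}}\cdots A_{x_0}$, and let $\Phi_t:=(\varphi_{t,n})_{n\in\mathbb{N}}$. Then there exists $C>0$ such that $$P_{\mathrm{top}}(\Phi_t,\sigma)=\sup_{\mu\in\mathcal{M}(\Sigma,\sigma)}\{h(\mu,\sigma):\lambda_1(\mathcal{A},\mu)=0\}\quad\text{for all }t\le -C,$$ and $$P_{\mathrm{top}}(\Phi_t,\sigma)>\sup_{\mu\in\mathcal{M}(\Sigma,\sigma)}\{h(\mu,\sigma):\lambda_1(\mathcal{A},\mu)=0\}\quad\text{for all }t>-C.$$ In particular, $t\mapsto P_{\mathrm{top}}(\Phi_t,\sigma)$ is not analytic (on $\mathbb{R}$).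
   Context: $\Sigma=\{1,2\}^{\mathbb{N}_0}$ and $\sigma$ is the left shift; $\|\cdot\|$ is the spectral norm; $\mathcal{M}(\Sigma,\sigma)$ is the set of $\sigma$-invariant Borel probability measures on $\Sigma$; $h(\mu,\sigma)$ is the measure-theoretic entropy. $\lambda_1(\mathcal{A},\mu)=\lim_{n\to\infty}\frac1n\int\log\|\mathcal{A}^n(x)\|\,d\mu(x)$ is the top Lyapunov exponent of $\mu$. Since $\varphi_{t,n}$ depends only on $x_0,\dots,x_{n-1}$, the topological pressure is $P_{\mathrm{top}}(\Phi_t,\sigma)=\lim_{n\to\infty}\frac1n\log\sum_{I\in\{1,2\}^n}\|\mathcal{A}^n(I)\|^t$, where $\mathcal{A}^n(I)=A_{i_{n-1}}\cdots A_{i_0}$ for $I=(i_0,\dots,i_{n-1})$. *)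

theory Defs
  imports "HOL-Probability.Probability"
begin

section \<open>The one-sided full shift on two symbols\<close>

definition full_shift :: "(nat \<Rightarrow> nat) set"
  where "full_shift = {x. \<forall>n. x n \<in> {1, 2}}"

definition left_shift :: "(nat \<Rightarrow> nat) \<Rightarrow> (nat \<Rightarrow> nat)"
  where "left_shift x = (\<lambda>n. x (Suc n))"

text \<open>Here \<open>borel\<close> belongs to the product topology on \<open>nat \<Rightarrow> nat\<close> with \<open>nat\<close> discrete, so
  its restriction is the Borel sigma-algebra of the full shift.\<close>

definition invariant_measures :: "(nat \<Rightarrow> nat) measure set"
  where "invariant_measures =
    {\<mu>. prob_space \<mu> \<and> sets \<mu> = sets (restrict_space borel full_shift) \<and> distr \<mu> \<mu> left_shift = \<mu>}"

definition words :: "nat \<Rightarrow> (nat \<Rightarrow> nat) set"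
  where "words n = {..<n} \<rightarrow>\<^sub>E {1, 2}"

definition cylinder :: "nat \<Rightarrow> (nat \<Rightarrow> nat) \<Rightarrow> (nat \<Rightarrow> nat) set"
  where "cylinder n I = {x \<in> full_shift. \<forall>i<n. x i = I i}"


section \<open>Measure-theoretic entropy\<close>

text \<open>The convention \<open>0 log 0 = 0\<close> is built into multiplication.\<close>

definition partition_entropy :: "'a measure \<Rightarrow> 'a set set \<Rightarrow> real"
  where "partition_entropy \<mu> P = - (\<Sum>A\<in>P. measure \<mu> A * ln (measure \<mu> A))"

text \<open>The join of the partitions \<open>T\<^sup>-\<^sup>iP\<close> for \<open>i < n\<close>: a choice \<open>f\<close> of one cell of \<open>P\<close> for each
  time \<open>i < n\<close> gives the cell of points with the itinerary \<open>f\<close>. The cell may be empty, in which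
  case it does not contribute to the entropy.\<close>

definition iterated_join :: "'a measure \<Rightarrow> ('a \<Rightarrow> 'a) \<Rightarrow> 'a set set \<Rightarrow> nat \<Rightarrow> 'a set set"
  where "iterated_join \<mu> T P n =
    (\<lambda>f. {x \<in> space \<mu>. \<forall>i<n. (T ^^ i) x \<in> f i}) ` ({..<n} \<rightarrow>\<^sub>E P)"

definition entropy_wrt :: "'a measure \<Rightarrow> ('a \<Rightarrow> 'a) \<Rightarrow> 'a set set \<Rightarrow> real"
  where "entropy_wrt \<mu> T P = lim (\<lambda>n. partition_entropy \<mu> (iterated_join \<mu> T P n) / real n)"

definition ks_entropy :: "'a measure \<Rightarrow> ('a \<Rightarrow> 'a) \<Rightarrow> ereal"
  where "ks_entropy \<mu> T =
    (SUP P\<in>{P. finite P \<and> P \<subseteq> sets \<mu> \<and> partition_on (space \<mu>) P}. ereal (entropy_wrt \<mu> T P))"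


section \<open>Matrix cocycles over the full shift\<close>

definition spectral_norm :: "real^2^2 \<Rightarrow> real"
  where "spectral_norm M = onorm (\<lambda>v. M *v v)"

primrec cocycle :: "(nat \<Rightarrow> real^2^2) \<Rightarrow> nat \<Rightarrow> (nat \<Rightarrow> nat) \<Rightarrow> real^2^2"
  where
    "cocycle A 0 x = mat 1"
  | "cocycle A (Suc n) x = A (x n) ** cocycle A n x"

definition top_lyapunov :: "(nat \<Rightarrow> real^2^2) \<Rightarrow> (nat \<Rightarrow> nat) measure \<Rightarrow> real"
  where "top_lyapunov A \<mu> = lim (\<lambda>n. (\<integral>x. ln (spectral_norm (cocycle A n x)) \<partial>\<mu>) / real n)"

definition potential :: "(nat \<Rightarrow> real^2^2) \<Rightarrow> real \<Rightarrow> nat \<Rightarrow> (nat \<Rightarrow> nat) \<Rightarrow> real"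
  where "potential A t n x = t * ln (spectral_norm (cocycle A n x))"

text \<open>Topological pressure of a sequence of potentials on the full shift. The n-th potential is
  evaluated by its supremum over each cylinder of length \<open>n\<close>; for potentials depending only on the
  first \<open>n\<close> coordinates this is their constant value there. See \<open>pressure_potential\<close> below for the
  resulting formula.\<close>

definition pressure :: "(nat \<Rightarrow> (nat \<Rightarrow> nat) \<Rightarrow> real) \<Rightarrow> real"
  where "pressure \<Phi> = lim (\<lambda>n. ln (\<Sum>I\<in>words n. exp (SUP x\<in>cylinder n I. \<Phi> n x)) / real n)"

lemma cocycle_cong:
  assumes "\<And>i. i < n \<Longrightarrow> x i = y i"
  shows "cocycle A n x = cocycle A n y"
  using assms by (induction n) auto

lemma spectral_norm_cocycle_pos:
  assumes "\<And>i. i \<in> {1, 2} \<Longrightarrow> det (A i) \<noteq> 0" and "\<And>i. i < n \<Longrightarrow> x i \<in> {1, 2}"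
  shows "spectral_norm (cocycle A n x) > 0"
proof -
  have "det (cocycle A n x) \<noteq> 0"
    using assms(2) by (induction n) (auto simp: det_mul assms(1))
  then have "cocycle A n x \<noteq> 0"
    by (auto simp: det_2)
  then have "\<not> (\<forall>v. cocycle A n x *v v = 0)"
    using matrix_eq[of "cocycle A n x" 0] by simp
  then show ?thesis
    unfolding spectral_norm_def
    by (subst onorm_pos_lt[OF matrix_vector_mul_bounded_linear]) simp
qed

lemma pressure_potential:
  assumes "\<And>i. i \<in> {1, 2} \<Longrightarrow> det (A i) \<noteq> 0"
  shows "pressure (potential A t) =
    lim (\<lambda>n. ln (\<Sum>I\<in>words n. spectral_norm (cocycle A n I) powr t) / real n)"
proof -
  have "exp (SUP x\<in>cylinder n I. potential A t n x) = spectral_norm (cocycle A n I) powr t"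
    if I: "I \<in> words n" for n I
  proof -
    have I12: "I i \<in> {1, 2}" if "i < n" for i
      using I that by (auto simp: words_def PiE_def Pi_def)
    have "(\<lambda>i. if i < n then I i else 1) \<in> cylinder n I"
      using I12 by (auto simp: cylinder_def full_shift_def)
    then have "cylinder n I \<noteq> {}"
      by blast
    moreover have "potential A t n x = t * ln (spectral_norm (cocycle A n I))"
      if "x \<in> cylinder n I" for x
      using that cocycle_cong[of n x I A] by (simp add: potential_def cylinder_def)
    ultimately have "potential A t n ` cylinder n I = {t * ln (spectral_norm (cocycle A n I))}"
      by (auto simp: image_iff)
    then have "(SUP x\<in>cylinder n I. potential A t n x)
        = t * ln (spectral_norm (cocycle A n I))"
      by simp
    moreover have "spectral_norm (cocycle A n I) > 0"
      using assms I12 by (rule spectral_norm_cocycle_pos)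
    ultimately show ?thesis
      by (simp add: powr_def)
  qed
  then show ?thesis
    by (simp add: pressure_def)
qed


section \<open>The example\<close>

definition hyperbolic_matrix :: "real \<Rightarrow> real^2^2"
  where "hyperbolic_matrix lam = vector [vector [lam, 0], vector [0, 1 / lam]]"

definition rotation_matrix :: "real \<Rightarrow> real^2^2"
  where "rotation_matrix \<theta> =
    vector [vector [cos (2 * pi * \<theta>), - sin (2 * pi * \<theta>)],
            vector [sin (2 * pi * \<theta>), cos (2 * pi * \<theta>)]]"

text \<open>Only the values at the symbols \<open>1\<close> and \<open>2\<close> matter.\<close>

definition generators :: "real \<Rightarrow> real \<Rightarrow> nat \<Rightarrow> real^2^2"
  where "generators lam \<theta> i = (if i = 1 then hyperbolic_matrix lam else rotation_matrix \<theta>)"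


section \<open>Real analyticity\<close>

definition real_analytic_on :: "(real \<Rightarrow> real) \<Rightarrow> real set \<Rightarrow> bool"
  where "real_analytic_on f S \<longleftrightarrow> (\<forall>x\<in>S. \<exists>F. (\<lambda>h. f (x + h)) has_fps_expansion F)"

end

(*
  All products have determinant one, so their norm is at least one and the pressure P is
  nondecreasing and Lipschitz. Let h be the supremum of the entropies of the measures with vanishing
  exponent.

  h <= P t for every t: Gibbs' inequality bounds the entropy of the first n symbols plus t times the
  integrated logarithm of the norm by the logarithm of the partition sum, and the partition by the
  first symbol generates.

  P (-s) <= h for large s: since the rotation is irrational, the long axis of a product can be turned
  into the contracting direction of the hyperbolic matrix, so a word whose product has squared norm about
  kappa^(-j) extends by j K symbols to one with bounded product. Chaining bounded words, each followed by
  a correction, gives invariant measures with vanishing exponent whose entropy is at least the growth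
  rate of the number of bounded words. Hence the words of squared norm about kappa^(-j) number at most
  exp (h (n + j K + L)), which for large s is outweighed by their weights.

  h < P 0 = ln 2: the Koopman operators of the two matrices on L^2 of the plane are unitary and their
  average has a power of norm less than one, because an almost invariant function would be almost
  invariant under comparing a hyperbolic step with a rotation step, which moves mass towards the
  first axis. Testing against the unit disc gives P (-2) < ln 2.

  The set where P <= h is therefore a half-line ending at a negative point, and P is constant to its
  left but not to its right, so it is not analytic there.
*)
theory Submission
  imports Defs "HOL-Analysis.Kronecker_Approximation_Theorem"
begin

text \<open>All size estimates use \<open>frob\<close>, the squared Frobenius norm: it is polynomial
  in the entries, invariant under rotations, unchanged by inverting a matrix of determinant one, and
  comparable to the squared spectral norm with constants 1 and 2. The obstacle in producing measures
  with vanishing exponent is that the exponent is only upper semicontinuous, so a limit of measures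
  with small exponents may have a positive one. The measures are therefore built so that all words
  of positive probability have products below one common bound, a property that passes to limits of
  word frequencies. Concatenating bounded words does not preserve a bound, hence the correction
  after each block; its length has to be the same for every past, which is where uniform density of
  the irrational rotation and the padding by rotations enter. The parameter -2 comes from the plane:
  the vectors that a product of norm R keeps in the unit disc contain a disc of area proportional to
  \<open>R powr (-2)\<close>.\<close>

section \<open>Subadditive sequences\<close>

text \<open>Fekete's lemma. Nonnegativity makes the infimum of the averages a real number, and
  division of \<open>n\<close> by a good index \<open>m\<close> shows that the averages converge to
  it.\<close>

lemma subadditive_convergent:
  fixes a :: "nat \<Rightarrow> real"
  assumes sub: "\<And>m n. a (m + n) \<le> a m + a n" and nn: "\<And>n. 0 \<le> a n"
  shows "convergent (\<lambda>n. a n / n)" and "\<And>n. n > 0 \<Longrightarrow> lim (\<lambda>n. a n / n) \<le> a n / n"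
proof -
  define I where "I = (INF n\<in>{1..}. a n / real n)"
  have bdd: "bdd_below ((\<lambda>n. a n / real n) ` {1..})"
    by (rule bdd_belowI[of _ 0]) (auto simp: nn)
  have I_le: "I \<le> a n / n" if "n > 0" for n
    unfolding I_def using that by (intro cINF_lower[OF bdd]) auto
  have mult: "a (q * m + r) \<le> q * a m + a r" for q m r
  proof (induction q)
    case (Suc q)
    have "a (Suc q * m + r) = a (m + (q * m + r))" by (simp add: algebra_simps)
    also have "\<dots> \<le> a m + a (q * m + r)" by (rule sub)
    finally show ?case using Suc by (simp add: algebra_simps)
  qed simp
  have lim: "(\<lambda>n. a n / n) \<longlonglongrightarrow> I"
  proof (rule LIMSEQ_I)
    fix e :: real assume e: "0 < e"
    have "I < I + e / 2" using e by simp
    then obtain m where m: "m \<ge> 1" "a m / m < I + e / 2"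
      unfolding I_def using cINF_less_iff[OF _ bdd, of "I + e/2"] by (auto simp: I_def)
    \<comment> \<open>One bound for all remainders \<open>r < m\<close>; a sum dominates each of its
      terms because the sequence is nonnegative.\<close>
    define C where "C = (\<Sum>r<m. a r)"
    have C: "a r \<le> C" if "r < m" for r
      unfolding C_def using that by (intro member_le_sum) (auto simp: nn)
    obtain N where N: "2 * C / e < real N" using reals_Archimedean2 by blast
    have "\<bar>a n / n - I\<bar> < e" if n: "n \<ge> Suc N" for n
    proof -
      have n0: "real n > 0" using n by simp
      have "a n \<le> (n div m) * a m + a (n mod m)"
        using mult[of "n div m" m "n mod m"] by simp
      also have "\<dots> \<le> (n div m) * a m + C" using C[of "n mod m"] m by simp
      also have "real (n div m) * a m = (real (n div m) * real m) * (a m / m)" using m by simp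
      also have "\<dots> \<le> n * (a m / m)"
      proof (rule mult_right_mono)
        show "real (n div m) * real m \<le> real n"
          by (metis div_times_less_eq_dividend of_nat_mono of_nat_mult)
      qed (simp add: nn)
      finally have "a n / n \<le> a m / m + C / n"
        using n0 by (simp add: field_simps)
      moreover have "C / n < e / 2"
      proof -
        have "2 * C / e < real n" using N n by linarith
        then show ?thesis using e n0 by (simp add: field_simps)
      qed
      ultimately have "a n / n < I + e" using m(2) by linarith
      moreover have "I \<le> a n / n" using I_le[of n] n by simp
      ultimately show ?thesis by simp
    qed
    then show "\<exists>no. \<forall>n\<ge>no. norm (a n / real n - I) < e" by auto
  qed
  then show "convergent (\<lambda>n. a n / n)" by (auto simp: convergent_def)
  show "lim (\<lambda>n. a n / n) \<le> a n / n" if "n > 0" for n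
    using limI[OF lim] I_le[OF that] by simp
qed


section \<open>Real two by two matrices of determinant one\<close>

text \<open>The squared Frobenius norm.\<close>

definition frob :: "real^2^2 \<Rightarrow> real"
  where "frob M = (M$1$1)\<^sup>2 + (M$1$2)\<^sup>2 + (M$2$1)\<^sup>2 + (M$2$2)\<^sup>2"

lemma matrix_mul_2: "((A::real^2^2) ** B)$i$j = A$i$1 * B$1$j + A$i$2 * B$2$j"
  by (simp add: matrix_matrix_mult_def sum_2)

lemma matrix_vector_mul_2: "((A::real^2^2) *v v)$i = A$i$1 * v$1 + A$i$2 * v$2"
  by (simp add: matrix_vector_mult_def sum_2)

lemma norm_vec2_sq: "(norm (v::real^2))\<^sup>2 = (v$1)\<^sup>2 + (v$2)\<^sup>2"
  by (simp add: norm_vec_def L2_set_def sum_2)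

lemma frob_mult: "frob (A ** B) \<le> frob A * frob B"
proof -
  have cs: "(a * c + b * d)\<^sup>2 \<le> (a\<^sup>2 + b\<^sup>2) * (c\<^sup>2 + d\<^sup>2)" for a b c d :: real
  proof -
    have "(a\<^sup>2 + b\<^sup>2) * (c\<^sup>2 + d\<^sup>2) - (a * c + b * d)\<^sup>2 = (a * d - b * c)\<^sup>2"
      by (simp add: power2_eq_square algebra_simps)
    then show ?thesis by (metis diff_ge_0_iff_ge zero_le_power2)
  qed
  have "frob (A ** B) \<le> (((A$1$1)\<^sup>2 + (A$1$2)\<^sup>2) * ((B$1$1)\<^sup>2 + (B$2$1)\<^sup>2)
      + ((A$1$1)\<^sup>2 + (A$1$2)\<^sup>2) * ((B$1$2)\<^sup>2 + (B$2$2)\<^sup>2))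
      + (((A$2$1)\<^sup>2 + (A$2$2)\<^sup>2) * ((B$1$1)\<^sup>2 + (B$2$1)\<^sup>2)
      + ((A$2$1)\<^sup>2 + (A$2$2)\<^sup>2) * ((B$1$2)\<^sup>2 + (B$2$2)\<^sup>2))"
    unfolding frob_def matrix_mul_2
    using cs[of "A$1$1" "B$1$1" "A$1$2" "B$2$1"] cs[of "A$1$1" "B$1$2" "A$1$2" "B$2$2"]
      cs[of "A$2$1" "B$1$1" "A$2$2" "B$2$1"] cs[of "A$2$1" "B$1$2" "A$2$2" "B$2$2"]
    by linarith
  also have "\<dots> = frob A * frob B" unfolding frob_def by (simp add: algebra_simps)
  finally show ?thesis .
qed

lemma frob_nonneg: "0 \<le> frob M"
  by (simp add: frob_def)

lemma frob_ge_2: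
  assumes "det M = 1"
  shows "2 \<le> frob M"
proof -
  have "frob M = (M$1$1 - M$2$2)\<^sup>2 + (M$1$2 + M$2$1)\<^sup>2 + 2 * det M"
    unfolding frob_def det_2 by (simp add: power2_eq_square algebra_simps)
  also have "\<dots> \<ge> 2" using assms by simp
  finally show ?thesis by simp
qed

text \<open>The adjugate, which is the inverse when the determinant is one.\<close>

definition adj2 :: "real^2^2 \<Rightarrow> real^2^2"
  where "adj2 M = vector [vector [M$2$2, - M$1$2], vector [- M$2$1, M$1$1]]"

lemma frob_adj2: "frob (adj2 M) = frob M"
  by (simp add: frob_def adj2_def)

lemma adj2_mult: "M ** adj2 M = mat (det M)" "adj2 M ** M = mat (det M)"
  by (simp_all add: vec_eq_iff forall_2 matrix_mul_2 adj2_def det_2 mat_def algebra_simps)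

text \<open>The inverse of a matrix of determinant one has the same Frobenius norm, so removing a
  factor costs no more than inserting it.\<close>

lemma frob_cancel_right:
  assumes "det A = 1"
  shows "frob B \<le> frob (B ** A) * frob A"
proof -
  have "B = (B ** A) ** adj2 A"
    using assms by (simp add: matrix_mul_assoc[symmetric] adj2_mult)
  then show ?thesis using frob_mult[of "B ** A" "adj2 A"] by (simp add: frob_adj2)
qed

lemma spectral_norm_bound: "norm (M *v v) \<le> spectral_norm M * norm v"
  unfolding spectral_norm_def by (rule onorm[OF matrix_vector_mul_bounded_linear])

lemma spectral_norm_nonneg: "0 \<le> spectral_norm M"
  unfolding spectral_norm_def by (rule onorm_pos_le[OF matrix_vector_mul_bounded_linear])

lemma spectral_norm_mult: "spectral_norm (A ** B) \<le> spectral_norm A * spectral_norm B"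
  using onorm_compose[OF matrix_vector_mul_bounded_linear[of A] matrix_vector_mul_bounded_linear[of B]]
  by (simp add: spectral_norm_def o_def matrix_vector_mul_assoc)

lemma spectral_norm_sq_le_frob: "(spectral_norm M)\<^sup>2 \<le> frob M"
proof -
  have "norm (M *v v) \<le> sqrt (frob M) * norm v" for v
  proof (rule power2_le_imp_le)
    \<comment> \<open>Lagrange's identity for each row: the defect in the Cauchy-Schwarz inequality
      is a square.\<close>
    have "(norm (M *v v))\<^sup>2 + (M$1$1 * v$2 - M$1$2 * v$1)\<^sup>2 + (M$2$1 * v$2 - M$2$2 * v$1)\<^sup>2
        = frob M * (norm v)\<^sup>2"
      unfolding norm_vec2_sq matrix_vector_mul_2 frob_def
      by (simp add: power2_eq_square algebra_simps)
    then have "(norm (M *v v))\<^sup>2 \<le> frob M * (norm v)\<^sup>2"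
      by (smt (verit) zero_le_power2)
    then show "(norm (M *v v))\<^sup>2 \<le> (sqrt (frob M) * norm v)\<^sup>2"
      by (simp add: power_mult_distrib frob_nonneg)
  qed (simp add: frob_nonneg)
  then have "spectral_norm M \<le> sqrt (frob M)"
    unfolding spectral_norm_def by (rule onorm_le)
  then have "(spectral_norm M)\<^sup>2 \<le> (sqrt (frob M))\<^sup>2"
    by (rule power_mono) (rule spectral_norm_nonneg)
  then show ?thesis by (simp add: frob_nonneg)
qed

lemma frob_le_spectral_norm_sq: "frob M \<le> 2 * (spectral_norm M)\<^sup>2"
proof -
  have *: "(norm (M *v axis i 1))\<^sup>2 \<le> (spectral_norm M)\<^sup>2" for i
    using spectral_norm_bound[of M "axis i 1"] by (intro power_mono) auto
  have "frob M = (norm (M *v axis 1 1))\<^sup>2 + (norm (M *v axis 2 1))\<^sup>2"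
    unfolding norm_vec2_sq matrix_vector_mul_2 frob_def by (simp add: axis_def)
  then show ?thesis using *[of 1] *[of 2] by simp
qed

lemma spectral_norm_ge_1:
  assumes "det M = 1"
  shows "1 \<le> spectral_norm M"
proof -
  have "1\<^sup>2 \<le> (spectral_norm M)\<^sup>2"
    using frob_ge_2[OF assms] frob_le_spectral_norm_sq[of M] by simp
  then show ?thesis using spectral_norm_nonneg power2_le_imp_le by blast
qed


section \<open>Matrix products along finite words\<close>

text \<open>Words as lists, in contrast to the functions in \<open>words\<close>, so that they can
  be concatenated and cut.\<close>

definition word_set :: "nat \<Rightarrow> nat list set"
  where "word_set n = {xs. set xs \<subseteq> {1, 2} \<and> length xs = n}"

text \<open>The head of the list is time zero and hence the rightmost factor; concatenation becomes
  multiplication in the opposite order.\<close>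

primrec word_matrix :: "(nat \<Rightarrow> real^2^2) \<Rightarrow> nat list \<Rightarrow> real^2^2"
  where
    "word_matrix A [] = mat 1"
  | "word_matrix A (i # xs) = word_matrix A xs ** A i"

lemma word_matrix_append: "word_matrix A (xs @ ys) = word_matrix A ys ** word_matrix A xs"
  by (induction xs) (simp_all add: matrix_mul_assoc)

lemma cocycle_eq_word_matrix: "cocycle A n x = word_matrix A (map x [0..<n])"
  by (induction n) (simp_all add: word_matrix_append)

lemma finite_word_set [simp, intro]: "finite (word_set n)"
  unfolding word_set_def using finite_lists_length_eq[of "{1,2::nat}" n] by simp

lemma card_word_set: "card (word_set n) = 2 ^ n"
  unfolding word_set_def using card_lists_length_eq[of "{1, 2::nat}" n] by (simp add: numeral_2_eq_2)

lemma word_set_append: "xs \<in> word_set m \<Longrightarrow> ys \<in> word_set n \<Longrightarrow> xs @ ys \<in> word_set (m + n)"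
  by (auto simp: word_set_def)

lemma word_set_0 [simp]: "word_set 0 = {[]}"
  by (auto simp: word_set_def)

lemma sum_word_set_append:
  "(\<Sum>w\<in>word_set (m + n). f w) = (\<Sum>xs\<in>word_set m. \<Sum>ys\<in>word_set n. f (xs @ ys))"
proof -
  have "bij_betw (\<lambda>(xs, ys). xs @ ys) (word_set m \<times> word_set n) (word_set (m + n))"
    by (rule bij_betwI[of _ _ _ "\<lambda>w. (take m w, drop m w)"])
      (auto simp: word_set_def dest: in_set_takeD in_set_dropD)
  from sum.reindex_bij_betw[OF this, of f, symmetric] show ?thesis
    by (simp add: sum.cartesian_product split_def)
qed

lemma bij_betw_words: "bij_betw (\<lambda>I. map I [0..<n]) (words n) (word_set n)"
proof (rule bij_betwI[of _ _ _ "\<lambda>xs i. if i < n then xs ! i else undefined"])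
  show "(\<lambda>I. map I [0..<n]) \<in> words n \<rightarrow> word_set n"
    by (auto simp: words_def word_set_def PiE_def Pi_def)
  show "(\<lambda>xs i. if i < n then xs ! i else undefined) \<in> word_set n \<rightarrow> words n"
    by (auto simp: words_def word_set_def PiE_def Pi_def extensional_def dest!: nth_mem)
  show "(\<lambda>i. if i < n then map I [0..<n] ! i else undefined) = I" if "I \<in> words n" for I
    using that by (auto simp: words_def PiE_def extensional_def)
  show "map (\<lambda>i. if i < n then xs ! i else undefined) [0..<n] = xs" if "xs \<in> word_set n" for xs
    using that by (auto simp: word_set_def intro!: nth_equalityI)
qed

lemma sum_words: "(\<Sum>I\<in>words n. f (map I [0..<n])) = (\<Sum>w\<in>word_set n. f w)"
  using sum.reindex_bij_betw[OF bij_betw_words, of f n] by simp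


section \<open>The pressure function\<close>

lemma det_generators: "lam \<noteq> 0 \<Longrightarrow> det (generators lam \<theta> i) = 1"
  by (simp add: generators_def hyperbolic_matrix_def rotation_matrix_def det_2
      flip: power2_eq_square)

locale hyperbolic_rotation =
  fixes lam \<theta> :: real
  assumes lam: "lam > 1" and irrational: "\<theta> \<notin> \<rat>"
begin

abbreviation wm :: "nat list \<Rightarrow> real^2^2"
  where "wm \<equiv> word_matrix (generators lam \<theta>)"

definition partition_sum :: "real \<Rightarrow> nat \<Rightarrow> real"
  where "partition_sum t n = (\<Sum>w\<in>word_set n. spectral_norm (wm w) powr t)"

definition P :: "real \<Rightarrow> real"
  where "P t = lim (\<lambda>n. ln (partition_sum t n) / n)"

lemma det_wm: "det (wm w) = 1"
  using lam by (induction w) (simp_all add: det_mul det_generators)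

lemma sn_ge_1: "1 \<le> spectral_norm (wm w)"
  by (rule spectral_norm_ge_1[OF det_wm])

lemma sn_pos: "0 < spectral_norm (wm w)"
  using sn_ge_1[of w] by linarith

lemma P_eq: "pressure (potential (generators lam \<theta>) t) = P t"
proof -
  have "(\<Sum>I\<in>words n. spectral_norm (cocycle (generators lam \<theta>) n I) powr t) = partition_sum t n" for n
    unfolding partition_sum_def cocycle_eq_word_matrix by (rule sum_words)
  then show ?thesis
    unfolding P_def using lam by (subst pressure_potential) (simp_all add: det_generators)
qed

lemma partition_sum_pos: "0 < partition_sum t n"
proof -
  have "word_set n \<noteq> {}" using card_word_set[of n] by auto
  then show ?thesis unfolding partition_sum_def
    using sn_pos by (intro sum_pos) (auto simp: less_imp_neq[symmetric])
qed

lemma partition_sum_append_le: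
  assumes "t \<ge> 0"
  shows "partition_sum t (m + n) \<le> partition_sum t m * partition_sum t n"
  unfolding partition_sum_def sum_word_set_append sum_product
proof (intro sum_mono)
  fix x y
  have "spectral_norm (wm (x @ y)) powr t \<le> (spectral_norm (wm y) * spectral_norm (wm x)) powr t"
    unfolding word_matrix_append
    by (rule powr_mono2[OF assms spectral_norm_nonneg spectral_norm_mult])
  then show "spectral_norm (wm (x @ y)) powr t \<le> spectral_norm (wm x) powr t * spectral_norm (wm y) powr t"
    by (simp add: powr_mult spectral_norm_nonneg mult.commute)
qed

lemma partition_sum_append_ge:
  assumes "t \<le> 0"
  shows "partition_sum t m * partition_sum t n \<le> partition_sum t (m + n)"
  unfolding partition_sum_def sum_word_set_append sum_product
proof (intro sum_mono)
  fix x y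
  have "(spectral_norm (wm y) * spectral_norm (wm x)) powr t \<le> spectral_norm (wm (x @ y)) powr t"
    using assms spectral_norm_mult[of "wm y" "wm x"] sn_pos[of "x @ y"]
    unfolding word_matrix_append by (intro powr_mono2') auto
  then show "spectral_norm (wm x) powr t * spectral_norm (wm y) powr t \<le> spectral_norm (wm (x @ y)) powr t"
    by (simp add: powr_mult spectral_norm_nonneg mult.commute)
qed

lemma partition_sum_0: "partition_sum 0 n = 2 ^ n"
  using sn_pos by (simp add: partition_sum_def card_word_set less_imp_neq[symmetric])

lemma partition_sum_mono: "t \<le> t' \<Longrightarrow> partition_sum t n \<le> partition_sum t' n"
  unfolding partition_sum_def by (intro sum_mono powr_mono sn_ge_1)

lemma ln_partition_sum_mono: "t \<le> t' \<Longrightarrow> ln (partition_sum t n) \<le> ln (partition_sum t' n)"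
  using partition_sum_pos partition_sum_mono by simp

text \<open>Fekete's lemma wants a nonnegative subadditive sequence. For \<open>t \<ge> 0\<close>
  this is the logarithm itself; for negative \<open>t\<close> submultiplicativity of the norm
  reverses, and the deficit from \<open>n * ln 2\<close> is used, which is nonnegative by
  monotonicity in \<open>t\<close>.\<close>

lemma P_convergent: "convergent (\<lambda>n. ln (partition_sum t n) / n)"
proof (cases "t \<ge> 0")
  case True
  show ?thesis
  proof (rule subadditive_convergent(1))
    show "ln (partition_sum t (m + n)) \<le> ln (partition_sum t m) + ln (partition_sum t n)" for m n
      using partition_sum_append_le[OF True, of m n] partition_sum_pos
      by (simp flip: ln_mult_pos)
    show "0 \<le> ln (partition_sum t n)" for n
      using ln_partition_sum_mono[OF True, of n] by (simp add: partition_sum_0 ln_realpow)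
         (smt (verit) ln_gt_zero mult_nonneg_nonneg of_nat_0_le_iff)
  qed
next
  case False
  have "convergent (\<lambda>n. (n * ln 2 - ln (partition_sum t n)) / n)"
  proof (rule subadditive_convergent(1))
    show "real (m + n) * ln 2 - ln (partition_sum t (m + n))
      \<le> real m * ln 2 - ln (partition_sum t m) + (real n * ln 2 - ln (partition_sum t n))" for m n
      using partition_sum_append_ge[of t m n] False partition_sum_pos
      by (simp add: algebra_simps flip: ln_mult_pos)
    show "0 \<le> real n * ln 2 - ln (partition_sum t n)" for n
      using ln_partition_sum_mono[of t 0 n] False by (simp add: partition_sum_0 ln_realpow)
  qed
  then obtain l where "(\<lambda>n. (n * ln 2 - ln (partition_sum t n)) / n) \<longlonglongrightarrow> l"
    by (auto simp: convergent_def)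
  from tendsto_diff[OF tendsto_const[of "ln 2"] this]
  have "(\<lambda>n. ln 2 - (n * ln 2 - ln (partition_sum t n)) / n) \<longlonglongrightarrow> ln 2 - l" .
  moreover have "\<forall>\<^sub>F n in sequentially. ln 2 - (n * ln 2 - ln (partition_sum t n)) / n = ln (partition_sum t n) / n"
    using eventually_gt_at_top[of 0] by eventually_elim (simp add: field_simps)
  ultimately have "(\<lambda>n. ln (partition_sum t n) / n) \<longlonglongrightarrow> ln 2 - l"
    by (rule Lim_transform_eventually)
  then show ?thesis by (auto simp: convergent_def)
qed

lemma P_LIMSEQ: "(\<lambda>n. ln (partition_sum t n) / n) \<longlonglongrightarrow> P t"
  unfolding P_def using P_convergent convergent_LIMSEQ_iff by blast

lemma P_mono: "t \<le> t' \<Longrightarrow> P t \<le> P t'"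
  by (rule LIMSEQ_le[OF P_LIMSEQ P_LIMSEQ]) (auto intro!: divide_right_mono ln_partition_sum_mono)

lemma P_0: "P 0 = ln 2"
proof -
  have "\<forall>\<^sub>F n in sequentially. ln 2 = ln (partition_sum 0 n) / n"
    using eventually_gt_at_top[of 0] by eventually_elim (simp add: partition_sum_0 ln_realpow)
  then have "(\<lambda>n. ln (partition_sum 0 n) / n) \<longlonglongrightarrow> ln 2"
    by (rule Lim_transform_eventually[OF tendsto_const])
  then show ?thesis using P_LIMSEQ LIMSEQ_unique by blast
qed

lemma frob_rotation_mult: "frob (rotation_matrix \<theta> ** M) = frob M"
proof -
  have *: "(c * a - s * b)\<^sup>2 + (s * a + c * b)\<^sup>2 = (a\<^sup>2 + b\<^sup>2) * (s\<^sup>2 + c\<^sup>2)" for a b c s :: real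
    by (simp add: power2_eq_square algebra_simps)
  show ?thesis
    using *[of "cos (2 * pi * \<theta>)" "M$1$1" "sin (2 * pi * \<theta>)" "M$2$1"]
      *[of "cos (2 * pi * \<theta>)" "M$1$2" "sin (2 * pi * \<theta>)" "M$2$2"]
    by (simp add: frob_def matrix_mul_2 rotation_matrix_def)
qed

lemma spectral_norm_generator_le: "spectral_norm (generators lam \<theta> i) \<le> lam"
proof -
  have "norm (generators lam \<theta> i *v v) \<le> lam * norm v" for v
  proof (rule power2_le_imp_le)
    show "(norm (generators lam \<theta> i *v v))\<^sup>2 \<le> (lam * norm v)\<^sup>2"
    proof (cases "i = 1")
      case True
      have "(v$2 / lam)\<^sup>2 \<le> (lam * v$2)\<^sup>2"
        using lam by (simp add: power_divide power_mult_distrib divide_le_eq)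
          (smt (verit) mult_le_cancel_left1 mult_right_le_one_le one_le_power zero_le_power2 mult.assoc mult.commute)
      then show ?thesis using True
        by (simp add: norm_vec2_sq matrix_vector_mul_2 generators_def hyperbolic_matrix_def
            power_mult_distrib algebra_simps)
    next
      case False
      have "(norm (generators lam \<theta> i *v v))\<^sup>2 = ((v$1)\<^sup>2 + (v$2)\<^sup>2) *
        ((sin (2 * pi * \<theta>))\<^sup>2 + (cos (2 * pi * \<theta>))\<^sup>2)"
      proof -
        have "(c * a - s * b)\<^sup>2 + (s * a + c * b)\<^sup>2 = (a\<^sup>2 + b\<^sup>2) * (s\<^sup>2 + c\<^sup>2)" for a b c s :: real
          by (simp add: power2_eq_square algebra_simps)
        then show ?thesis
          using False by (simp del: sin_cos_squared_add add: norm_vec2_sq matrix_vector_mul_2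
              generators_def rotation_matrix_def)
      qed
      also have "\<dots> = (norm v)\<^sup>2" by (simp add: norm_vec2_sq)
      also have "\<dots> \<le> (lam * norm v)\<^sup>2"
        using lam by (intro power_mono) (auto simp: mult_le_cancel_right1)
      finally show ?thesis .
    qed
  qed (use lam in auto)
  then show ?thesis unfolding spectral_norm_def by (rule onorm_le)
qed

lemma spectral_norm_wm_le: "spectral_norm (wm w) \<le> lam ^ length w"
proof (induction w)
  case Nil
  have "norm (mat 1 *v v) \<le> 1 * norm v" for v :: "real^2" by simp
  then have "spectral_norm (mat 1) \<le> 1" unfolding spectral_norm_def by (rule onorm_le)
  then show ?case by simp
next
  case (Cons i w)
  have "spectral_norm (wm (i # w)) \<le> spectral_norm (wm w) * spectral_norm (generators lam \<theta> i)"
    by (simp add: spectral_norm_mult)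
  also have "\<dots> \<le> lam ^ length w * lam"
    by (intro mult_mono Cons spectral_norm_generator_le spectral_norm_nonneg) (use lam in auto)
  finally show ?case by (simp add: mult.commute)
qed

text \<open>Each generator has norm at most \<open>lam\<close>, so raising the exponent multiplies
  every term by at most \<open>lam powr (n * (t' - t))\<close>. This supplies both the continuity at
  the transition point and its distance from 0.\<close>

lemma P_lipschitz:
  assumes "t \<le> t'"
  shows "P t' \<le> P t + (t' - t) * ln lam"
proof -
  have "partition_sum t' n \<le> partition_sum t n * lam powr (n * (t' - t))" for n
    unfolding partition_sum_def sum_distrib_right
  proof (rule sum_mono)
    fix w assume "w \<in> word_set n"
    then have l: "length w = n" by (simp add: word_set_def)
    have "spectral_norm (wm w) powr t' = spectral_norm (wm w) powr t * spectral_norm (wm w) powr (t' - t)"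
      by (simp flip: powr_add)
    also have "\<dots> \<le> spectral_norm (wm w) powr t * (lam ^ n) powr (t' - t)"
      using assms spectral_norm_wm_le[of w] l sn_pos[of w]
      by (intro mult_left_mono powr_mono2) auto
    also have "(lam ^ n) powr (t' - t) = lam powr (n * (t' - t))"
      using lam by (simp add: powr_powr flip: powr_realpow)
    finally show "spectral_norm (wm w) powr t' \<le> spectral_norm (wm w) powr t * lam powr (n * (t' - t))" .
  qed
  then have "ln (partition_sum t' n) \<le> ln (partition_sum t n) + n * (t' - t) * ln lam" for n
    using partition_sum_pos lam by (subst (asm) ln_le_cancel_iff[symmetric])
      (auto simp: ln_mult_pos ln_powr)
  then have "ln (partition_sum t' n) / n \<le> ln (partition_sum t n) / n + (t' - t) * ln lam" if "n > 0" for n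
    using that by (simp add: field_simps)
  moreover have "(\<lambda>n. ln (partition_sum t n) / n + (t' - t) * ln lam) \<longlonglongrightarrow> P t + (t' - t) * ln lam"
    by (intro tendsto_intros P_LIMSEQ)
  ultimately show ?thesis
    by (intro LIMSEQ_le[OF P_LIMSEQ]) (auto intro!: exI[of _ 1])
qed

end


section \<open>Correcting words\<close>

text \<open>Dirichlet's theorem gives a multiple \<open>q * \<alpha>\<close> that misses an integer
  by some nonzero \<open>d\<close> smaller than \<open>\<delta>\<close>. The multiples of
  \<open>d\<close> walk around the circle in steps shorter than \<open>\<delta>\<close>, so a number
  of steps depending on \<open>d\<close> alone reaches every target.\<close>

lemma irrational_rotation_uniformly_dense:
  fixes \<alpha> \<delta> :: real
  assumes "\<alpha> \<notin> \<rat>" "\<delta> > 0"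
  obtains K :: nat where "\<And>x. \<exists>k\<le>K. \<exists>m::int. \<bar>k * \<alpha> - x - m\<bar> < \<delta>"
proof -
  obtain N :: nat where N: "N > 0" "1 / N < \<delta>"
    using assms(2) by (metis nat_approx_posE of_nat_0_less_iff zero_less_Suc)
  obtain p q :: int where q: "0 < q" and pq: "\<bar>q * \<alpha> - p\<bar> < 1 / N"
    using Dirichlet_approx[OF N(1), of \<alpha>] by metis
  define d where "d = q * \<alpha> - p"
  have d0: "d \<noteq> 0"
  proof
    assume "d = 0"
    then have "\<alpha> = p / q" using q by (simp add: d_def field_simps)
    then show False using assms(1) by simp
  qed
  define J where "J = nat \<lceil>1 / \<bar>d\<bar>\<rceil>"
  have approx: "\<exists>j\<le>J. \<bar>j * \<bar>d\<bar> - frac y\<bar> < \<delta>" for y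
  proof -
    define j where "j = nat \<lfloor>frac y / \<bar>d\<bar>\<rfloor>"
    have j: "j = \<lfloor>frac y / \<bar>d\<bar>\<rfloor>" by (simp add: j_def)
    have "frac y / \<bar>d\<bar> \<le> 1 / \<bar>d\<bar>"
      using frac_lt_1[of y] d0 by (intro divide_right_mono) auto
    then have "j \<le> J" unfolding j_def J_def by linarith
    moreover have "real j \<le> frac y / \<bar>d\<bar>" "frac y / \<bar>d\<bar> < real j + 1"
      using j by linarith+
    then have "\<bar>j * \<bar>d\<bar> - frac y\<bar> \<le> \<bar>d\<bar>"
      using d0 by (simp add: field_simps abs_le_iff)
    ultimately show ?thesis using pq N(2) by (auto simp: d_def intro!: exI[of _ j])
  qed
  show thesis
  proof (rule that[of "J * nat q"])
    fix x
    show "\<exists>k\<le>J * nat q. \<exists>m::int. \<bar>k * \<alpha> - x - m\<bar> < \<delta>"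
    proof (cases "d > 0")
      case True
      obtain j where j: "j \<le> J" "\<bar>j * d - frac x\<bar> < \<delta>" using approx[of x] True by auto
      have "real (j * nat q) * \<alpha> - x - of_int (int j * p - \<lfloor>x\<rfloor>) = j * d - frac x"
        using q by (simp add: d_def frac_def algebra_simps)
      then show ?thesis using j by (intro exI[of _ "j * nat q"] conjI exI[of _ "int j * p - \<lfloor>x\<rfloor>"]) auto
    next
      \<comment> \<open>The walk goes backwards here, so it is aimed at the reflected target
        \<open>-x\<close>.\<close>
      case False
      obtain j where j: "j \<le> J" "\<bar>j * (-d) - frac (-x)\<bar> < \<delta>" using approx[of "-x"] False by auto
      have "real (j * nat q) * \<alpha> - x - of_int (int j * p + \<lfloor>-x\<rfloor>) = - (j * (-d) - frac (-x))"
        using q by (simp add: d_def frac_def algebra_simps)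
      then show ?thesis using j by (intro exI[of _ "j * nat q"] conjI exI[of _ "int j * p + \<lfloor>-x\<rfloor>"]) auto
    qed
  qed
qed

lemma rotation_matrix_add: "rotation_matrix a ** rotation_matrix b = rotation_matrix (a + b)"
proof -
  have "2 * pi * (a + b) = 2 * pi * a + 2 * pi * b" by (simp add: algebra_simps)
  then show ?thesis
    by (simp add: vec_eq_iff forall_2 matrix_mul_2 rotation_matrix_def cos_add sin_add)
qed

lemma rotation_matrix_0: "rotation_matrix 0 = mat 1"
  by (simp add: vec_eq_iff forall_2 rotation_matrix_def mat_def)

text \<open>The squared length of the first row is a quadratic form in the cosine and sine of the
  angle, hence a sinusoid in the doubled angle. Determinant one fixes its amplitude.\<close>

lemma rotated_first_row:
  assumes "det M = 1"
  obtains \<phi> where "\<And>a. ((rotation_matrix a ** M)$1$1)\<^sup>2 + ((rotation_matrix a ** M)$1$2)\<^sup>2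
      = frob M / 2 + sqrt ((frob M)\<^sup>2 / 4 - 1) * cos (2 * (2 * pi * a) + \<phi>)"
proof -
  \<comment> \<open>The Gram matrix of the rows has diagonal entries \<open>frob M / 2 + u\<close>
    and \<open>frob M / 2 - u\<close> and off-diagonal entry \<open>v\<close>; its determinant is
    the square of \<open>det M\<close>.\<close>
  define u where "u = ((M$1$1)\<^sup>2 + (M$1$2)\<^sup>2 - (M$2$1)\<^sup>2 - (M$2$2)\<^sup>2) / 2"
  define v where "v = M$1$1 * M$2$1 + M$1$2 * M$2$2"
  have "(frob M)\<^sup>2 / 4 - (det M)\<^sup>2 = u\<^sup>2 + v\<^sup>2"
    unfolding frob_def det_2 u_def v_def by (simp add: power2_eq_square field_simps)
  then have uv: "(frob M)\<^sup>2 / 4 - 1 = u\<^sup>2 + v\<^sup>2" using assms by simp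
  obtain \<phi> where \<phi>: "u = sqrt (u\<^sup>2 + v\<^sup>2) * cos \<phi>" "v = sqrt (u\<^sup>2 + v\<^sup>2) * sin \<phi>"
  proof (cases "u\<^sup>2 + v\<^sup>2 = 0")
    case True
    then show ?thesis using that[of 0] by (simp add: sum_power2_eq_zero_iff)
  next
    case False
    then have "(u / sqrt (u\<^sup>2 + v\<^sup>2))\<^sup>2 + (v / sqrt (u\<^sup>2 + v\<^sup>2))\<^sup>2 = 1"
      by (simp add: power_divide flip: add_divide_distrib)
    from sincos_total_2pi[OF this] obtain \<phi>
      where "u / sqrt (u\<^sup>2 + v\<^sup>2) = cos \<phi>" "v / sqrt (u\<^sup>2 + v\<^sup>2) = sin \<phi>" by metis
    then show ?thesis using that[of \<phi>] False by (simp add: field_simps)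
  qed
  show thesis
  proof (rule that[of \<phi>])
    fix a
    define b where "b = 2 * pi * a"
    have cs: "(cos b)\<^sup>2 = 1 / 2 + cos (2 * b) / 2" "(sin b)\<^sup>2 = 1 / 2 - cos (2 * b) / 2"
      unfolding cos_double sin_squared_eq by (simp_all add: field_simps)
    have cs': "cos b * sin b = sin (2 * b) / 2" by (simp add: sin_double)
    have "((rotation_matrix a ** M)$1$1)\<^sup>2 + ((rotation_matrix a ** M)$1$2)\<^sup>2
      = (cos b)\<^sup>2 * ((M$1$1)\<^sup>2 + (M$1$2)\<^sup>2) + (sin b)\<^sup>2 * ((M$2$1)\<^sup>2 + (M$2$2)\<^sup>2)
        - 2 * (cos b * sin b) * v"
      unfolding matrix_mul_2 rotation_matrix_def v_def b_def
      by (simp add: power2_eq_square algebra_simps)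
    also have "\<dots> = frob M / 2 + u * cos (2 * b) - v * sin (2 * b)"
      unfolding cs cs' by (simp add: u_def frob_def field_simps)
    also have "frob M / 2 + u * cos (2 * b) - v * sin (2 * b)
        = frob M / 2 + sqrt (u\<^sup>2 + v\<^sup>2) * cos (2 * b + \<phi>)"
    proof -
      define \<rho> where "\<rho> = sqrt (u\<^sup>2 + v\<^sup>2)"
      have "u = \<rho> * cos \<phi>" "v = \<rho> * sin \<phi>" using \<phi> by (simp_all only: \<rho>_def)
      then show ?thesis unfolding \<rho>_def[symmetric] by (simp add: cos_add algebra_simps)
    qed
    finally show "((rotation_matrix a ** M)$1$1)\<^sup>2 + ((rotation_matrix a ** M)$1$2)\<^sup>2
      = frob M / 2 + sqrt ((frob M)\<^sup>2 / 4 - 1) * cos (2 * (2 * pi * a) + \<phi>)"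
      using uv by (simp add: b_def algebra_simps)
  qed
qed

context hyperbolic_rotation
begin

lemma wm_replicate_2: "wm (replicate k 2) = rotation_matrix (k * \<theta>)"
  by (induction k) (simp_all add: rotation_matrix_0 generators_def rotation_matrix_add algebra_simps)

lemma frob_replicate_2: "frob (wm (replicate k 2) ** M) = frob M"
proof (induction k arbitrary: M)
  case (Suc k)
  have "wm (replicate (Suc k) 2) ** M = wm (replicate k 2) ** (rotation_matrix \<theta> ** M)"
    by (simp add: generators_def matrix_mul_assoc)
  then show ?case using Suc by (simp add: frob_rotation_mult)
qed simp

text \<open>The hyperbolic matrix stretches the first row, so that row should be short beforehand.
  It is shortest where the cosine in \<open>rotated_first_row\<close> is -1, and then its squared
  length is at most 1; the term with \<open>\<epsilon>\<close> pays for reaching the angle only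
  approximately. The doubled angle advances by \<open>2 * \<theta>\<close> turns per step, so one
  \<open>K\<close> serves all matrices.\<close>

lemma rotate_to_contracting_direction:
  assumes "\<epsilon> > 0" "\<epsilon> \<le> 1"
  obtains K :: nat where "\<And>M. det M = 1 \<Longrightarrow>
    \<exists>k\<le>K. ((wm (replicate k 2) ** M)$1$1)\<^sup>2 + ((wm (replicate k 2) ** M)$1$2)\<^sup>2 \<le> \<epsilon> * frob M / 2 + 1"
proof -
  have "isCont cos (0::real)" by (rule isCont_cos)
  then obtain \<delta>' where \<delta>': "\<delta>' > 0" "\<And>x::real. \<bar>x\<bar> < \<delta>' \<Longrightarrow> \<bar>cos x - 1\<bar> < \<epsilon>"
    unfolding continuous_at_eps_delta dist_real_def using assms(1) by fastforce
  have irr: "2 * \<theta> \<notin> \<rat>"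
  proof
    assume "2 * \<theta> \<in> \<rat>"
    then have "2 * \<theta> / 2 \<in> \<rat>" by (intro Rats_divide) auto
    then show False using irrational by simp
  qed
  have "\<delta>' / (2 * pi) > 0" using \<delta>' by simp
  then obtain K :: nat where K: "\<And>x. \<exists>k\<le>K. \<exists>m::int. \<bar>k * (2 * \<theta>) - x - m\<bar> < \<delta>' / (2 * pi)"
    using irrational_rotation_uniformly_dense[OF irr, of "\<delta>' / (2 * pi)"] by metis
  show thesis
  proof (rule that[of K])
    fix M :: "real^2^2" assume M: "det M = 1"
    obtain \<phi> where \<phi>: "\<And>a. ((rotation_matrix a ** M)$1$1)\<^sup>2 + ((rotation_matrix a ** M)$1$2)\<^sup>2
      = frob M / 2 + sqrt ((frob M)\<^sup>2 / 4 - 1) * cos (2 * (2 * pi * a) + \<phi>)"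
      using rotated_first_row[OF M] by metis
    \<comment> \<open>Measured in turns, \<open>1 / 2 - \<phi> / (2 * pi)\<close> is the doubled
      angle at which the cosine equals -1.\<close>
    obtain k m where k: "k \<le> K" and m: "\<bar>real k * (2 * \<theta>) - (1 / 2 - \<phi> / (2 * pi)) - of_int m\<bar> < \<delta>' / (2 * pi)"
      using K[of "1 / 2 - \<phi> / (2 * pi)"] by blast
    define e where "e = 2 * pi * (real k * (2 * \<theta>) - (1 / 2 - \<phi> / (2 * pi)) - of_int m)"
    have "\<bar>e\<bar> < \<delta>'"
    proof -
      have "\<bar>e\<bar> = 2 * pi * \<bar>real k * (2 * \<theta>) - (1 / 2 - \<phi> / (2 * pi)) - of_int m\<bar>"
        unfolding e_def by (simp add: abs_mult)
      also have "\<dots> < 2 * pi * (\<delta>' / (2 * pi))" by (rule mult_strict_left_mono[OF m]) simp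
      finally show ?thesis by simp
    qed
    then have cose: "cos e \<ge> 1 - \<epsilon>" using \<delta>'(2)[of e] by linarith
    have "2 * (2 * pi * (k * \<theta>)) + \<phi> = (e + pi) + 2 * pi * of_int m"
      by (simp add: e_def field_simps)
    then have "cos (2 * (2 * pi * (k * \<theta>)) + \<phi>) = cos (e + pi)"
      by (simp only: cos_add[of "e + pi"] cos_int_2pin sin_int_2pin)
    then have "cos (2 * (2 * pi * (k * \<theta>)) + \<phi>) \<le> - (1 - \<epsilon>)"
      using cose by simp
    then have "sqrt ((frob M)\<^sup>2 / 4 - 1) * cos (2 * (2 * pi * (k * \<theta>)) + \<phi>)
        \<le> sqrt ((frob M)\<^sup>2 / 4 - 1) * (- (1 - \<epsilon>))"
    proof (rule mult_left_mono)
      have "2\<^sup>2 \<le> (frob M)\<^sup>2" using frob_ge_2[OF M] by (intro power_mono) auto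
      then show "0 \<le> sqrt ((frob M)\<^sup>2 / 4 - 1)" by simp
    qed
    also have "\<dots> \<le> (frob M / 2 - 1) * (- (1 - \<epsilon>))"
    proof (rule mult_right_mono_neg)
      show "frob M / 2 - 1 \<le> sqrt ((frob M)\<^sup>2 / 4 - 1)"
      proof (rule real_le_rsqrt)
        have "(frob M / 2 - 1)\<^sup>2 = (frob M)\<^sup>2 / 4 - frob M + 1"
          by (simp add: power2_diff power_divide)
        then show "(frob M / 2 - 1)\<^sup>2 \<le> (frob M)\<^sup>2 / 4 - 1" using frob_ge_2[OF M] by simp
      qed
    qed (use assms in auto)
    finally have "((rotation_matrix (k * \<theta>) ** M)$1$1)\<^sup>2 + ((rotation_matrix (k * \<theta>) ** M)$1$2)\<^sup>2
        \<le> frob M / 2 + (frob M / 2 - 1) * (- (1 - \<epsilon>))"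
      unfolding \<phi> by simp
    also have "\<dots> = \<epsilon> * frob M / 2 + 1 - \<epsilon>" by (simp add: algebra_simps add_divide_distrib diff_divide_distrib)
    also have "\<dots> \<le> \<epsilon> * frob M / 2 + 1" using assms by simp
    finally show "\<exists>k\<le>K. ((wm (replicate k 2) ** M)$1$1)\<^sup>2 + ((wm (replicate k 2) ** M)$1$2)\<^sup>2
        \<le> \<epsilon> * frob M / 2 + 1"
      using k unfolding wm_replicate_2 by blast
  qed
qed

text \<open>One hyperbolic step in the contracting direction shrinks \<open>frob\<close> by a
  definite factor, provided \<open>frob\<close> is large enough to absorb the additive error of the
  rotation.\<close>

lemma contracting_word:
  obtains K F0 \<kappa> where "0 < \<kappa>" "\<kappa> < 1"
    "\<And>M. det M = 1 \<Longrightarrow> F0 \<le> frob M \<Longrightarrow> \<exists>J\<in>word_set K. frob (wm J ** M) \<le> \<kappa> * frob M"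
proof -
  \<comment> \<open>With a vanishing first row the hyperbolic matrix would save the share
    \<open>c\<close> of \<open>frob\<close>. The values of \<open>\<epsilon>\<close> and of the
    threshold \<open>4 * lam\<^sup>2 / c\<close> let the inexact angle and the additive 1 spend a
    quarter of \<open>c\<close> each, so half of it remains.\<close>
  define c where "c = 1 - 1 / lam\<^sup>2"
  have c: "0 < c" "c < 1" using lam by (auto simp: c_def field_simps one_less_power)
  have lam2: "1 < lam\<^sup>2" using lam by (simp add: one_less_power)
  define \<epsilon> where "\<epsilon> = c / (2 * lam\<^sup>2)"
  have "0 < 2 * lam\<^sup>2" using lam2 by linarith
  then have \<epsilon>: "\<epsilon> > 0" unfolding \<epsilon>_def using c(1) by (rule divide_pos_pos[rotated])
  have "c \<le> 1 * (2 * lam\<^sup>2)" using c lam2 by linarith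
  then have \<epsilon>': "\<epsilon> \<le> 1" unfolding \<epsilon>_def using \<open>0 < 2 * lam\<^sup>2\<close> by (subst pos_divide_le_eq)
  obtain K :: nat where K: "\<And>M. det M = 1 \<Longrightarrow>
    \<exists>k\<le>K. ((wm (replicate k 2) ** M)$1$1)\<^sup>2 + ((wm (replicate k 2) ** M)$1$2)\<^sup>2 \<le> \<epsilon> * frob M / 2 + 1"
    using rotate_to_contracting_direction[OF \<epsilon> \<epsilon>'] by metis
  show thesis
  proof (rule that[of "1 - c / 2" "4 * lam\<^sup>2 / c" "Suc K"])
    fix M :: "real^2^2" assume M: "det M = 1" and F0: "4 * lam\<^sup>2 / c \<le> frob M"
    obtain k where k: "k \<le> K" and row: "((wm (replicate k 2) ** M)$1$1)\<^sup>2 + ((wm (replicate k 2) ** M)$1$2)\<^sup>2 \<le> \<epsilon> * frob M / 2 + 1"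
      using K[OF M] by blast
    \<comment> \<open>Trailing rotations leave \<open>frob\<close> unchanged and give all correcting
      words the same length.\<close>
    define J where "J = replicate k 2 @ 1 # replicate (K - k) (2::nat)"
    have J: "J \<in> word_set (Suc K)" using k by (auto simp: J_def word_set_def)
    define M' where "M' = wm (replicate k 2) ** M"
    define r where "r = (M'$1$1)\<^sup>2 + (M'$1$2)\<^sup>2"
    have "wm J ** M = wm (replicate (K - k) 2) ** (hyperbolic_matrix lam ** M')"
      by (simp add: J_def word_matrix_append generators_def matrix_mul_assoc M'_def)
    then have "frob (wm J ** M) = frob (hyperbolic_matrix lam ** M')"
      by (simp add: frob_replicate_2)
    also have "\<dots> = lam\<^sup>2 * r + (frob M' - r) / lam\<^sup>2"
      by (simp add: frob_def r_def hyperbolic_matrix_def matrix_mul_2 power_mult_distrib power_divide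
          add_divide_distrib distrib_left)
    also have "frob M' = frob M" by (simp add: M'_def frob_replicate_2)
    also have "lam\<^sup>2 * r + (frob M - r) / lam\<^sup>2 \<le> lam\<^sup>2 * r + frob M / lam\<^sup>2"
      using lam by (intro add_left_mono divide_right_mono) (auto simp: r_def)
    also have "\<dots> \<le> lam\<^sup>2 * (\<epsilon> * frob M / 2 + 1) + frob M / lam\<^sup>2"
      using row lam by (intro add_right_mono mult_left_mono) (auto simp: r_def M'_def)
    also have "lam\<^sup>2 * (\<epsilon> * frob M / 2 + 1) = c * frob M / 4 + lam\<^sup>2"
      using lam by (simp add: \<epsilon>_def field_simps)
    also have "c * frob M / 4 + lam\<^sup>2 \<le> c * frob M / 2"
      using F0 c by (simp add: field_simps)
    also have "c * frob M / 2 + frob M / lam\<^sup>2 = (1 - c / 2) * frob M"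
      by (simp add: c_def field_simps)
    finally show "\<exists>J\<in>word_set (Suc K). frob (wm J ** M) \<le> (1 - c / 2) * frob M" using J by force
  qed (use c in auto)
qed

text \<open>Contracting words are applied while the product is above the threshold, and rotations as
  padding once it is below. The length depends on the scale \<open>j\<close> only and not on the
  matrix, which makes appending such a word injective and keeps blocks of equal length.\<close>

lemma correcting_word:
  obtains K F0 \<kappa> where "0 < \<kappa>" "\<kappa> < 1" "2 \<le> F0"
    "\<And>j M. det M = 1 \<Longrightarrow> frob M \<le> F0 / \<kappa> ^ j \<Longrightarrow> \<exists>J\<in>word_set (j * K). frob (wm J ** M) \<le> F0"
proof -
  obtain K F1 \<kappa> where \<kappa>: "0 < \<kappa>" "\<kappa> < 1" and
    K: "\<And>M. det M = 1 \<Longrightarrow> F1 \<le> frob M \<Longrightarrow> \<exists>J\<in>word_set K. frob (wm J ** M) \<le> \<kappa> * frob M"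
    using contracting_word by metis
  define F0 where "F0 = max 2 F1"
  have "\<exists>J\<in>word_set (j * K). frob (wm J ** M) \<le> F0" if "det M = 1" "frob M \<le> F0 / \<kappa> ^ j" for j M
    using that
  proof (induction j arbitrary: M)
    case (Suc j)
    obtain J where J: "J \<in> word_set K" "frob (wm J ** M) \<le> F0 / \<kappa> ^ j"
    proof (cases "F0 \<le> frob M")
      case True
      then obtain J where J: "J \<in> word_set K" "frob (wm J ** M) \<le> \<kappa> * frob M"
        using K[OF Suc.prems(1)] by (auto simp: F0_def)
      have "\<kappa> * frob M \<le> \<kappa> * (F0 / \<kappa> ^ Suc j)" using Suc.prems(2) \<kappa> by (intro mult_left_mono) auto
      also have "\<dots> = F0 / \<kappa> ^ j" using \<kappa> by simp
      finally show ?thesis using that[of J] J by simp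
    next
      case False
      have "replicate K 2 \<in> word_set K" by (auto simp: word_set_def)
      moreover have "F0 \<le> F0 / \<kappa> ^ j"
        using \<kappa> by (simp add: F0_def le_divide_eq power_le_one mult_left_le)
      ultimately show ?thesis using that[of "replicate K 2"] False by (simp add: frob_replicate_2)
    qed
    moreover have "det (wm J ** M) = 1" using Suc.prems by (simp add: det_mul det_wm)
    ultimately obtain J' where J': "J' \<in> word_set (j * K)" "frob (wm J' ** (wm J ** M)) \<le> F0"
      using Suc.IH by blast
    have "J @ J' \<in> word_set (Suc j * K)" using word_set_append[OF J(1) J'(1)] by simp
    moreover have "wm (J @ J') ** M = wm J' ** (wm J ** M)"
      by (simp add: word_matrix_append matrix_mul_assoc)
    ultimately show ?case using J'(2) by metis
  qed (use frob_ge_2 in auto)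
  then show thesis using that[of \<kappa> F0 K] \<kappa> by (simp add: F0_def)
qed

end


section \<open>Strict decay of the average of the norms to a negative power\<close>

text \<open>On boxes: the preimage is the image under the inverse \<open>adj2 g\<close>, a linear
  map of determinant one. This is what makes composition with a product of generators an isometry of
  the square integrable functions.\<close>

lemma lborel_distr_det_1:
  fixes g :: "real^2^2"
  assumes "det g = 1"
  shows "distr lborel borel (\<lambda>v. g *v v) = lborel"
proof (rule lborel_eqI[symmetric])
  fix l u :: "real^2" assume lu: "\<And>b. b \<in> Basis \<Longrightarrow> l \<bullet> b \<le> u \<bullet> b"
  have inv: "adj2 g *v (g *v v) = v" "g *v (adj2 g *v v) = v" for v
    using assms by (simp_all add: matrix_vector_mul_assoc adj2_mult)
  have vim: "(\<lambda>v. g *v v) -` box l u = (\<lambda>v. adj2 g *v v) ` box l u"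
    using inv by (auto simp: image_iff) metis
  have cont: "(\<lambda>v. g *v v) \<in> borel_measurable borel"
    by (intro borel_measurable_continuous_onI linear_continuous_on matrix_vector_mul_bounded_linear)
  have det: "det (adj2 g) = 1" using assms by (simp add: adj2_def det_2 mult.commute)
  have meas: "(\<lambda>v. adj2 g *v v) ` box l u \<in> sets borel"
    using measurable_sets[OF cont, of "box l u"] by (simp add: vim)
  have lin: "linear (\<lambda>v. adj2 g *v v)" by simp
  have lm: "(\<lambda>v. adj2 g *v v) ` box l u \<in> lmeasurable"
    by (rule measurable_linear_image[OF lin]) simp
  have "emeasure (distr lborel borel (\<lambda>v. g *v v)) (box l u) = emeasure lborel ((\<lambda>v. adj2 g *v v) ` box l u)"
    using cont by (simp add: emeasure_distr vim)
  also have "\<dots> = emeasure lebesgue ((\<lambda>v. adj2 g *v v) ` box l u)" using meas by simp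
  also have "\<dots> = measure lebesgue ((\<lambda>v. adj2 g *v v) ` box l u)"
    using lm by (rule emeasure_eq_measure2)
  also have "measure lebesgue ((\<lambda>v. adj2 g *v v) ` box l u) = measure lebesgue (box l u)"
    by (subst measure_linear_image[OF lin]) (simp_all add: det)
  also have "ennreal (measure lebesgue (box l u)) = emeasure lborel (box l u)"
    by (subst emeasure_eq_measure2[of "box l u" lborel]) auto
  finally show "emeasure (distr lborel borel (\<lambda>v. g *v v)) (box l u) = (\<Prod>b\<in>Basis. (u - l) \<bullet> b)"
    using lu by simp
qed simp

lemma measurable_matrix_vector_mult [measurable]: "(\<lambda>v. (g::real^2^2) *v v) \<in> borel_measurable borel"
  by (intro borel_measurable_continuous_onI linear_continuous_on matrix_vector_mul_bounded_linear)

definition square_integrable :: "(real^2 \<Rightarrow> real) \<Rightarrow> bool"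
  where "square_integrable f \<longleftrightarrow> f \<in> borel_measurable borel \<and> integrable lborel (\<lambda>v. (f v)\<^sup>2)"

lemma integral_det_1:
  fixes f :: "real^2 \<Rightarrow> real"
  assumes "det g = 1" "f \<in> borel_measurable borel"
  shows "(\<integral>v. f (g *v v) \<partial>lborel) = (\<integral>v. f v \<partial>lborel)"
    and "integrable lborel (\<lambda>v. f (g *v v)) \<longleftrightarrow> integrable lborel f"
proof -
  have m: "(\<lambda>v. g *v v) \<in> measurable lborel borel" by simp
  show "(\<integral>v. f (g *v v) \<partial>lborel) = (\<integral>v. f v \<partial>lborel)"
    using integral_distr[OF m assms(2)] by (simp add: lborel_distr_det_1[OF assms(1)])
  show "integrable lborel (\<lambda>v. f (g *v v)) \<longleftrightarrow> integrable lborel f"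
    using integrable_distr_eq[OF m assms(2)] by (simp add: lborel_distr_det_1[OF assms(1)])
qed

lemma square_integrable_measurable: "square_integrable f \<Longrightarrow> f \<in> borel_measurable borel"
  by (simp add: square_integrable_def)

lemma square_integrable_comp:
  assumes "square_integrable f" "det g = 1"
  shows "square_integrable (\<lambda>v. f (g *v v))"
  unfolding square_integrable_def
proof
  note [measurable] = square_integrable_measurable[OF assms(1)]
  show "(\<lambda>v. f (g *v v)) \<in> borel_measurable borel" by measurable
  show "integrable lborel (\<lambda>v. (f (g *v v))\<^sup>2)"
    using integral_det_1(2)[OF assms(2), of "\<lambda>v. (f v)\<^sup>2"] assms(1) by (simp add: square_integrable_def)
qed

lemma square_integrable_comp_norm:
  assumes "square_integrable f" "det g = 1"
  shows "(\<integral>v. (f (g *v v))\<^sup>2 \<partial>lborel) = (\<integral>v. (f v)\<^sup>2 \<partial>lborel)"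
  using integral_det_1(1)[OF assms(2) borel_measurable_power[OF square_integrable_measurable[OF assms(1)], of 2]]
  by simp

lemma square_integrable_add:
  assumes "square_integrable f" "square_integrable g"
  shows "square_integrable (\<lambda>v. f v + g v)"
proof -
  note [measurable] = assms[THEN square_integrable_measurable]
  have "integrable lborel (\<lambda>v. (f v + g v)\<^sup>2)"
  proof (rule Bochner_Integration.integrable_bound)
    show "integrable lborel (\<lambda>v. 2 * (f v)\<^sup>2 + 2 * (g v)\<^sup>2)"
      using assms by (auto simp: square_integrable_def)
    have "(a + b)\<^sup>2 \<le> 2 * a\<^sup>2 + 2 * b\<^sup>2" for a b :: real
      using zero_le_power2[of "a - b"] by (simp add: power2_eq_square algebra_simps)
    then show "AE v in lborel. norm ((f v + g v)\<^sup>2) \<le> norm (2 * (f v)\<^sup>2 + 2 * (g v)\<^sup>2)" by simp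
  qed simp
  then show ?thesis by (simp add: square_integrable_def)
qed

lemma square_integrable_scale:
  assumes "square_integrable f"
  shows "square_integrable (\<lambda>v. c * f v)"
  using assms by (auto simp: square_integrable_def power_mult_distrib)

lemma square_integrable_diff:
  assumes "square_integrable f" "square_integrable g"
  shows "square_integrable (\<lambda>v. f v - g v)"
  using square_integrable_add[OF assms(1) square_integrable_scale[OF assms(2), of "-1"]] by simp

lemma square_integrable_sum:
  assumes "finite I" "\<And>i. i \<in> I \<Longrightarrow> square_integrable (f i)"
  shows "square_integrable (\<lambda>v. \<Sum>i\<in>I. f i v)"
  using assms
proof (induction I rule: finite_induct)
  case empty
  then show ?case by (simp add: square_integrable_def)
next
  case (insert i I)
  then show ?case using square_integrable_add[of "f i" "\<lambda>v. \<Sum>i\<in>I. f i v"] by simp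
qed

text \<open>The defect in the Cauchy-Schwarz inequality is half the sum of all squared differences;
  the pairs \<open>(i, j)\<close> and \<open>(j, i)\<close> alone contribute the term kept
  here.\<close>

lemma square_of_sum_le:
  fixes a :: "'i \<Rightarrow> real"
  assumes "finite I" "i \<in> I" "j \<in> I" "i \<noteq> j"
  shows "(\<Sum>k\<in>I. a k)\<^sup>2 + (a i - a j)\<^sup>2 \<le> card I * (\<Sum>k\<in>I. (a k)\<^sup>2)"
proof -
  have "(\<Sum>p\<in>I \<times> I. (a (fst p) - a (snd p))\<^sup>2) = (\<Sum>k\<in>I. \<Sum>l\<in>I. (a k)\<^sup>2 + (a l)\<^sup>2 - 2 * (a k * a l))"
    by (simp add: sum.cartesian_product split_def power2_diff mult.assoc)
  also have "\<dots> = 2 * card I * (\<Sum>k\<in>I. (a k)\<^sup>2) - 2 * (\<Sum>k\<in>I. a k)\<^sup>2"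
    by (simp add: sum.distrib sum_subtractf power2_eq_square sum_product flip: sum_distrib_left)
  finally have eq: "(\<Sum>p\<in>I \<times> I. (a (fst p) - a (snd p))\<^sup>2)
      = 2 * card I * (\<Sum>k\<in>I. (a k)\<^sup>2) - 2 * (\<Sum>k\<in>I. a k)\<^sup>2" .
  have "(\<Sum>p\<in>{(i, j), (j, i)}. (a (fst p) - a (snd p))\<^sup>2) \<le> (\<Sum>p\<in>I \<times> I. (a (fst p) - a (snd p))\<^sup>2)"
    using assms by (intro sum_mono2) auto
  moreover have "(\<Sum>p\<in>{(i, j), (j, i)}. (a (fst p) - a (snd p))\<^sup>2) = 2 * (a i - a j)\<^sup>2"
    using assms(4) by (simp add: power2_commute[of "a j"])
  ultimately show ?thesis using eq by linarith
qed

text \<open>Factor the difference of squares and apply Young's inequality with weight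
  \<open>c\<close>. A large \<open>c\<close> makes the error a small multiple of \<open>s\<close>,
  at the price of a larger factor on the squared distance.\<close>

lemma weighted_square_diff_le:
  assumes f: "square_integrable f" and g: "square_integrable g"
    and fs: "(\<integral>v. (f v)\<^sup>2 \<partial>lborel) = s" and gs: "(\<integral>v. (g v)\<^sup>2 \<partial>lborel) = s"
    and \<omega>: "\<omega> \<in> borel_measurable borel" "\<And>v. 0 \<le> \<omega> v \<and> \<omega> v \<le> 1" and c: "c > 0"
  shows "(\<integral>v. \<omega> v * (f v)\<^sup>2 \<partial>lborel) - (\<integral>v. \<omega> v * (g v)\<^sup>2 \<partial>lborel)
      \<le> c / 2 * (\<integral>v. (f v - g v)\<^sup>2 \<partial>lborel) + 2 / c * s"
proof -
  note [measurable] = f[THEN square_integrable_measurable] g[THEN square_integrable_measurable] \<omega>(1)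
  have int: "integrable lborel (\<lambda>v. \<omega> v * (h v)\<^sup>2)" if h: "square_integrable h" for h
  proof (rule Bochner_Integration.integrable_bound)
    show "integrable lborel (\<lambda>v. (h v)\<^sup>2)" using h by (simp add: square_integrable_def)
    have [measurable]: "h \<in> borel_measurable borel" using h by (rule square_integrable_measurable)
    show "(\<lambda>v. \<omega> v * (h v)\<^sup>2) \<in> borel_measurable lborel" by measurable
    show "AE v in lborel. norm (\<omega> v * (h v)\<^sup>2) \<le> norm ((h v)\<^sup>2)"
      using \<omega>(2) by (auto simp: abs_mult intro!: mult_left_le_one_le)
  qed
  have ifg: "integrable lborel (\<lambda>v. (f v - g v)\<^sup>2)"
    using square_integrable_diff[OF f g] by (simp add: square_integrable_def)
  have i2: "integrable lborel (\<lambda>v. (f v)\<^sup>2)" "integrable lborel (\<lambda>v. (g v)\<^sup>2)"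
    using f g by (auto simp: square_integrable_def)
  have "(\<integral>v. \<omega> v * (f v)\<^sup>2 \<partial>lborel) - (\<integral>v. \<omega> v * (g v)\<^sup>2 \<partial>lborel)
      = (\<integral>v. \<omega> v * (f v)\<^sup>2 - \<omega> v * (g v)\<^sup>2 \<partial>lborel)"
    using int[OF f] int[OF g] by simp
  also have "\<dots> \<le> (\<integral>v. c / 2 * (f v - g v)\<^sup>2 + (1 / c) * ((f v)\<^sup>2 + (g v)\<^sup>2) \<partial>lborel)"
  proof (rule integral_mono)
    fix v
    have "\<omega> v * (f v)\<^sup>2 - \<omega> v * (g v)\<^sup>2 \<le> \<bar>(f v)\<^sup>2 - (g v)\<^sup>2\<bar>"
    proof -
      have "\<omega> v * (f v)\<^sup>2 - \<omega> v * (g v)\<^sup>2 = \<omega> v * ((f v)\<^sup>2 - (g v)\<^sup>2)" by (simp add: algebra_simps)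
      also have "\<dots> \<le> \<omega> v * \<bar>(f v)\<^sup>2 - (g v)\<^sup>2\<bar>" using \<omega>(2)[of v] by (intro mult_left_mono) auto
      also have "\<dots> \<le> 1 * \<bar>(f v)\<^sup>2 - (g v)\<^sup>2\<bar>" using \<omega>(2)[of v] by (intro mult_right_mono) auto
      finally show ?thesis by simp
    qed
    also have "\<bar>(f v)\<^sup>2 - (g v)\<^sup>2\<bar> = \<bar>f v - g v\<bar> * \<bar>f v + g v\<bar>"
      by (simp add: power2_eq_square square_diff_square_factored abs_mult mult.commute)
    also have "\<dots> \<le> c / 2 * \<bar>f v - g v\<bar>\<^sup>2 + 1 / (2 * c) * \<bar>f v + g v\<bar>\<^sup>2"
    proof -
      have "0 \<le> (c * \<bar>f v - g v\<bar> - \<bar>f v + g v\<bar>)\<^sup>2 / (2 * c)" using c by simp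
      also have "\<dots> = (c / 2 * \<bar>f v - g v\<bar>\<^sup>2 + 1 / (2 * c) * \<bar>f v + g v\<bar>\<^sup>2) - \<bar>f v - g v\<bar> * \<bar>f v + g v\<bar>"
        using c unfolding power2_diff by (simp add: power_mult_distrib field_simps power2_eq_square[of c])
      finally show ?thesis by simp
    qed
    also have "1 / (2 * c) * \<bar>f v + g v\<bar>\<^sup>2 \<le> 1 / (2 * c) * (2 * ((f v)\<^sup>2 + (g v)\<^sup>2))"
      using c zero_le_power2[of "f v - g v"] by (intro mult_left_mono) (auto simp: power2_sum power2_diff)
    also have "\<dots> = (1 / c) * ((f v)\<^sup>2 + (g v)\<^sup>2)" using c by (simp add: field_simps)
    finally show "\<omega> v * (f v)\<^sup>2 - \<omega> v * (g v)\<^sup>2 \<le> c / 2 * (f v - g v)\<^sup>2 + (1 / c) * ((f v)\<^sup>2 + (g v)\<^sup>2)"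
      by simp
  qed (use int[OF f] int[OF g] ifg i2 in auto)
  also have "\<dots> = c / 2 * (\<integral>v. (f v - g v)\<^sup>2 \<partial>lborel) + 1 / c * ((\<integral>v. (f v)\<^sup>2 \<partial>lborel) + (\<integral>v. (g v)\<^sup>2 \<partial>lborel))"
    using ifg i2 by simp
  also have "\<dots> = c / 2 * (\<integral>v. (f v - g v)\<^sup>2 \<partial>lborel) + 2 / c * s" by (simp add: fs gs)
  finally show ?thesis .
qed


section \<open>Contraction by averages of Koopman operators\<close>

context hyperbolic_rotation
begin

text \<open>The \<open>n\<close>-th power of the average of the two Koopman operators.\<close>

definition word_average :: "nat \<Rightarrow> (real^2 \<Rightarrow> real) \<Rightarrow> real^2 \<Rightarrow> real"
  where "word_average n F v = (\<Sum>w\<in>word_set n. F (wm w *v v)) / 2 ^ n"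

lemma square_integrable_word_average:
  assumes "square_integrable F"
  shows "square_integrable (word_average n F)"
proof -
  have "square_integrable (\<lambda>v. \<Sum>w\<in>word_set n. F (wm w *v v))"
    by (intro square_integrable_sum square_integrable_comp assms det_wm) simp
  from square_integrable_scale[OF this, of "1 / 2 ^ n"] show ?thesis
    by (simp add: word_average_def[abs_def])
qed

lemma word_average_add: "word_average (m + n) F = word_average m (word_average n F)"
  unfolding word_average_def[abs_def] sum_word_set_append
  by (simp add: word_matrix_append matrix_vector_mul_assoc power_add mult.commute flip: sum_divide_distrib)

text \<open>The share of the first coordinate in the squared length of \<open>diag(lam, 1/lam) v\<close>. Along an
  orbit of the rotation, replacing one rotation step by the hyperbolic matrix changes its
  average by a definite amount; this is what prevents almost invariant functions.\<close>

definition stretched_share :: "real^2 \<Rightarrow> real"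
  where "stretched_share v = (lam * v$1)\<^sup>2 / ((lam * v$1)\<^sup>2 + (v$2 / lam)\<^sup>2)"

text \<open>The squared cosine of the angle with the first axis, with value 0 at the origin through
  division by zero; \<open>stretched_share\<close> is its composition with the hyperbolic
  matrix.\<close>

definition share :: "real^2 \<Rightarrow> real"
  where "share v = (v$1)\<^sup>2 / ((v$1)\<^sup>2 + (v$2)\<^sup>2)"

lemma fraction_of_sum_bounds: "0 \<le> a \<Longrightarrow> 0 \<le> b \<Longrightarrow> 0 \<le> a / (a + b) \<and> a / (a + b) \<le> (1::real)"
  by (cases "a + b = 0") (auto simp: divide_le_eq)

lemma share_bounds: "0 \<le> share v" "share v \<le> 1"
  unfolding share_def using fraction_of_sum_bounds by auto

lemma stretched_share_bounds: "0 \<le> stretched_share v \<and> stretched_share v \<le> 1"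
  unfolding stretched_share_def by (intro fraction_of_sum_bounds) auto

lemma stretched_share_measurable [measurable]: "stretched_share \<in> borel_measurable borel"
  unfolding stretched_share_def[abs_def] by measurable

lemma share_polar:
  assumes "r > 0"
  shows "share (vector [r * cos \<phi>, r * sin \<phi>]) = (cos \<phi>)\<^sup>2"
proof -
  have "(r * cos \<phi>)\<^sup>2 + (r * sin \<phi>)\<^sup>2 = r\<^sup>2 * ((sin \<phi>)\<^sup>2 + (cos \<phi>)\<^sup>2)"
    by (simp only: power_mult_distrib distrib_left add.commute)
  then show ?thesis using assms by (simp add: share_def power_mult_distrib)
qed

text \<open>The hyperbolic matrix multiplies the ratio of the squared coordinates by
  \<open>lam ^ 4\<close>. The gain degenerates only on the two axes, and the product of
  \<open>share\<close> and its complement measures the distance from them.\<close>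

lemma stretched_share_gain:
  assumes "v \<noteq> 0"
  shows "(1 - 1 / lam ^ 4) * (share v * (1 - share v)) \<le> stretched_share v - share v"
proof -
  define a where "a = (v$1)\<^sup>2"
  define b where "b = (v$2)\<^sup>2"
  have ab: "a \<ge> 0" "b \<ge> 0" by (auto simp: a_def b_def)
  have s: "a + b > 0"
    using assms ab by (auto simp: a_def b_def vec_eq_iff forall_2 sum_power2_gt_zero_iff)
  define L where "L = lam ^ 4"
  have L: "L > 1" using lam by (simp add: L_def one_less_power)
  have den: "L * a + b > 0"
  proof -
    have "L * a + b \<ge> a + b" using L ab by (simp add: mult_le_cancel_right1)
    then show ?thesis using s by linarith
  qed
  have 1: "share v = a / (a + b)" by (simp add: share_def a_def b_def)
  have "stretched_share v = (lam\<^sup>2 * a) / (lam\<^sup>2 * a + b / lam\<^sup>2)"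
    by (simp add: stretched_share_def a_def b_def power_mult_distrib power_divide)
  also have "\<dots> = (lam\<^sup>2 * (lam\<^sup>2 * a)) / (lam\<^sup>2 * (lam\<^sup>2 * a + b / lam\<^sup>2))"
    using lam by (subst mult_divide_mult_cancel_left) auto
  also have "\<dots> = L * a / (L * a + b)"
  proof -
    have "lam\<^sup>2 * lam\<^sup>2 = L" by (simp add: L_def flip: power_add)
    then have "lam\<^sup>2 * (lam\<^sup>2 * a) = L * a" by (metis mult.assoc)
    moreover have "lam\<^sup>2 * (b / lam\<^sup>2) = b" using lam by simp
    ultimately show ?thesis by (simp only: distrib_left)
  qed
  finally have 2: "stretched_share v = L * a / (L * a + b)" .
  have "stretched_share v - share v = (L - 1) * (a * b) / ((L * a + b) * (a + b))"
    unfolding 1 2 using s den by (subst diff_frac_eq) (simp_all add: algebra_simps)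
  also have "\<dots> \<ge> (L - 1) * (a * b) / ((L * (a + b)) * (a + b))"
  proof (rule divide_left_mono)
    show "(L * a + b) * (a + b) \<le> L * (a + b) * (a + b)"
      using ab s L by (intro mult_right_mono) (auto simp: distrib_left mult_le_cancel_right1)
    show "0 \<le> (L - 1) * (a * b)" using L ab by simp
    show "0 < L * (a + b) * (a + b) * ((L * a + b) * (a + b))" using s den L by simp
  qed
  also have "(L - 1) * (a * b) / ((L * (a + b)) * (a + b)) = (1 - 1 / L) * (share v * (1 - share v))"
  proof -
    have "1 - share v = b / (a + b)" unfolding 1 using s by (simp add: field_simps)
    moreover have "1 - 1 / L = (L - 1) / L" using L by (simp add: diff_divide_distrib)
    ultimately show ?thesis unfolding 1 by (simp add: mult.assoc)
  qed
  finally show ?thesis by (simp add: L_def)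
qed

lemma det_rotation_matrix: "det (rotation_matrix a) = 1"
  by (simp add: rotation_matrix_def det_2 flip: power2_eq_square)

text \<open>The sum splits into the gains from stretching and a telescoping sum that is at least -1.
  The gains cannot all be small: a direction and its rotation by \<open>\<theta>\<close> turns are
  not both near an axis, since \<open>4 * \<theta>\<close> is no integer.\<close>

lemma sum_share_rotations:
  obtains N :: nat where "N > 0" "\<forall>v. v \<noteq> 0 \<longrightarrow>
    1 \<le> (\<Sum>k<N. stretched_share (rotation_matrix (- (Suc k * \<theta>)) *v v) - share (rotation_matrix (- (k * \<theta>)) *v v))"
proof -
  define s where "s = (sin (4 * pi * \<theta>))\<^sup>2"
  have "sin (4 * pi * \<theta>) \<noteq> 0"
  proof
    assume "sin (4 * pi * \<theta>) = 0"
    then obtain i :: int where "4 * pi * \<theta> = of_int i * pi" by (auto simp: sin_zero_iff_int2)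
    then have "4 * \<theta> = of_int i" by simp
    then have "\<theta> = of_int i / 4" by simp
    moreover have "of_int i / 4 \<in> (\<rat> :: real set)" by simp
    ultimately show False using irrational by metis
  qed
  then have s: "s > 0" by (simp add: s_def)
  define \<kappa> where "\<kappa> = 1 - 1 / lam ^ 4"
  have \<kappa>: "\<kappa> > 0" using lam by (simp add: \<kappa>_def one_less_power)
  \<comment> \<open>Each of the \<open>m\<close> pairs of consecutive angles gains at least
    \<open>\<kappa> * (s / 8)\<close>. The total has to exceed 2: one unit for the telescoping loss,
    one for the claim.\<close>
  obtain m :: nat where m: "2 / (\<kappa> * (s / 8)) < m" using reals_Archimedean2 by blast
  have m': "2 < \<kappa> * (m * (s / 8))" using m \<kappa> s by (simp add: field_simps)
  then have m0: "m > 0" by (cases m) auto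
  show thesis
  proof (rule that[of "2 * m"], use m0 in simp, intro allI impI)
    fix v :: "real^2" assume v: "v \<noteq> 0"
    define r where "r = sqrt ((v$1)\<^sup>2 + (v$2)\<^sup>2)"
    have pos: "(v$1)\<^sup>2 + (v$2)\<^sup>2 > 0"
      using v by (auto simp: vec_eq_iff forall_2 sum_power2_gt_zero_iff)
    then have r: "r > 0" unfolding r_def by (rule real_sqrt_gt_zero)
    have "r\<^sup>2 = (v$1)\<^sup>2 + (v$2)\<^sup>2" by (simp add: r_def)
    then have "(v$1 / r)\<^sup>2 + (v$2 / r)\<^sup>2 = r\<^sup>2 / r\<^sup>2"
      by (simp only: power_divide add_divide_distrib)
    then have "(v$1 / r)\<^sup>2 + (v$2 / r)\<^sup>2 = 1" using r by simp
    from sincos_total_2pi[OF this] obtain \<phi> where "v$1 / r = cos \<phi>" "v$2 / r = sin \<phi>" by metis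
    then have v_eq: "v = vector [r * cos \<phi>, r * sin \<phi>]"
      using r by (simp add: vec_eq_iff forall_2 field_simps)
    define \<psi> where "\<psi> k = \<phi> - 2 * pi * (real k * \<theta>)" for k
    define u where "u k = rotation_matrix (- (real k * \<theta>)) *v v" for k
    have u: "u k = vector [r * cos (\<psi> k), r * sin (\<psi> k)]" for k
      unfolding u_def v_eq \<psi>_def
      by (simp add: vec_eq_iff forall_2 matrix_vector_mul_2 rotation_matrix_def cos_diff sin_diff algebra_simps)
    have u0: "u k \<noteq> 0" for k
    proof
      assume "u k = 0"
      then have "share (u k) = 0" by (simp add: share_def)
      moreover have "(u k)$2 = 0" using \<open>u k = 0\<close> by simp
      ultimately show False using r sin_cos_squared_add[of "\<psi> k"] unfolding u share_polar[OF r] by simp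
    qed
    define y where "y k = share (u k) * (1 - share (u k))" for k
    have y: "y k = (sin (2 * \<psi> k))\<^sup>2 / 4" for k
      unfolding y_def u share_polar[OF r] sin_squared_eq[symmetric] sin_double
      by (simp add: power_mult_distrib mult.commute)
    have y0: "y k \<ge> 0" for k by (simp add: y)
    \<comment> \<open>The sine of a difference is at most the sum of the absolute sines, so two
      doubled angles that differ by \<open>4 * pi * \<theta>\<close> do not both have a small
      sine.\<close>
    have yy: "y k + y (Suc k) \<ge> s / 8" for k
    proof -
      have "2 * \<psi> k - 2 * \<psi> (Suc k) = 4 * pi * \<theta>" by (simp add: \<psi>_def algebra_simps)
      then have "\<bar>sin (4 * pi * \<theta>)\<bar> = \<bar>sin (2 * \<psi> k) * cos (2 * \<psi> (Suc k)) - cos (2 * \<psi> k) * sin (2 * \<psi> (Suc k))\<bar>"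
        by (simp flip: sin_diff)
      also have "\<dots> \<le> \<bar>sin (2 * \<psi> k) * cos (2 * \<psi> (Suc k))\<bar> + \<bar>cos (2 * \<psi> k) * sin (2 * \<psi> (Suc k))\<bar>"
        by (rule abs_triangle_ineq4)
      also have "\<dots> \<le> \<bar>sin (2 * \<psi> k)\<bar> + \<bar>sin (2 * \<psi> (Suc k))\<bar>"
      proof (rule add_mono)
        show "\<bar>sin (2 * \<psi> k) * cos (2 * \<psi> (Suc k))\<bar> \<le> \<bar>sin (2 * \<psi> k)\<bar>"
          unfolding abs_mult by (rule mult_left_le) simp_all
        show "\<bar>cos (2 * \<psi> k) * sin (2 * \<psi> (Suc k))\<bar> \<le> \<bar>sin (2 * \<psi> (Suc k))\<bar>"
          unfolding abs_mult by (rule mult_left_le_one_le) simp_all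
      qed
      finally have "s \<le> (\<bar>sin (2 * \<psi> k)\<bar> + \<bar>sin (2 * \<psi> (Suc k))\<bar>)\<^sup>2"
        unfolding s_def by (metis abs_ge_zero power2_abs power_mono)
      also have "\<dots> \<le> 2 * ((sin (2 * \<psi> k))\<^sup>2 + (sin (2 * \<psi> (Suc k)))\<^sup>2)"
        using zero_le_power2[of "\<bar>sin (2 * \<psi> k)\<bar> - \<bar>sin (2 * \<psi> (Suc k))\<bar>"]
        by (simp add: power2_sum power2_diff)
      finally show ?thesis by (simp add: y)
    qed
    have ysum: "(\<Sum>k<2 * m. y (Suc k)) \<ge> m * (s / 8)" for m
    proof (induction m)
      case (Suc m)
      have "(\<Sum>k<2 * Suc m. y (Suc k)) = (\<Sum>k<2 * m. y (Suc k)) + (y (Suc (2 * m)) + y (Suc (Suc (2 * m))))"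
        by simp
      then show ?case using Suc yy[of "Suc (2 * m)"] by (simp add: algebra_simps)
    qed simp
    have split: "(\<Sum>k<2 * m. stretched_share (u (Suc k)) - share (u k))
      = (\<Sum>k<2 * m. (stretched_share (u (Suc k)) - share (u (Suc k)))) + (\<Sum>k<2 * m. share (u (Suc k)) - share (u k))"
      by (simp add: sum_subtractf)
    have "(\<Sum>k<2 * m. share (u (Suc k)) - share (u k)) = share (u (2 * m)) - share (u 0)"
      by (rule sum_lessThan_telescope)
    then have "(\<Sum>k<2 * m. share (u (Suc k)) - share (u k)) \<ge> -1"
      using share_bounds[of "u (2 * m)"] share_bounds[of "u 0"] by linarith
    moreover have "(\<Sum>k<2 * m. \<kappa> * y (Suc k)) \<le> (\<Sum>k<2 * m. (stretched_share (u (Suc k)) - share (u (Suc k))))"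
      unfolding y_def \<kappa>_def by (intro sum_mono stretched_share_gain u0)
    moreover have "\<kappa> * (m * (s / 8)) \<le> (\<Sum>k<2 * m. \<kappa> * y (Suc k))"
      unfolding sum_distrib_left[symmetric] using ysum \<kappa> by (intro mult_left_mono) auto
    ultimately have "1 \<le> (\<Sum>k<2 * m. stretched_share (u (Suc k)) - share (u k))"
      using m' split by linarith
    then show "1 \<le> (\<Sum>k<2 * m. stretched_share (rotation_matrix (- (Suc k * \<theta>)) *v v) - share (rotation_matrix (- (k * \<theta>)) *v v))"
      unfolding u_def by simp
  qed
qed


text \<open>A function moved only a little by each of finitely many pairs of words of equal length would
  violate \<open>sum_share_rotations\<close> after integration against its square.\<close>

lemma word_average_moved:
  obtains N \<delta> where "N > 0" "\<delta> > 0" "\<delta> \<le> 1"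
    "\<forall>F. square_integrable F \<longrightarrow> (\<exists>v\<in>word_set N. \<exists>w\<in>word_set N. v \<noteq> w \<and>
      \<delta> * (\<integral>x. (F x)\<^sup>2 \<partial>lborel) \<le> (\<integral>x. (F (wm v *v x) - F (wm w *v x))\<^sup>2 \<partial>lborel))"
proof -
  obtain N :: nat where N: "N > 0" and Nsum: "\<forall>v. v \<noteq> 0 \<longrightarrow>
    1 \<le> (\<Sum>k<N. stretched_share (rotation_matrix (- (Suc k * \<theta>)) *v v) - share (rotation_matrix (- (k * \<theta>)) *v v))"
    by (rule sum_share_rotations)
  show thesis
  \<comment> \<open>Young's inequality with weight \<open>4 * N\<close>, summed over
    \<open>N\<close> steps, spends half of \<open>s\<close> and leaves \<open>s / 2\<close> at most
    \<open>2 * N\<close> times the sum of the squared distances \<open>d k\<close>. One of the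
    \<open>N\<close> distances is then at least \<open>s / (4 * N\<^sup>2)\<close>.\<close>
  proof (rule that[of N "1 / (4 * (real N)\<^sup>2)"])
    show "N > 0" "1 / (4 * (real N)\<^sup>2) > 0" using N by auto
    have "1 \<le> real N" using N by simp
    then have "1\<^sup>2 \<le> (real N)\<^sup>2" by (rule power_mono) simp
    then have "1 \<le> 4 * (real N)\<^sup>2" by simp
    then show "1 / (4 * (real N)\<^sup>2) \<le> 1" using N by (subst pos_divide_le_eq) auto
  next
    show "\<forall>F. square_integrable F \<longrightarrow> (\<exists>v\<in>word_set N. \<exists>w\<in>word_set N. v \<noteq> w \<and>
      1 / (4 * (real N)\<^sup>2) * (\<integral>x. (F x)\<^sup>2 \<partial>lborel) \<le> (\<integral>x. (F (wm v *v x) - F (wm w *v x))\<^sup>2 \<partial>lborel))"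
    proof (intro allI impI)
      fix F assume F: "square_integrable F"
      note [measurable] = square_integrable_measurable[OF F]
      define s where "s = (\<integral>x. (F x)\<^sup>2 \<partial>lborel)"
      define R where "R k = rotation_matrix (real k * \<theta>)" for k
      define R' where "R' k = rotation_matrix (- (real k * \<theta>))" for k
      have RR: "R' k *v (R k *v v) = v" for k v
        by (simp add: R_def R'_def matrix_vector_mul_assoc rotation_matrix_add rotation_matrix_0)
      define D where "D = hyperbolic_matrix lam"
      have dets [simp]: "det (R k) = 1" "det (R' k) = 1" "det D = 1" for k
        using lam by (simp_all add: R_def R'_def det_rotation_matrix) (simp add: D_def hyperbolic_matrix_def det_2)
      have sD: "stretched_share v = share (D *v v)" for v
        by (simp add: stretched_share_def share_def D_def hyperbolic_matrix_def matrix_vector_mul_2)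
      have [measurable]: "share \<in> borel_measurable borel"
        unfolding share_def[abs_def] by measurable
      have int_share: "integrable lborel (\<lambda>v. h v * (F v)\<^sup>2)"
        if [measurable]: "h \<in> borel_measurable borel" and h: "\<And>v. 0 \<le> h v \<and> h v \<le> 1" for h
      proof (rule Bochner_Integration.integrable_bound)
        show "integrable lborel (\<lambda>v. (F v)\<^sup>2)" using F by (simp add: square_integrable_def)
        show "AE v in lborel. norm (h v * (F v)\<^sup>2) \<le> norm ((F v)\<^sup>2)"
          using h by (auto simp: abs_mult intro!: mult_left_le_one_le)
      qed measurable
      have i1: "integrable lborel (\<lambda>v. stretched_share (R' (Suc k) *v v) * (F v)\<^sup>2)" for k
      proof (rule int_share)
        show "(\<lambda>v. stretched_share (R' (Suc k) *v v)) \<in> borel_measurable borel" by measurable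
      qed (rule stretched_share_bounds)
      have i2: "integrable lborel (\<lambda>v. share (R' k *v v) * (F v)\<^sup>2)" for k
      proof (rule int_share)
        show "(\<lambda>v. share (R' k *v v)) \<in> borel_measurable borel" by measurable
      qed (simp add: share_bounds)
      have t1: "(\<integral>v. stretched_share v * (F (R (Suc k) *v v))\<^sup>2 \<partial>lborel)
          = (\<integral>v. stretched_share (R' (Suc k) *v v) * (F v)\<^sup>2 \<partial>lborel)" for k
      proof -
        have "(\<lambda>v. stretched_share (R' (Suc k) *v v) * (F v)\<^sup>2) \<in> borel_measurable borel" by measurable
        from integral_det_1(1)[OF dets(1)[of "Suc k"] this] show ?thesis by (simp only: RR)
      qed
      \<comment> \<open>As \<open>stretched_share\<close> is \<open>share\<close> after
        \<open>D\<close>, the substitution by \<open>R k ** D\<close> turns the weight into a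
        rotated \<open>share\<close>. Both terms of the sum thus come from the same weight
        \<open>stretched_share\<close> and differ only in the matrix inside
        \<open>F\<close>.\<close>
      have t2: "(\<integral>v. stretched_share v * (F ((R k ** D) *v v))\<^sup>2 \<partial>lborel)
          = (\<integral>v. share (R' k *v v) * (F v)\<^sup>2 \<partial>lborel)" for k
      proof -
        have "R' k *v ((R k ** D) *v v) = D *v v" for v
          by (simp add: RR flip: matrix_vector_mul_assoc)
        moreover have "(\<lambda>v. share (R' k *v v) * (F v)\<^sup>2) \<in> borel_measurable borel" by measurable
        moreover have "det (R k ** D) = 1" by (simp add: det_mul)
        ultimately show ?thesis
          using integral_det_1(1)[of "R k ** D" "\<lambda>v. share (R' k *v v) * (F v)\<^sup>2"]
          by (simp only: sD)
      qed
      define d where "d k = (\<integral>v. (F (R (Suc k) *v v) - F ((R k ** D) *v v))\<^sup>2 \<partial>lborel)" for k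
      have "s \<le> (\<integral>v. (\<Sum>k<N. stretched_share (R' (Suc k) *v v) * (F v)\<^sup>2 - share (R' k *v v) * (F v)\<^sup>2) \<partial>lborel)"
        unfolding s_def
      proof (rule integral_mono_AE)
        show "integrable lborel (\<lambda>v. (F v)\<^sup>2)" using F by (simp add: square_integrable_def)
        show "AE v in lborel. (F v)\<^sup>2 \<le> (\<Sum>k<N. stretched_share (R' (Suc k) *v v) * (F v)\<^sup>2 - share (R' k *v v) * (F v)\<^sup>2)"
          using AE_lborel_singleton[of 0]
        proof eventually_elim
          case (elim v)
          have "1 * (F v)\<^sup>2 \<le> (\<Sum>k<N. stretched_share (R' (Suc k) *v v) - share (R' k *v v)) * (F v)\<^sup>2"
            using Nsum elim unfolding R'_def by (intro mult_right_mono) auto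
          then show ?case by (simp add: sum_distrib_right left_diff_distrib)
        qed
      qed (use i1 i2 in auto)
      also have "\<dots> = (\<Sum>k<N. (\<integral>v. stretched_share (R' (Suc k) *v v) * (F v)\<^sup>2 \<partial>lborel) - (\<integral>v. share (R' k *v v) * (F v)\<^sup>2 \<partial>lborel))"
        using i1 i2 by simp
      also have "\<dots> \<le> (\<Sum>k<N. 4 * real N / 2 * d k + 2 / (4 * real N) * s)"
      proof (rule sum_mono)
        fix k
        show "(\<integral>v. stretched_share (R' (Suc k) *v v) * (F v)\<^sup>2 \<partial>lborel) - (\<integral>v. share (R' k *v v) * (F v)\<^sup>2 \<partial>lborel)
          \<le> 4 * real N / 2 * d k + 2 / (4 * real N) * s"
          unfolding t1[symmetric] t2[symmetric] d_def
        proof (rule weighted_square_diff_le)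
          have det: "det (R k ** D) = 1" by (simp add: det_mul)
          show "square_integrable (\<lambda>v. F (R (Suc k) *v v))" "square_integrable (\<lambda>v. F ((R k ** D) *v v))"
            using square_integrable_comp[OF F] det dets(1) by blast+
          show "(\<integral>v. (F (R (Suc k) *v v))\<^sup>2 \<partial>lborel) = s" "(\<integral>v. (F ((R k ** D) *v v))\<^sup>2 \<partial>lborel) = s"
            unfolding s_def using square_integrable_comp_norm[OF F] det dets(1) by blast+
          show "4 * real N > 0" using N by simp
        qed (use stretched_share_bounds stretched_share_measurable in blast)+
      qed
      also have "\<dots> = 2 * real N * (\<Sum>k<N. d k) + s / 2"
        using N by (simp add: sum.distrib sum_distrib_left)
      finally have sum_d: "s / 2 \<le> 2 * real N * (\<Sum>k<N. d k)" by simp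
      have "\<exists>k<N. s / (4 * (real N)\<^sup>2) \<le> d k"
      proof (rule ccontr)
        assume "\<not> ?thesis"
        then have "(\<Sum>k<N. d k) < (\<Sum>k<N. s / (4 * (real N)\<^sup>2))"
          using N by (intro sum_strict_mono) (auto simp: not_le)
        then have "(\<Sum>k<N. d k) < real N * (s / (4 * (real N)\<^sup>2))" by simp
        then have "2 * real N * (\<Sum>k<N. d k) < 2 * real N * (real N * (s / (4 * (real N)\<^sup>2)))"
          by (rule mult_strict_left_mono) (use N in simp)
        also have "\<dots> = s / 2" using N by (simp add: power2_eq_square)
        finally show False using sum_d by simp
      qed
      then obtain k where k: "k < N" "s / (4 * (real N)\<^sup>2) \<le> d k" by blast
      \<comment> \<open>A common prefix of rotations brings both words to length \<open>N\<close>.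
        It acts first, so it is a measure preserving substitution in the integral and does not
        change the distance.\<close>
      define p where "p = replicate (N - Suc k) (2::nat)"
      define v where "v = p @ replicate (Suc k) 2"
      define w where "w = p @ 1 # replicate k 2"
      have vw: "v \<in> word_set N" "w \<in> word_set N" "v \<noteq> w"
        using k by (auto simp: v_def w_def p_def word_set_def)
      have wmv: "wm v = R (Suc k) ** wm p"
        unfolding v_def word_matrix_append wm_replicate_2 R_def ..
      have wmw: "wm w = (R k ** D) ** wm p"
        unfolding w_def word_matrix_append word_matrix.simps wm_replicate_2 R_def D_def
        by (simp add: generators_def)
      have "square_integrable (\<lambda>v. F (R (Suc k) *v v) - F ((R k ** D) *v v))"
        by (intro square_integrable_diff square_integrable_comp F) (simp_all add: det_mul)
      from square_integrable_comp_norm[OF this det_wm[of p]]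
      have "(\<integral>x. (F (wm v *v x) - F (wm w *v x))\<^sup>2 \<partial>lborel) = d k"
        unfolding wmv wmw d_def by (simp add: matrix_vector_mul_assoc)
      then show "\<exists>v\<in>word_set N. \<exists>w\<in>word_set N. v \<noteq> w \<and>
        1 / (4 * (real N)\<^sup>2) * (\<integral>x. (F x)\<^sup>2 \<partial>lborel) \<le> (\<integral>x. (F (wm v *v x) - F (wm w *v x))\<^sup>2 \<partial>lborel)"
        using k(2) vw unfolding s_def by (intro bexI[of _ v] bexI[of _ w]) auto
    qed
  qed
qed

text \<open>All terms of the average have the same norm, so two of them at a definite distance make
  the Cauchy-Schwarz inequality strict, by an amount that is uniform in \<open>F\<close>.\<close>

lemma word_average_contracts:
  obtains N \<kappa> where "N > 0" "0 < \<kappa>" "\<kappa> < 1"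
    "\<forall>F. square_integrable F \<longrightarrow> (\<integral>x. (word_average N F x)\<^sup>2 \<partial>lborel) \<le> \<kappa> * (\<integral>x. (F x)\<^sup>2 \<partial>lborel)"
proof -
  obtain N \<delta> where N: "N > 0" and \<delta>: "\<delta> > 0" "\<delta> \<le> 1" and moved:
    "\<forall>F. square_integrable F \<longrightarrow> (\<exists>v\<in>word_set N. \<exists>w\<in>word_set N. v \<noteq> w \<and>
      \<delta> * (\<integral>x. (F x)\<^sup>2 \<partial>lborel) \<le> (\<integral>x. (F (wm v *v x) - F (wm w *v x))\<^sup>2 \<partial>lborel))"
    by (rule word_average_moved)
  define W :: real where "W = 2 ^ N"
  have W: "W > 1" using N by (simp add: W_def)
  then have W2: "W\<^sup>2 > 1" by simp
  show thesis
  proof (rule that[of N "1 - \<delta> / W\<^sup>2"])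
    show "\<forall>F. square_integrable F \<longrightarrow> (\<integral>x. (word_average N F x)\<^sup>2 \<partial>lborel) \<le> (1 - \<delta> / W\<^sup>2) * (\<integral>x. (F x)\<^sup>2 \<partial>lborel)"
    proof (intro allI impI)
      fix F assume F: "square_integrable F"
      define s where "s = (\<integral>x. (F x)\<^sup>2 \<partial>lborel)"
      obtain v w where vw: "v \<in> word_set N" "w \<in> word_set N" "v \<noteq> w"
        and d: "\<delta> * s \<le> (\<integral>x. (F (wm v *v x) - F (wm w *v x))\<^sup>2 \<partial>lborel)"
        using moved F unfolding s_def by blast
      have iF: "integrable lborel (\<lambda>x. (F (wm u *v x))\<^sup>2)" for u
        using square_integrable_comp[OF F det_wm[of u]] by (simp add: square_integrable_def)
      have id: "integrable lborel (\<lambda>x. (F (wm v *v x) - F (wm w *v x))\<^sup>2)"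
        using square_integrable_diff[OF square_integrable_comp[OF F det_wm] square_integrable_comp[OF F det_wm]]
        by (simp add: square_integrable_def)
      have "(\<integral>x. (word_average N F x)\<^sup>2 \<partial>lborel)
          \<le> (\<integral>x. (W * (\<Sum>u\<in>word_set N. (F (wm u *v x))\<^sup>2) - (F (wm v *v x) - F (wm w *v x))\<^sup>2) / W\<^sup>2 \<partial>lborel)"
      proof (rule integral_mono)
        fix x
        show "(word_average N F x)\<^sup>2 \<le> (W * (\<Sum>u\<in>word_set N. (F (wm u *v x))\<^sup>2) - (F (wm v *v x) - F (wm w *v x))\<^sup>2) / W\<^sup>2"
          unfolding word_average_def power_divide W_def[symmetric]
          using square_of_sum_le[OF finite_word_set vw, of "\<lambda>u. F (wm u *v x)"]
          by (intro divide_right_mono) (auto simp: card_word_set W_def)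
        show "integrable lborel (\<lambda>x. (word_average N F x)\<^sup>2)"
          using square_integrable_word_average[OF F] by (simp add: square_integrable_def)
      qed (use iF id in auto)
      also have "\<dots> = (W * (\<Sum>u\<in>word_set N. (\<integral>x. (F (wm u *v x))\<^sup>2 \<partial>lborel)) - (\<integral>x. (F (wm v *v x) - F (wm w *v x))\<^sup>2 \<partial>lborel)) / W\<^sup>2"
        using iF id by simp
      also have "(\<Sum>u\<in>word_set N. (\<integral>x. (F (wm u *v x))\<^sup>2 \<partial>lborel)) = W * s"
        using square_integrable_comp_norm[OF F det_wm] by (simp add: card_word_set s_def W_def)
      also have "(W * (W * s) - (\<integral>x. (F (wm v *v x) - F (wm w *v x))\<^sup>2 \<partial>lborel)) / W\<^sup>2 \<le> (W * (W * s) - \<delta> * s) / W\<^sup>2"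
        using d by (intro divide_right_mono) auto
      also have "\<dots> = (1 - \<delta> / W\<^sup>2) * s" using W by (simp add: power2_eq_square field_simps)
      finally show "(\<integral>x. (word_average N F x)\<^sup>2 \<partial>lborel) \<le> (1 - \<delta> / W\<^sup>2) * (\<integral>x. (F x)\<^sup>2 \<partial>lborel)"
        by (simp add: s_def)
    qed
  next
    have "\<delta> < 1 * W\<^sup>2" using \<delta> W2 by linarith
    then show "0 < 1 - \<delta> / W\<^sup>2" using W2 by (simp add: divide_less_eq)
    have "0 < \<delta> / W\<^sup>2" using W2 \<delta> by (intro divide_pos_pos) linarith+
    then show "1 - \<delta> / W\<^sup>2 < 1" by simp
  qed (rule N)
qed

text \<open>For the indicator \<open>F\<close> of the unit disc, the correlation of \<open>F\<close>
  with its composition with a product is the area of the vectors that stay in the disc. These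
  include a disc of radius one over the norm, so the partition sum at -2 is bounded by the
  correlation of \<open>F\<close> with its average, which decays exponentially relative to
  \<open>2 ^ n\<close>.\<close>

lemma P_minus_2_less: "P (-2) < ln 2"
proof -
  obtain N \<kappa> where N: "N > 0" and \<kappa>: "0 < \<kappa>" "\<kappa> < 1" and contr:
    "\<forall>F. square_integrable F \<longrightarrow> (\<integral>x. (word_average N F x)\<^sup>2 \<partial>lborel) \<le> \<kappa> * (\<integral>x. (F x)\<^sup>2 \<partial>lborel)"
    by (rule word_average_contracts)
  define F :: "real^2 \<Rightarrow> real" where "F = indicator (cball 0 1)"
  have fin: "emeasure lborel (cball (0::real^2) r) < \<infinity>" for r by (rule emeasure_lborel_cball_finite)
  have F2: "(F v)\<^sup>2 = F v" for v by (simp add: F_def indicator_def)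
  have "F \<in> borel_measurable borel" unfolding F_def by (rule borel_measurable_indicator) simp
  then have F: "square_integrable F"
    unfolding square_integrable_def F2 unfolding F_def
    using fin by (auto intro!: integrable_real_indicator)
  define c where "c = unit_ball_vol 2"
  have c: "c > 0" by (simp add: c_def)
  have vol: "measure lborel (cball (0::real^2) r) = c * r\<^sup>2" if "r \<ge> 0" for r
    using content_cball[OF that, of "0::real^2"] by (simp add: c_def)
  have nF: "(\<integral>x. (F x)\<^sup>2 \<partial>lborel) = c"
    unfolding F2 unfolding F_def using vol[of 1] by simp
  have iter: "(\<integral>x. (word_average (j * N) F x)\<^sup>2 \<partial>lborel) \<le> \<kappa> ^ j * c" for j
  proof (induction j)
    case 0
    have "word_average 0 F = F" by (simp add: word_average_def[abs_def])
    then show ?case by (simp add: nF)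
  next
    case (Suc j)
    have "(\<integral>x. (word_average (Suc j * N) F x)\<^sup>2 \<partial>lborel) \<le> \<kappa> * (\<integral>x. (word_average (j * N) F x)\<^sup>2 \<partial>lborel)"
      using contr[rule_format, OF square_integrable_word_average[OF F, of "j * N"]] by (simp add: word_average_add)
    also have "\<dots> \<le> \<kappa> * (\<kappa> ^ j * c)" using Suc \<kappa> by (intro mult_left_mono) auto
    finally show ?case by (simp add: mult_ac)
  qed
  have "c * partition_sum (-2) n / 2 ^ n \<le> (\<integral>x. F x * word_average n F x \<partial>lborel)" for n
  proof -
    have i: "integrable lborel (\<lambda>x. F x * F (wm w *v x))" for w
    proof (rule Bochner_Integration.integrable_bound)
      show "integrable lborel (\<lambda>v. (F v)\<^sup>2)" using F by (simp add: square_integrable_def)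
      show "AE x in lborel. norm (F x * F (wm w *v x)) \<le> norm ((F x)\<^sup>2)"
        by (auto simp: F_def indicator_def)
      note [measurable] = square_integrable_measurable[OF F]
      show "(\<lambda>x. F x * F (wm w *v x)) \<in> borel_measurable lborel" by measurable
    qed
    have "c * spectral_norm (wm w) powr (-2) \<le> (\<integral>x. F x * F (wm w *v x) \<partial>lborel)" for w
    proof -
      define r where "r = 1 / spectral_norm (wm w)"
      have r: "0 < r" "r \<le> 1" using sn_pos[of w] sn_ge_1[of w] by (auto simp: r_def)
      have "c * spectral_norm (wm w) powr (-2) = c * r\<^sup>2"
        using sn_pos[of w] by (simp add: r_def powr_minus power_inverse divide_inverse powr_numeral)
      also have "\<dots> = (\<integral>x. indicator (cball (0::real^2) r) x \<partial>lborel)" using vol[of r] r by simp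
      also have "\<dots> \<le> (\<integral>x. F x * F (wm w *v x) \<partial>lborel)"
      proof (rule integral_mono)
        show "integrable lborel (indicator (cball (0::real^2) r) :: _ \<Rightarrow> real)"
          using fin by (intro integrable_real_indicator) auto
        fix x :: "real^2"
        show "indicator (cball 0 r) x \<le> F x * F (wm w *v x)"
        proof (cases "norm x \<le> r")
          case True
          have "norm (wm w *v x) \<le> spectral_norm (wm w) * norm x" by (rule spectral_norm_bound)
          also have "\<dots> \<le> spectral_norm (wm w) * r" using True sn_pos[of w] by (intro mult_left_mono) auto
          also have "\<dots> = 1" using sn_pos[of w] by (simp add: r_def)
          finally show ?thesis using True r by (simp add: F_def indicator_def)
        qed (simp add: F_def indicator_def)
      qed (rule i)
      finally show ?thesis .
    qed
    then have "(\<Sum>w\<in>word_set n. c * spectral_norm (wm w) powr (-2)) \<le> (\<Sum>w\<in>word_set n. \<integral>x. F x * F (wm w *v x) \<partial>lborel)"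
      by (intro sum_mono)
    also have "\<dots> = (\<integral>x. (\<Sum>w\<in>word_set n. F x * F (wm w *v x)) \<partial>lborel)" using i by simp
    finally have "(\<Sum>w\<in>word_set n. c * spectral_norm (wm w) powr (-2)) / 2 ^ n \<le> (\<integral>x. (\<Sum>w\<in>word_set n. F x * F (wm w *v x)) \<partial>lborel) / 2 ^ n"
      by (rule divide_right_mono) simp
    then show ?thesis
      by (simp add: partition_sum_def word_average_def sum_distrib_left)
  qed
  moreover have "(\<integral>x. F x * word_average (j * N) F x \<partial>lborel) \<le> c * sqrt \<kappa> ^ j" for j
  proof -
    \<comment> \<open>The weight in Young's inequality that balances its two terms and so reproduces
      the Cauchy-Schwarz bound.\<close>
    define q where "q = sqrt \<kappa> ^ j"
    have "q\<^sup>2 = (sqrt \<kappa> ^ 2) ^ j" unfolding q_def by (metis power_mult mult.commute)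
    then have q: "q > 0" "q\<^sup>2 = \<kappa> ^ j" using \<kappa> by (auto simp: q_def)
    have iA: "integrable lborel (\<lambda>x. (word_average (j * N) F x)\<^sup>2)"
      using square_integrable_word_average[OF F] by (simp add: square_integrable_def)
    have iF: "integrable lborel (\<lambda>x. (F x)\<^sup>2)" using F by (simp add: square_integrable_def)
    have "(\<integral>x. F x * word_average (j * N) F x \<partial>lborel)
        \<le> (\<integral>x. q / 2 * (F x)\<^sup>2 + 1 / (2 * q) * (word_average (j * N) F x)\<^sup>2 \<partial>lborel)"
    proof (rule integral_mono_AE')
      show "integrable lborel (\<lambda>x. q / 2 * (F x)\<^sup>2 + 1 / (2 * q) * (word_average (j * N) F x)\<^sup>2)"
        using iA iF by simp
      have "a * b \<le> q / 2 * a\<^sup>2 + 1 / (2 * q) * b\<^sup>2" for a b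
      proof -
        have "0 \<le> (q * a - b)\<^sup>2 / (2 * q)" using q by simp
        also have "\<dots> = (q / 2 * a\<^sup>2 + 1 / (2 * q) * b\<^sup>2) - a * b"
          using q(1) by (simp add: power2_eq_square field_simps)
        finally show ?thesis by simp
      qed
      then show "AE x in lborel. F x * word_average (j * N) F x \<le> q / 2 * (F x)\<^sup>2 + 1 / (2 * q) * (word_average (j * N) F x)\<^sup>2"
        by simp
      show "AE x in lborel. 0 \<le> q / 2 * (F x)\<^sup>2 + 1 / (2 * q) * (word_average (j * N) F x)\<^sup>2"
        using q(1) by simp
    qed
    also have "\<dots> = q / 2 * c + 1 / (2 * q) * (\<integral>x. (word_average (j * N) F x)\<^sup>2 \<partial>lborel)"
      using iA iF by (simp add: nF)
    also have "\<dots> \<le> q / 2 * c + 1 / (2 * q) * (q\<^sup>2 * c)"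
      using iter[of j] q by (intro add_left_mono mult_left_mono) auto
    also have "\<dots> = c * q" using q(1) by (simp add: power2_eq_square)
    finally show ?thesis by (simp add: q_def)
  qed
  ultimately have "c * partition_sum (-2) (j * N) / 2 ^ (j * N) \<le> c * sqrt \<kappa> ^ j" for j
    using order_trans by blast
  then have *: "partition_sum (-2) (j * N) \<le> 2 ^ (j * N) * sqrt \<kappa> ^ j" for j
    using c by (simp add: pos_divide_le_eq mult.assoc mult.commute[of "2 ^ (j * N)"])
  have le: "ln (partition_sum (-2) (j * N)) / (j * N) \<le> ln 2 + ln \<kappa> / (2 * N)" if "j > 0" for j
  proof -
    have "ln (partition_sum (-2) (j * N)) \<le> ln (2 ^ (j * N) * sqrt \<kappa> ^ j)"
      using * partition_sum_pos \<kappa> by (subst ln_le_cancel_iff) auto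
    also have "\<dots> = (j * N) * ln 2 + j * (ln \<kappa> / 2)"
      using \<kappa> by (simp add: ln_mult_pos ln_realpow ln_sqrt)
    also have "\<dots> = (j * N) * (ln 2 + ln \<kappa> / (2 * N))" using N by (simp add: field_simps)
    finally show ?thesis using N that by (subst pos_divide_le_eq) (simp_all add: mult_ac)
  qed
  have "strict_mono (\<lambda>j. j * N)" using N by (simp add: strict_mono_def)
  from LIMSEQ_subseq_LIMSEQ[OF P_LIMSEQ this]
  have "(\<lambda>j. ln (partition_sum (-2) (j * N)) / real (j * N)) \<longlonglongrightarrow> P (-2)" by (simp add: o_def)
  then have "P (-2) \<le> ln 2 + ln \<kappa> / (2 * N)"
    by (rule LIMSEQ_le_const2) (use le in \<open>auto intro!: exI[of _ 1]\<close>)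
  moreover have "ln \<kappa> / (2 * N) < 0" using \<kappa> N by (simp add: divide_neg_pos)
  ultimately show ?thesis by linarith
qed

end


section \<open>Entropy of random variables with finitely many values\<close>

definition obs_prob :: "'a measure \<Rightarrow> ('a \<Rightarrow> 'b) \<Rightarrow> 'b \<Rightarrow> real"
  where "obs_prob M X y = measure M (X -` {y} \<inter> space M)"

definition obs_entropy :: "'a measure \<Rightarrow> ('a \<Rightarrow> 'b) \<Rightarrow> real"
  where "obs_entropy M X = - (\<Sum>y\<in>X ` space M. obs_prob M X y * ln (obs_prob M X y))"

lemma obs_prob_nonneg: "0 \<le> obs_prob M X y"
  by (simp add: obs_prob_def)

lemma obs_prob_outside: "y \<notin> X ` space M \<Longrightarrow> obs_prob M X y = 0"
proof -
  assume "y \<notin> X ` space M"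
  then have "X -` {y} \<inter> space M = {}" by auto
  then show ?thesis by (simp add: obs_prob_def)
qed

lemma obs_entropy_superset:
  assumes "finite A" "X ` space M \<subseteq> A"
  shows "obs_entropy M X = - (\<Sum>y\<in>A. obs_prob M X y * ln (obs_prob M X y))"
  unfolding obs_entropy_def using assms obs_prob_outside[of _ X M]
  by (subst sum.mono_neutral_right[of A "X ` space M"]) auto

text \<open>Termwise \<open>ln x \<le> x - 1\<close> at the ratio of \<open>q\<close> to
  \<open>p\<close>; terms with \<open>p y = 0\<close> only lose the nonnegative
  \<open>q y\<close>.\<close>

lemma gibbs_inequality:
  fixes p q :: "'b \<Rightarrow> real"
  assumes "finite A" and p: "\<And>y. y \<in> A \<Longrightarrow> 0 \<le> p y" "sum p A = 1"
    and q: "\<And>y. y \<in> A \<Longrightarrow> 0 \<le> q y" "sum q A \<le> 1" and pq: "\<And>y. y \<in> A \<Longrightarrow> 0 < p y \<Longrightarrow> 0 < q y"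
  shows "- (\<Sum>y\<in>A. p y * ln (p y)) \<le> - (\<Sum>y\<in>A. p y * ln (q y))"
proof -
  have "p y * ln (q y) - p y * ln (p y) \<le> q y - p y" if y: "y \<in> A" for y
  proof (cases "p y = 0")
    case False
    then have p0: "p y > 0" using p(1)[OF y] by simp
    then have q0: "q y > 0" using pq[OF y] by simp
    have "p y * ln (q y) - p y * ln (p y) = p y * ln (q y / p y)"
      using p0 q0 by (simp add: ln_div right_diff_distrib)
    also have "\<dots> \<le> p y * (q y / p y - 1)"
      using p0 q0 by (intro mult_left_mono ln_le_minus_one) auto
    also have "\<dots> = q y - p y" using p0 by (simp add: right_diff_distrib)
    finally show ?thesis .
  qed (use q(1)[OF y] in simp)
  then have "(\<Sum>y\<in>A. p y * ln (q y) - p y * ln (p y)) \<le> (\<Sum>y\<in>A. q y - p y)" by (rule sum_mono)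
  then show ?thesis using p(2) q(2) by (simp add: sum_subtractf)
qed

context prob_space
begin

lemma sum_obs_prob_comp:
  assumes X: "simple_function M X" and A: "finite A" "X ` space M \<subseteq> A"
  shows "(\<Sum>y\<in>{y\<in>A. f y = z}. obs_prob M X y) = obs_prob M (\<lambda>x. f (X x)) z"
proof -
  have fin: "finite {y\<in>A. f y = z}" using A by simp
  have "obs_prob M (\<lambda>x. f (X x)) z = measure M (\<Union>y\<in>{y\<in>A. f y = z}. X -` {y} \<inter> space M)"
    unfolding obs_prob_def using A by (intro arg_cong[of _ _ "measure M"]) auto
  also have "\<dots> = (\<Sum>y\<in>{y\<in>A. f y = z}. measure M (X -` {y} \<inter> space M))"
    using fin simple_functionD(2)[OF X]
    by (intro finite_measure_finite_Union) (auto simp: disjoint_family_on_def)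
  finally show ?thesis by (simp add: obs_prob_def)
qed

lemma sum_obs_prob:
  assumes X: "simple_function M X" and A: "finite A" "X ` space M \<subseteq> A"
  shows "(\<Sum>y\<in>A. obs_prob M X y) = 1"
  using sum_obs_prob_comp[OF assms, of "\<lambda>_. ()" "()"] by (simp add: obs_prob_def prob_space)

lemma obs_prob_le_1: "obs_prob M X y \<le> 1"
  by (simp add: obs_prob_def)

text \<open>Entropy is the mean of minus the logarithm of the probability. This converts an upper
  bound for cylinder probabilities into a lower bound for entropy.\<close>

lemma obs_entropy_ge:
  assumes X: "simple_function M X" and c: "\<And>y. obs_prob M X y \<le> c" "c > 0"
  shows "- ln c \<le> obs_entropy M X"
proof -
  have fin: "finite (X ` space M)" by (rule simple_functionD(1)[OF X])
  have "obs_prob M X y * ln (obs_prob M X y) \<le> obs_prob M X y * ln c" for y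
  proof (cases "obs_prob M X y = 0")
    case False
    then have "obs_prob M X y > 0" using obs_prob_nonneg[of M X y] by simp
    then show ?thesis using c by (intro mult_left_mono) auto
  qed simp
  then have "(\<Sum>y\<in>X ` space M. obs_prob M X y * ln (obs_prob M X y)) \<le> (\<Sum>y\<in>X ` space M. obs_prob M X y * ln c)"
    by (rule sum_mono)
  also have "\<dots> = ln c" using sum_obs_prob[OF X fin] by (simp flip: sum_distrib_right)
  finally show ?thesis by (simp add: obs_entropy_def)
qed

lemma obs_entropy_nonneg: "simple_function M X \<Longrightarrow> 0 \<le> obs_entropy M X"
  using obs_entropy_ge[of X 1, OF _ obs_prob_le_1] by simp

lemma simple_function_comp:
  "simple_function M X \<Longrightarrow> simple_function M (\<lambda>x. f (X x))"
  using simple_function_compose1[of M X f] by simp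

lemma obs_entropy_comp_le:
  assumes X: "simple_function M X"
  shows "obs_entropy M (\<lambda>x. f (X x)) \<le> obs_entropy M X"
proof -
  define A where "A = X ` space M"
  have A: "finite A" "X ` space M \<subseteq> A" using simple_functionD(1)[OF X] by (auto simp: A_def)
  have fA: "finite (f ` A)" "(\<lambda>x. f (X x)) ` space M \<subseteq> f ` A" using A by auto
  define r where "r = obs_prob M (\<lambda>x. f (X x))"
  have le: "obs_prob M X y \<le> r (f y)" if "y \<in> A" for y
    unfolding r_def sum_obs_prob_comp[OF X A, symmetric]
    using A that by (intro member_le_sum) (auto simp: obs_prob_nonneg)
  have "(\<Sum>y\<in>A. obs_prob M X y * ln (obs_prob M X y)) \<le> (\<Sum>y\<in>A. obs_prob M X y * ln (r (f y)))"
  proof (rule sum_mono)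
    fix y assume y: "y \<in> A"
    show "obs_prob M X y * ln (obs_prob M X y) \<le> obs_prob M X y * ln (r (f y))"
    proof (cases "obs_prob M X y = 0")
      case False
      then have "obs_prob M X y > 0" using obs_prob_nonneg[of M X y] by simp
      then show ?thesis using le[OF y] by (intro mult_left_mono) auto
    qed simp
  qed
  also have "\<dots> = (\<Sum>z\<in>f ` A. \<Sum>y\<in>{y\<in>A. f y = z}. obs_prob M X y * ln (r (f y)))"
    by (rule sum.group[symmetric]) (use A in auto)
  also have "\<dots> = (\<Sum>z\<in>f ` A. r z * ln (r z))"
  proof (rule sum.cong[OF refl])
    fix z
    have "(\<Sum>y\<in>{y\<in>A. f y = z}. obs_prob M X y * ln (r (f y))) = (\<Sum>y\<in>{y\<in>A. f y = z}. obs_prob M X y) * ln (r z)"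
      by (simp add: sum_distrib_right)
    then show "(\<Sum>y\<in>{y\<in>A. f y = z}. obs_prob M X y * ln (r (f y))) = r z * ln (r z)"
      unfolding sum_obs_prob_comp[OF X A] r_def .
  qed
  finally show ?thesis
    unfolding obs_entropy_superset[OF A] obs_entropy_superset[OF fA] r_def by simp
qed

text \<open>Gibbs' inequality against the product of the marginals.\<close>

lemma obs_entropy_Pair_le:
  assumes X: "simple_function M X" and Y: "simple_function M Y"
  shows "obs_entropy M (\<lambda>x. (X x, Y x)) \<le> obs_entropy M X + obs_entropy M Y"
proof -
  define A where "A = X ` space M"
  define B where "B = Y ` space M"
  have A: "finite A" "X ` space M \<subseteq> A" and B: "finite B" "Y ` space M \<subseteq> B"
    using simple_functionD(1)[OF X] simple_functionD(1)[OF Y] by (auto simp: A_def B_def)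
  have XY: "simple_function M (\<lambda>x. (X x, Y x))" by (rule simple_function_Pair[OF X Y])
  have AB: "finite (A \<times> B)" "(\<lambda>x. (X x, Y x)) ` space M \<subseteq> A \<times> B" using A B by auto
  define p where "p = obs_prob M (\<lambda>x. (X x, Y x))"
  define a where "a = obs_prob M X"
  define b where "b = obs_prob M Y"
  have pa: "(\<Sum>y\<in>B. p (x, y)) = a x" if "x \<in> A" for x
  proof -
    have "(\<Sum>y\<in>B. p (x, y)) = (\<Sum>w\<in>{w\<in>A \<times> B. fst w = x}. p w)"
      by (rule sum.reindex_bij_witness[of _ snd "Pair x"]) (use that in auto)
    then show ?thesis
      using sum_obs_prob_comp[OF XY AB, of fst x] by (simp add: p_def a_def)
  qed
  have pb: "(\<Sum>x\<in>A. p (x, y)) = b y" if "y \<in> B" for y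
  proof -
    have "(\<Sum>x\<in>A. p (x, y)) = (\<Sum>w\<in>{w\<in>A \<times> B. snd w = y}. p w)"
      by (rule sum.reindex_bij_witness[of _ fst "\<lambda>x. (x, y)"]) (use that in auto)
    then show ?thesis
      using sum_obs_prob_comp[OF XY AB, of snd y] by (simp add: p_def b_def)
  qed
  have p0: "p w \<ge> 0" for w by (simp add: p_def obs_prob_nonneg)
  have ab0: "a x \<ge> 0" "b y \<ge> 0" for x y by (simp_all add: a_def b_def obs_prob_nonneg)
  have pos: "0 < a x \<and> 0 < b y" if "x \<in> A" "y \<in> B" "0 < p (x, y)" for x y
  proof -
    have "p (x, y) \<le> a x" unfolding pa[OF that(1), symmetric]
      by (rule member_le_sum) (use that B p0 in auto)
    moreover have "p (x, y) \<le> b y" unfolding pb[OF that(2), symmetric]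
      by (rule member_le_sum[of x A "\<lambda>x. p (x, y)"]) (use that A p0 in auto)
    ultimately show ?thesis using that(3) by linarith
  qed
  have "- (\<Sum>w\<in>A \<times> B. p w * ln (p w)) \<le> - (\<Sum>w\<in>A \<times> B. p w * ln (a (fst w) * b (snd w)))"
  proof (rule gibbs_inequality)
    show "sum p (A \<times> B) = 1" unfolding p_def by (rule sum_obs_prob[OF XY AB])
    have "(\<Sum>w\<in>A \<times> B. a (fst w) * b (snd w)) = sum a A * sum b B"
      by (simp add: sum_product sum.cartesian_product split_def)
    also have "\<dots> = 1" using sum_obs_prob[OF X A] sum_obs_prob[OF Y B] by (simp add: a_def b_def)
    finally show "(\<Sum>w\<in>A \<times> B. a (fst w) * b (snd w)) \<le> 1" by simp
  qed (use AB p0 ab0 pos in auto)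
  also have "(\<Sum>w\<in>A \<times> B. p w * ln (a (fst w) * b (snd w)))
      = (\<Sum>w\<in>A \<times> B. p w * ln (a (fst w)) + p w * ln (b (snd w)))"
  proof (rule sum.cong[OF refl])
    fix w assume w: "w \<in> A \<times> B"
    show "p w * ln (a (fst w) * b (snd w)) = p w * ln (a (fst w)) + p w * ln (b (snd w))"
    proof (cases "p w = 0")
      case False
      then have "0 < a (fst w) \<and> 0 < b (snd w)"
        using pos[of "fst w" "snd w"] w p0[of w] by auto
      then show ?thesis by (simp add: ln_mult_pos distrib_left)
    qed simp
  qed
  also have "\<dots> = (\<Sum>x\<in>A. \<Sum>y\<in>B. p (x, y) * ln (a x)) + (\<Sum>x\<in>A. \<Sum>y\<in>B. p (x, y) * ln (b y))"
    by (simp add: sum.distrib sum.cartesian_product split_def)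
  also have "(\<Sum>x\<in>A. \<Sum>y\<in>B. p (x, y) * ln (b y)) = (\<Sum>y\<in>B. \<Sum>x\<in>A. p (x, y) * ln (b y))"
    by (rule sum.swap)
  also have "(\<Sum>x\<in>A. \<Sum>y\<in>B. p (x, y) * ln (a x)) = (\<Sum>x\<in>A. a x * ln (a x))"
    by (simp add: pa flip: sum_distrib_right)
  also have "(\<Sum>y\<in>B. \<Sum>x\<in>A. p (x, y) * ln (b y)) = (\<Sum>y\<in>B. b y * ln (b y))"
    by (simp add: pb flip: sum_distrib_right)
  finally show ?thesis
    unfolding obs_entropy_superset[OF AB] obs_entropy_superset[OF A] obs_entropy_superset[OF B] p_def a_def b_def
    by simp
qed

lemma integral_finite_observable:
  assumes X: "simple_function M X" and A: "finite A" "X ` space M \<subseteq> A"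
  shows "(\<integral>x. g (X x) \<partial>M) = (\<Sum>y\<in>A. obs_prob M X y * (g y :: real))"
proof -
  have "(\<integral>x. g (X x) \<partial>M) = (\<integral>x. (\<Sum>y\<in>A. g y * indicator (X -` {y} \<inter> space M) x) \<partial>M)"
  proof (rule Bochner_Integration.integral_cong[OF refl])
    fix x assume x: "x \<in> space M"
    have "(\<Sum>y\<in>A. g y * indicator (X -` {y} \<inter> space M) x) = (\<Sum>y\<in>A. if y = X x then g y else 0)"
      using x by (intro sum.cong) (auto simp: indicator_def)
    then show "g (X x) = (\<Sum>y\<in>A. g y * indicator (X -` {y} \<inter> space M) x)"
      using A x by auto
  qed
  also have "\<dots> = (\<Sum>y\<in>A. \<integral>x. g y * indicator (X -` {y} \<inter> space M) x \<partial>M)"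
    using simple_functionD(2)[OF X]
    by (intro Bochner_Integration.integral_sum integrable_mult_right integrable_real_indicator)
      (auto simp: emeasure_eq_measure)
  also have "\<dots> = (\<Sum>y\<in>A. obs_prob M X y * g y)"
    by (intro sum.cong) (auto simp: obs_prob_def mult.commute Int_absorb2)
  finally show ?thesis .
qed

end


section \<open>Stationary processes\<close>

locale measure_preserving = prob_space +
  fixes T :: "'a \<Rightarrow> 'a"
  assumes T [measurable]: "T \<in> measurable M M" and invariant: "distr M M T = M"
begin

lemma funpow_measurable [measurable]: "(T ^^ n) \<in> measurable M M"
  by (induction n) (auto intro: measurable_comp[OF _ T] simp: o_def)

lemma distr_funpow: "distr M M (T ^^ n) = M"
proof (induction n)
  case 0
  then show ?case by (simp add: distr_id[unfolded id_def] id_def)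
next
  case (Suc n)
  have "distr M M (T ^^ Suc n) = distr (distr M M (T ^^ n)) M T"
    by (subst distr_distr) (auto simp: o_def)
  then show ?case using Suc invariant by (simp add: o_def)
qed

lemma obs_prob_funpow:
  assumes "simple_function M X"
  shows "obs_prob M (\<lambda>x. X ((T ^^ n) x)) y = obs_prob M X y"
proof -
  have "obs_prob M X y = measure (distr M M (T ^^ n)) (X -` {y} \<inter> space M)"
    by (simp add: distr_funpow obs_prob_def)
  also have "\<dots> = measure M ((T ^^ n) -` (X -` {y} \<inter> space M) \<inter> space M)"
    by (rule measure_distr[OF funpow_measurable simple_functionD(2)[OF assms]])
  also have "(T ^^ n) -` (X -` {y} \<inter> space M) \<inter> space M = (\<lambda>x. X ((T ^^ n) x)) -` {y} \<inter> space M"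
    using measurable_space[OF funpow_measurable[of n]] by auto
  finally show ?thesis by (simp add: obs_prob_def)
qed

lemma simple_function_funpow:
  assumes "simple_function M X"
  shows "simple_function M (\<lambda>x. X ((T ^^ n) x))"
  unfolding simple_function_def
proof
  have sp: "(T ^^ n) x \<in> space M" if "x \<in> space M" for x
    using measurable_space[OF funpow_measurable that] .
  have "(\<lambda>x. X ((T ^^ n) x)) ` space M \<subseteq> X ` space M" using sp by auto
  then show "finite ((\<lambda>x. X ((T ^^ n) x)) ` space M)"
    using simple_functionD(1)[OF assms] finite_subset by blast
  have "(\<lambda>x. X ((T ^^ n) x)) -` {y} \<inter> space M = (T ^^ n) -` (X -` {y} \<inter> space M) \<inter> space M" for y
    using sp by auto
  then show "\<forall>y\<in>(\<lambda>x. X ((T ^^ n) x)) ` space M. (\<lambda>x. X ((T ^^ n) x)) -` {y} \<inter> space M \<in> sets M"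
    using measurable_sets[OF funpow_measurable simple_functionD(2)[OF assms]] by simp
qed

lemma obs_entropy_funpow:
  assumes X: "simple_function M X"
  shows "obs_entropy M (\<lambda>x. X ((T ^^ n) x)) = obs_entropy M X"
proof -
  have fin: "finite (X ` space M)" by (rule simple_functionD(1)[OF X])
  have "(\<lambda>x. X ((T ^^ n) x)) ` space M \<subseteq> X ` space M"
    using measurable_space[OF funpow_measurable[of n]] by auto
  from obs_entropy_superset[OF fin this] show ?thesis
    unfolding obs_prob_funpow[OF X] by (simp add: obs_entropy_def)
qed

definition itinerary :: "('a \<Rightarrow> 'b) \<Rightarrow> nat \<Rightarrow> 'a \<Rightarrow> 'b list"
  where "itinerary X n x = map (\<lambda>i. X ((T ^^ i) x)) [0..<n]"

lemma itinerary_add: "itinerary X (m + n) x = itinerary X m x @ itinerary X n ((T ^^ m) x)"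
proof -
  have "[0..<m + n] = [0..<m] @ map (\<lambda>i. i + m) [0..<n]"
    using upt_add_eq_append[of 0 m n] map_add_upt[of m n] by (simp only: add_0 le0 add.commute)
  then show ?thesis
    by (simp add: itinerary_def funpow_add o_def)
qed

lemma simple_function_itinerary:
  assumes "simple_function M X"
  shows "simple_function M (itinerary X n)"
proof (induction n)
  case 0
  then show ?case by (simp add: itinerary_def[abs_def])
next
  case (Suc n)
  have "simple_function M (\<lambda>x. (itinerary X n x, X ((T ^^ n) x)))"
    by (intro simple_function_Pair Suc simple_function_funpow assms)
  from simple_function_comp[OF this, of "\<lambda>(l, y). l @ [y]"] show ?case
    by (simp add: itinerary_def[abs_def])
qed

lemma obs_entropy_itinerary_add:
  assumes X: "simple_function M X"
  shows "obs_entropy M (itinerary X (m + n)) \<le> obs_entropy M (itinerary X m) + obs_entropy M (itinerary X n)"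
proof -
  note s = simple_function_itinerary[OF X]
  have p: "simple_function M (\<lambda>x. (itinerary X m x, itinerary X n ((T ^^ m) x)))"
    by (intro simple_function_Pair s simple_function_funpow)
  have "obs_entropy M (itinerary X (m + n)) \<le> obs_entropy M (\<lambda>x. (itinerary X m x, itinerary X n ((T ^^ m) x)))"
    using obs_entropy_comp_le[OF p, of "\<lambda>(l, l'). l @ l'"] by (simp add: itinerary_add[abs_def])
  also have "\<dots> \<le> obs_entropy M (itinerary X m) + obs_entropy M (\<lambda>x. itinerary X n ((T ^^ m) x))"
    by (rule obs_entropy_Pair_le[OF s simple_function_funpow[OF s]])
  finally show ?thesis by (simp add: obs_entropy_funpow[OF s])
qed

lemma obs_entropy_itinerary_le:
  fixes X :: "'a \<Rightarrow> 'b"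
  assumes X: "simple_function M X"
  shows "obs_entropy M (itinerary X n) \<le> n * obs_entropy M X"
proof (induction n)
  case 0
  have "itinerary X 0 = (\<lambda>_. [])" by (simp add: itinerary_def[abs_def])
  moreover have "obs_entropy M (\<lambda>_. [] :: 'b list) = 0"
    using obs_entropy_superset[of "{[]}" "\<lambda>_. [] :: 'b list" M] by (auto simp: obs_prob_def prob_space)
  ultimately show ?case by simp
next
  case (Suc n)
  have "obs_entropy M (itinerary X 1) \<le> obs_entropy M X"
    using obs_entropy_comp_le[OF X, of "\<lambda>y. [y]"] by (simp add: itinerary_def[abs_def])
  then show ?case using obs_entropy_itinerary_add[OF X, of n 1] Suc by (simp add: algebra_simps)
qed

lemma entropy_rate_convergent:
  assumes X: "simple_function M X"
  shows "convergent (\<lambda>n. obs_entropy M (itinerary X n) / n)"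
  by (rule subadditive_convergent(1)[OF obs_entropy_itinerary_add[OF X]
      obs_entropy_nonneg[OF simple_function_itinerary[OF X]]])

text \<open>Encodes a partition as a variable, so that entropies of iterated joins become entropies
  of itineraries.\<close>

definition partition_cell :: "'a set set \<Rightarrow> 'a \<Rightarrow> 'a set"
  where "partition_cell Q x = (THE A. A \<in> Q \<and> x \<in> A)"

lemma partition_cell_eq:
  assumes "partition_on (space M) Q" "A \<in> Q" "x \<in> A"
  shows "partition_cell Q x = A"
  unfolding partition_cell_def using assms partition_onD2[OF assms(1)]
  by (intro the_equality) (auto simp: disjoint_def)

lemma partition_cell_in:
  assumes "partition_on (space M) Q" "x \<in> space M"
  shows "partition_cell Q x \<in> Q" "x \<in> partition_cell Q x"
proof -
  obtain A where "A \<in> Q" "x \<in> A" using assms partition_onD1[OF assms(1)] by auto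
  then show "partition_cell Q x \<in> Q" "x \<in> partition_cell Q x"
    using partition_cell_eq[OF assms(1)] by auto
qed

lemma simple_function_partition_cell:
  assumes Q: "partition_on (space M) Q" "finite Q" "Q \<subseteq> sets M"
  shows "simple_function M (partition_cell Q)"
  unfolding simple_function_def
proof
  have im: "partition_cell Q ` space M \<subseteq> Q" using partition_cell_in[OF Q(1)] by auto
  then show "finite (partition_cell Q ` space M)" using Q(2) finite_subset by blast
  show "\<forall>A\<in>partition_cell Q ` space M. partition_cell Q -` {A} \<inter> space M \<in> sets M"
  proof
    fix A assume "A \<in> partition_cell Q ` space M"
    then have A: "A \<in> Q" using im by auto
    then have "A \<subseteq> space M" using partition_onD1[OF Q(1)] by auto
    then have "partition_cell Q -` {A} \<inter> space M = A"
      using partition_cell_in[OF Q(1)] partition_cell_eq[OF Q(1) A] by auto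
    then show "partition_cell Q -` {A} \<inter> space M \<in> sets M" using A Q(3) by auto
  qed
qed

lemma partition_entropy_iterated_join:
  assumes Q: "partition_on (space M) Q" "finite Q" "Q \<subseteq> sets M"
  shows "partition_entropy M (iterated_join M T Q n) = obs_entropy M (itinerary (partition_cell Q) n)"
proof -
  define X where "X = partition_cell Q"
  have X: "simple_function M X" unfolding X_def by (rule simple_function_partition_cell[OF Q])
  define A where "A = {l. set l \<subseteq> Q \<and> length l = n}"
  have finA: "finite A" unfolding A_def by (rule finite_lists_length_eq[OF Q(2)])
  have sp: "(T ^^ i) x \<in> space M" if "x \<in> space M" for i x
    using measurable_space[OF funpow_measurable that] .
  have imA: "itinerary X n ` space M \<subseteq> A"
    using partition_cell_in(1)[OF Q(1)] sp by (auto simp: A_def itinerary_def X_def)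
  define C where "C l = {x \<in> space M. \<forall>i<n. (T ^^ i) x \<in> l ! i}" for l :: "'a set list"
  have vim: "itinerary X n -` {l} \<inter> space M = C l" if l: "l \<in> A" for l
  proof -
    have "(itinerary X n x = l) = (\<forall>i<n. (T ^^ i) x \<in> l ! i)" if x: "x \<in> space M" for x
    proof -
      have "(X ((T ^^ i) x) = l ! i) = ((T ^^ i) x \<in> l ! i)" if "i < n" for i
      proof -
        have "l ! i \<in> Q" using l that by (auto simp: A_def)
        then show ?thesis
          using partition_cell_eq[OF Q(1)] partition_cell_in(2)[OF Q(1) sp[OF x]] unfolding X_def by metis
      qed
      then show ?thesis using l by (auto simp: itinerary_def list_eq_iff_nth_eq A_def)
    qed
    then show ?thesis by (auto simp: C_def)
  qed
  have "iterated_join M T Q n = C ` A"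
  proof -
    have "A = (\<lambda>f. map f [0..<n]) ` ({..<n} \<rightarrow>\<^sub>E Q)"
    proof (intro equalityI subsetI)
      fix l assume l: "l \<in> A"
      then have "l = map (restrict (\<lambda>i. l ! i) {..<n}) [0..<n]"
        by (intro nth_equalityI) (auto simp: A_def)
      moreover have "restrict (\<lambda>i. l ! i) {..<n} \<in> {..<n} \<rightarrow>\<^sub>E Q"
        using l by (auto simp: A_def)
      ultimately show "l \<in> (\<lambda>f. map f [0..<n]) ` ({..<n} \<rightarrow>\<^sub>E Q)" by blast
    qed (auto simp: A_def PiE_def Pi_def)
    then show ?thesis unfolding iterated_join_def C_def by (force simp: image_image)
  qed
  then have "partition_entropy M (iterated_join M T Q n) = - (\<Sum>B\<in>C ` A. measure M B * ln (measure M B))"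
    by (simp add: partition_entropy_def)
  also have "(\<Sum>B\<in>C ` A. measure M B * ln (measure M B)) = (\<Sum>l\<in>A. measure M (C l) * ln (measure M (C l)))"
  proof (subst sum.reindex_nontrivial[OF finA], goal_cases)
    \<comment> \<open>Distinct itineraries give the same cell only if the cell is empty, and then
      its term is 0.\<close>
    case (1 l l')
    then have "C l = {}" using vim[OF 1(1)] vim[OF 1(2)] by auto
    then show ?case by simp
  qed simp
  also have "\<dots> = (\<Sum>l\<in>A. obs_prob M (itinerary X n) l * ln (obs_prob M (itinerary X n) l))"
    by (rule sum.cong) (auto simp: obs_prob_def vim)
  finally show ?thesis using obs_entropy_superset[OF finA imA] by (simp only: X_def)
qed

end


section \<open>Invariant measures of the full shift\<close>

lemma funpow_left_shift: "(left_shift ^^ i) x = (\<lambda>n. x (n + i))"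
  by (induction i) (auto simp: left_shift_def)

definition prefix_set :: "nat \<Rightarrow> nat list set \<Rightarrow> (nat \<Rightarrow> nat) set"
  where "prefix_set n C = {x \<in> full_shift. map x [0..<n] \<in> C}"

lemma prefix_measurable: "(\<lambda>x :: nat \<Rightarrow> nat. map x [0..<n]) \<in> measurable borel (count_space UNIV)"
proof (subst measurable_count_space_eq2_countable, intro conjI ballI)
  fix a :: "nat list"
  show "(\<lambda>x :: nat \<Rightarrow> nat. map x [0..<n]) -` {a} \<inter> space borel \<in> sets borel"
  proof (cases "length a = n")
    case True
    have "closed {x :: nat \<Rightarrow> nat. x i = a ! i}" for i
    proof -
      have "closed ((\<lambda>x :: nat \<Rightarrow> nat. x i) -` {a ! i})"
        by (rule closed_vimage[OF _ continuous_on_product_coordinates]) simp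
      then show ?thesis by (simp add: vimage_def)
    qed
    then have "closed (\<Inter>i\<in>{..<n}. {x :: nat \<Rightarrow> nat. x i = a ! i})" by (intro closed_INT) simp
    then have "(\<Inter>i\<in>{..<n}. {x :: nat \<Rightarrow> nat. x i = a ! i}) \<in> sets borel" by (rule borel_closed)
    moreover have "(map x [0..<n] = a) = (\<forall>i<n. x i = a ! i)" for x
      unfolding list_eq_iff_nth_eq using True by simp
    then have "(\<lambda>x :: nat \<Rightarrow> nat. map x [0..<n]) -` {a} = (\<Inter>i\<in>{..<n}. {x. x i = a ! i})"
      by blast
    ultimately show ?thesis by (simp only: space_borel Int_UNIV_right)
  next
    case False
    then have "(\<lambda>x :: nat \<Rightarrow> nat. map x [0..<n]) -` {a} = {}" by auto
    then show ?thesis by simp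
  qed
qed simp

text \<open>The product sigma-algebra is generated by conditions on single coordinates, and the
  coordinate \<open>i\<close> is the last letter of the prefix of length
  \<open>Suc i\<close>.\<close>

lemma sets_full_shift_eq:
  "sets (restrict_space borel full_shift) = sigma_sets full_shift {prefix_set n C |n C. True}"
proof (intro equalityI subsetI)
  fix B assume "B \<in> sets (restrict_space borel full_shift)"
  then obtain B' where B': "B' \<in> sets borel" "B = full_shift \<inter> B'"
    unfolding sets_restrict_space by blast
  have "sets (borel :: (nat \<Rightarrow> nat) measure) = sets (Pi\<^sub>M UNIV (\<lambda>_. borel))"
    by (rule sets_PiM_equal_borel[symmetric])
  also have "\<dots> = sigma_sets UNIV {{f. f i \<in> A} |i A. A \<in> sets borel}"
    by (simp add: sets_PiM_single)
  finally have "B' \<in> sigma_sets UNIV {{f :: nat \<Rightarrow> nat. f i \<in> A} |i A. A \<in> sets borel}"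
    using B' by simp
  then have "full_shift \<inter> B' \<in> sigma_sets full_shift {prefix_set n C |n C. True}"
  proof induction
    case (Basic X)
    then obtain i A where X: "X = {f. f i \<in> A}" by blast
    have "full_shift \<inter> X = prefix_set (Suc i) {l. last l \<in> A}"
      by (auto simp: X prefix_set_def)
    then show ?case by (intro sigma_sets.Basic) blast
  next
    case Empty
    show ?case by (simp add: sigma_sets.Empty)
  next
    case (Compl X)
    have "full_shift \<inter> (UNIV - X) = full_shift - (full_shift \<inter> X)" by auto
    then show ?case using sigma_sets.Compl[OF Compl.IH] by simp
  next
    case (Union X)
    have "full_shift \<inter> (\<Union>i. X i) = (\<Union>i. full_shift \<inter> X i)" by auto
    then show ?case using sigma_sets.Union[OF Union.IH] by simp
  qed
  then show "B \<in> sigma_sets full_shift {prefix_set n C |n C. True}" by (simp add: B'(2))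
next
  fix B assume "B \<in> sigma_sets full_shift {prefix_set n C |n C. True}"
  then show "B \<in> sets (restrict_space borel full_shift)"
  proof (rule sigma_algebra.sigma_sets_subset[THEN subsetD, rotated 2])
    show "sigma_algebra full_shift (sets (restrict_space borel full_shift))"
      using sets.sigma_algebra_axioms[of "restrict_space borel full_shift"] by (simp add: space_restrict_space)
    show "{prefix_set n C |n C. True} \<subseteq> sets (restrict_space borel full_shift)"
    proof safe
      fix n C
      have "(\<lambda>x :: nat \<Rightarrow> nat. map x [0..<n]) -` C \<inter> space borel \<in> sets borel"
        by (rule measurable_sets[OF prefix_measurable]) simp
      then have "{x :: nat \<Rightarrow> nat. map x [0..<n] \<in> C} \<in> sets borel" by (simp add: vimage_def)
      moreover have "prefix_set n C = full_shift \<inter> {x. map x [0..<n] \<in> C}" by (auto simp: prefix_set_def)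
      ultimately show "prefix_set n C \<in> sets (restrict_space borel full_shift)"
        unfolding sets_restrict_space by blast
    qed
  qed
qed

lemma left_shift_measurable_full_shift:
  "left_shift \<in> measurable (restrict_space borel full_shift) (restrict_space borel full_shift)"
proof -
  have "continuous_on UNIV (\<lambda>x :: nat \<Rightarrow> nat. (\<lambda>n. x (Suc n)))"
    by (rule continuous_on_coordinatewise_then_product) (rule continuous_on_product_coordinates)
  then have "left_shift \<in> measurable borel borel"
    unfolding left_shift_def[abs_def] by (rule borel_measurable_continuous_onI)
  then show ?thesis
    by (intro measurable_restrict_space2 measurable_restrict_space1)
      (auto simp: space_restrict_space full_shift_def left_shift_def)
qed

lemma prefix_set_in_sets: "prefix_set n C \<in> sets (restrict_space borel full_shift)"
  unfolding sets_full_shift_eq by (rule sigma_sets.Basic) blast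

locale shift_measure =
  fixes \<mu> :: "(nat \<Rightarrow> nat) measure"
  assumes invariant_measure: "\<mu> \<in> invariant_measures"
begin

lemma sets_eq: "sets \<mu> = sets (restrict_space borel full_shift)"
  using invariant_measure by (simp add: invariant_measures_def)

lemma space_eq: "space \<mu> = full_shift"
  using sets_eq_imp_space_eq[OF sets_eq] by (simp add: space_restrict_space)

lemma left_shift_measurable: "left_shift \<in> measurable \<mu> \<mu>"
  using left_shift_measurable_full_shift measurable_cong_sets[OF sets_eq sets_eq] by blast

lemma prefix_set_sets: "prefix_set n C \<in> sets \<mu>"
  unfolding sets_eq by (rule prefix_set_in_sets)

end

sublocale shift_measure \<subseteq> measure_preserving \<mu> left_shift
proof -
  interpret prob_space \<mu> using invariant_measure by (simp add: invariant_measures_def)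
  show "measure_preserving \<mu> left_shift"
    by unfold_locales (use left_shift_measurable invariant_measure in \<open>auto simp: invariant_measures_def\<close>)
qed

context shift_measure
begin

lemma simple_function_first: "simple_function \<mu> (\<lambda>x. x 0)"
  unfolding simple_function_def
proof
  have "(\<lambda>x. x 0) ` space \<mu> \<subseteq> {1, 2::nat}" by (auto simp: space_eq full_shift_def)
  then show "finite ((\<lambda>x. x 0) ` space \<mu>)" by (rule finite_subset) simp
  have "(\<lambda>x. x 0) -` {a} \<inter> space \<mu> \<in> sets \<mu>" for a :: nat
  proof -
    have "(\<lambda>x. x 0) -` {a} \<inter> space \<mu> = prefix_set 1 {[a]}" by (auto simp: space_eq prefix_set_def)
    also have "\<dots> \<in> sets \<mu>" by (rule prefix_set_sets)
    finally show ?thesis .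
  qed
  then show "\<forall>a\<in>(\<lambda>x. x 0) ` space \<mu>. (\<lambda>x. x 0) -` {a} \<inter> space \<mu> \<in> sets \<mu>" by blast
qed

lemma itinerary_first: "itinerary (\<lambda>x. x 0) n = (\<lambda>x. map x [0..<n])"
  by (simp add: itinerary_def[abs_def] funpow_left_shift)

lemma simple_function_prefix: "simple_function \<mu> (\<lambda>x. map x [0..<n])"
  using simple_function_itinerary[OF simple_function_first, of n] by (simp add: itinerary_first)

lemma prefix_in_word_set: "(\<lambda>x. map x [0..<n]) ` space \<mu> \<subseteq> word_set n"
  by (auto simp: space_eq full_shift_def word_set_def)

section \<open>Approximation of measurable sets by conditions on finite prefixes\<close>

definition cylinder_approximable :: "(nat \<Rightarrow> nat) set \<Rightarrow> bool"
  where "cylinder_approximable B \<longleftrightarrow> B \<inter> space \<mu> \<in> sets \<mu> \<and> (\<forall>\<epsilon>>0. \<exists>k C.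
    measure \<mu> {x \<in> space \<mu>. (x \<in> B) \<noteq> (map x [0..<k] \<in> C)} < \<epsilon>)"

lemma sets_mismatch:
  assumes "B \<inter> space \<mu> \<in> sets \<mu>"
  shows "{x \<in> space \<mu>. (x \<in> B) \<noteq> (map x [0..<k] \<in> C)} \<in> sets \<mu>"
proof -
  have "(\<lambda>x. map x [0..<k]) -` C \<inter> space \<mu> \<in> sets \<mu>" by (rule simple_functionD(2)[OF simple_function_prefix])
  then have "(B \<inter> space \<mu> - ((\<lambda>x. map x [0..<k]) -` C \<inter> space \<mu>)) \<union> (((\<lambda>x. map x [0..<k]) -` C \<inter> space \<mu>) - B \<inter> space \<mu>) \<in> sets \<mu>"
    using assms by blast
  moreover have "(B \<inter> space \<mu> - ((\<lambda>x. map x [0..<k]) -` C \<inter> space \<mu>)) \<union> (((\<lambda>x. map x [0..<k]) -` C \<inter> space \<mu>) - B \<inter> space \<mu>)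
    = {x \<in> space \<mu>. (x \<in> B) \<noteq> (map x [0..<k] \<in> C)}" by auto
  ultimately show ?thesis by simp
qed

lemma extend_prefix_set:
  assumes "k \<le> k'"
  obtains C' where "\<And>x :: nat \<Rightarrow> nat. (map x [0..<k'] \<in> C') = (map x [0..<k] \<in> C)"
proof (rule that[of "{l. take k l \<in> C}"])
  show "(map x [0..<k'] \<in> {l. take k l \<in> C}) = (map x [0..<k] \<in> C)" for x :: "nat \<Rightarrow> nat"
    using assms by (simp add: take_map)
qed

lemma cylinder_approximable_Un:
  assumes "cylinder_approximable B1" "cylinder_approximable B2"
  shows "cylinder_approximable (B1 \<union> B2)"
  unfolding cylinder_approximable_def
proof (intro conjI allI impI)
  have m: "B1 \<inter> space \<mu> \<in> sets \<mu>" "B2 \<inter> space \<mu> \<in> sets \<mu>"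
    using assms by (simp_all add: cylinder_approximable_def)
  then show "(B1 \<union> B2) \<inter> space \<mu> \<in> sets \<mu>" by (simp add: Int_Un_distrib2)
  fix \<epsilon> :: real assume "\<epsilon> > 0"
  then have e: "\<epsilon> / 2 > 0" by simp
  obtain k1 C1 where 1: "measure \<mu> {x \<in> space \<mu>. (x \<in> B1) \<noteq> (map x [0..<k1] \<in> C1)} < \<epsilon> / 2"
    using assms(1) e unfolding cylinder_approximable_def by blast
  obtain k2 C2 where 2: "measure \<mu> {x \<in> space \<mu>. (x \<in> B2) \<noteq> (map x [0..<k2] \<in> C2)} < \<epsilon> / 2"
    using assms(2) e unfolding cylinder_approximable_def by blast
  define k where "k = max k1 k2"
  obtain D1 where D1: "\<And>x :: nat \<Rightarrow> nat. (map x [0..<k] \<in> D1) = (map x [0..<k1] \<in> C1)"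
    using extend_prefix_set[of k1 k C1] by (auto simp: k_def)
  obtain D2 where D2: "\<And>x :: nat \<Rightarrow> nat. (map x [0..<k] \<in> D2) = (map x [0..<k2] \<in> C2)"
    using extend_prefix_set[of k2 k C2] by (auto simp: k_def)
  have "measure \<mu> {x \<in> space \<mu>. (x \<in> B1 \<union> B2) \<noteq> (map x [0..<k] \<in> D1 \<union> D2)}
      \<le> measure \<mu> ({x \<in> space \<mu>. (x \<in> B1) \<noteq> (map x [0..<k1] \<in> C1)} \<union> {x \<in> space \<mu>. (x \<in> B2) \<noteq> (map x [0..<k2] \<in> C2)})"
    by (intro finite_measure_mono) (use D1 D2 sets_mismatch[OF m(1)] sets_mismatch[OF m(2)] in auto)
  also have "\<dots> \<le> measure \<mu> {x \<in> space \<mu>. (x \<in> B1) \<noteq> (map x [0..<k1] \<in> C1)} + measure \<mu> {x \<in> space \<mu>. (x \<in> B2) \<noteq> (map x [0..<k2] \<in> C2)}"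
    by (rule measure_Un_le[OF sets_mismatch[OF m(1)] sets_mismatch[OF m(2)]])
  also have "\<dots> < \<epsilon>" using 1 2 by linarith
  finally show "\<exists>k C. measure \<mu> {x \<in> space \<mu>. (x \<in> B1 \<union> B2) \<noteq> (map x [0..<k] \<in> C)} < \<epsilon>" by blast
qed

text \<open>Continuity from below reduces the union to a finite one up to
  \<open>\<epsilon> / 2\<close>; the finite union is approximated up to the other half.\<close>

lemma cylinder_approximable_UN:
  assumes B: "\<And>n :: nat. cylinder_approximable (B n)"
  shows "cylinder_approximable (\<Union>n. B n)"
  unfolding cylinder_approximable_def
proof (intro conjI allI impI)
  define U where "U n = (\<Union>i\<le>n. B i)" for n
  have U: "cylinder_approximable (U n)" for n
  proof (induction n)
    case 0 then show ?case using B by (simp add: U_def)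
  next
    case (Suc n)
    have "U (Suc n) = U n \<union> B (Suc n)" by (auto simp: U_def le_Suc_eq)
    then show ?case using cylinder_approximable_Un[OF Suc B] by simp
  qed
  have m: "U n \<inter> space \<mu> \<in> sets \<mu>" for n using U by (simp add: cylinder_approximable_def)
  have UB: "(\<Union>n. B n) \<inter> space \<mu> = (\<Union>n. U n \<inter> space \<mu>)" by (auto simp: U_def)
  define V where "V = (\<Union>n. U n \<inter> space \<mu>)"
  have V: "V \<in> sets \<mu>" unfolding V_def by (rule sets.countable_UN) (use m in auto)
  then show "(\<Union>n. B n) \<inter> space \<mu> \<in> sets \<mu>" unfolding UB V_def .
  fix \<epsilon> :: real assume e: "\<epsilon> > 0"
  have inc: "incseq (\<lambda>n. U n \<inter> space \<mu>)" unfolding U_def incseq_def by force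
  have "(\<lambda>n. measure \<mu> (U n \<inter> space \<mu>)) \<longlonglongrightarrow> measure \<mu> V"
    unfolding V_def using m by (intro finite_Lim_measure_incseq inc) auto
  then obtain n where "norm (measure \<mu> (U n \<inter> space \<mu>) - measure \<mu> V) < \<epsilon> / 2"
    using LIMSEQ_D[of _ _ "\<epsilon> / 2"] e half_gt_zero by blast
  then have n: "measure \<mu> V - measure \<mu> (U n \<inter> space \<mu>) < \<epsilon> / 2"
    unfolding real_norm_def by linarith
  obtain k C where C: "measure \<mu> {x \<in> space \<mu>. (x \<in> U n) \<noteq> (map x [0..<k] \<in> C)} < \<epsilon> / 2"
    using U[of n] half_gt_zero[OF e] unfolding cylinder_approximable_def by blast
  define D where "D = {x \<in> space \<mu>. (x \<in> U n) \<noteq> (map x [0..<k] \<in> C)}"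
  have D: "D \<in> sets \<mu>" unfolding D_def by (rule sets_mismatch[OF m])
  have VU: "V - U n \<inter> space \<mu> \<in> sets \<mu>" using V m by blast
  have "{x \<in> space \<mu>. (x \<in> (\<Union>n. B n)) \<noteq> (map x [0..<k] \<in> C)} \<subseteq> (V - U n \<inter> space \<mu>) \<union> D"
    using UB unfolding V_def[symmetric] by (auto simp: D_def U_def)
  then have "measure \<mu> {x \<in> space \<mu>. (x \<in> (\<Union>n. B n)) \<noteq> (map x [0..<k] \<in> C)}
      \<le> measure \<mu> ((V - U n \<inter> space \<mu>) \<union> D)"
    using VU D by (intro finite_measure_mono) auto
  also have "\<dots> \<le> measure \<mu> (V - U n \<inter> space \<mu>) + measure \<mu> D" by (rule measure_Un_le[OF VU D])
  also have "measure \<mu> (V - U n \<inter> space \<mu>) = measure \<mu> V - measure \<mu> (U n \<inter> space \<mu>)"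
    using m V by (intro finite_measure_Diff) (auto simp: V_def)
  finally have "measure \<mu> {x \<in> space \<mu>. (x \<in> (\<Union>n. B n)) \<noteq> (map x [0..<k] \<in> C)} < \<epsilon>"
    using n C unfolding D_def by linarith
  then show "\<exists>k C. measure \<mu> {x \<in> space \<mu>. (x \<in> (\<Union>n. B n)) \<noteq> (map x [0..<k] \<in> C)} < \<epsilon>" by blast
qed

text \<open>The approximable sets contain the generators and are closed under complements and
  countable unions.\<close>

lemma cylinder_approximation:
  assumes "B \<in> sets \<mu>" "\<epsilon> > 0"
  obtains k C where "measure \<mu> {x \<in> space \<mu>. (x \<in> B) \<noteq> (map x [0..<k] \<in> C)} < \<epsilon>"
proof -
  have "B \<in> sigma_sets full_shift {prefix_set n C |n C. True}"
    using assms(1) unfolding sets_eq sets_full_shift_eq .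
  then have "cylinder_approximable B"
  proof induction
    case (Basic B)
    then obtain n C where B: "B = prefix_set n C" by blast
    have 0: "{x \<in> space \<mu>. (x \<in> B) \<noteq> (map x [0..<n] \<in> C)} = {}"
      by (auto simp: B prefix_set_def space_eq)
    have "B \<inter> space \<mu> \<in> sets \<mu>" unfolding B using prefix_set_sets by blast
    moreover have "measure \<mu> {x \<in> space \<mu>. (x \<in> B) \<noteq> (map x [0..<n] \<in> C)} < \<epsilon>" if "\<epsilon> > 0" for \<epsilon>
      unfolding 0 using that by simp
    ultimately show ?case unfolding cylinder_approximable_def by blast
  next
    case Empty
    have "measure \<mu> {x \<in> space \<mu>. (x \<in> {}) \<noteq> (map x [0..<0] \<in> {})} < \<epsilon>" if "\<epsilon> > 0" for \<epsilon>
      using that by simp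
    moreover have "{} \<inter> space \<mu> \<in> sets \<mu>" by simp
    ultimately show ?case unfolding cylinder_approximable_def by blast
  next
    case (Compl B)
    have "(full_shift - B) \<inter> space \<mu> = space \<mu> - B \<inter> space \<mu>" by (auto simp: space_eq)
    then have 1: "(full_shift - B) \<inter> space \<mu> \<in> sets \<mu>" using Compl.IH by (auto simp: cylinder_approximable_def)
    have eq: "{x \<in> space \<mu>. (x \<in> full_shift - B) \<noteq> (map x [0..<k] \<in> - C)} = {x \<in> space \<mu>. (x \<in> B) \<noteq> (map x [0..<k] \<in> C)}" for k C
      by (auto simp: space_eq)
    have "\<exists>k C. measure \<mu> {x \<in> space \<mu>. (x \<in> full_shift - B) \<noteq> (map x [0..<k] \<in> C)} < \<epsilon>" if \<epsilon>: "\<epsilon> > 0" for \<epsilon>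
    proof -
      obtain k C where "measure \<mu> {x \<in> space \<mu>. (x \<in> B) \<noteq> (map x [0..<k] \<in> C)} < \<epsilon>"
        using Compl.IH \<epsilon> unfolding cylinder_approximable_def by blast
      then have "measure \<mu> {x \<in> space \<mu>. (x \<in> full_shift - B) \<noteq> (map x [0..<k] \<in> - C)} < \<epsilon>" unfolding eq .
      then show ?thesis by blast
    qed
    with 1 show ?case unfolding cylinder_approximable_def by blast
  next
    case (Union B)
    show ?case by (rule cylinder_approximable_UN[OF Union.IH])
  qed
  then show thesis using that assms(2) unfolding cylinder_approximable_def by blast
qed

text \<open>From \<open>ln y \<le> y - 1\<close> at \<open>y = 1 / sqrt p\<close>. It bounds the
  entropy caused by rare values explicitly.\<close>

lemma neg_x_ln_x_le_sqrt:
  fixes p :: real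
  assumes "0 \<le> p"
  shows "- (p * ln p) \<le> 2 * sqrt p"
proof (cases "p = 0")
  case False
  then have p: "p > 0" "sqrt p > 0" using assms by auto
  have "ln (1 / sqrt p) \<le> 1 / sqrt p - 1" using p by (intro ln_le_minus_one) auto
  then have "- (ln p / 2) \<le> 1 / sqrt p" using p by (simp add: ln_div ln_sqrt)
  then have "p * (- (ln p / 2)) \<le> p * (1 / sqrt p)" using p by (intro mult_left_mono) auto
  also have "p * (1 / sqrt p) = sqrt p" using p by (simp add: real_div_sqrt)
  finally show ?thesis by simp
qed simp

text \<open>Outside a set of small measure the cell is determined by a long prefix; the process \<open>D\<close> that
  records the correct cell on the exceptional set has small entropy.\<close>

lemma partition_prefix_coding:
  assumes Q: "partition_on (space \<mu>) Q" "finite Q" "Q \<subseteq> sets \<mu>" and \<epsilon>: "\<epsilon> > 0"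
  obtains K D q where "simple_function \<mu> D" "obs_entropy \<mu> D \<le> \<epsilon>"
    "\<forall>x\<in>space \<mu>. partition_cell Q x = (case D x of None \<Rightarrow> q (map x [0..<K]) | Some A \<Rightarrow> A)"
proof -
  define r where "r = real (card Q)"
  \<comment> \<open>The entropy budget is \<open>s\<close> for the value \<open>None\<close> and
    \<open>2 * s\<close> for each of the \<open>r\<close> values \<open>Some A\<close>.\<close>
  define s where "s = min 1 (\<epsilon> / (2 * r + 1))"
  have s: "0 < s" "s \<le> 1" "(2 * r + 1) * s \<le> \<epsilon>"
  proof -
    have r: "2 * r + 1 > 0" by (simp add: r_def add_nonneg_pos)
    then show "0 < s" "s \<le> 1" using \<epsilon> by (auto simp: s_def)
    have "(2 * r + 1) * s \<le> (2 * r + 1) * (\<epsilon> / (2 * r + 1))" using r by (intro mult_left_mono) (auto simp: s_def)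
    then show "(2 * r + 1) * s \<le> \<epsilon>" using r by simp
  qed
  \<comment> \<open>The \<open>r\<close> exceptional sets together must have measure at most
    \<open>s\<^sup>2\<close>, because \<open>neg_x_ln_x_le_sqrt\<close> takes a square root;
    \<open>r + 1\<close> keeps the denominator positive.\<close>
  define \<delta> where "\<delta> = s\<^sup>2 / (r + 1)"
  have r1: "r + 1 > 0" by (simp add: r_def add_nonneg_pos)
  then have \<delta>: "\<delta> > 0" using s by (simp add: \<delta>_def)
  have r\<delta>: "r * \<delta> \<le> s\<^sup>2"
  proof -
    have "r * \<delta> \<le> (r + 1) * \<delta>" using \<delta> by (intro mult_right_mono) auto
    also have "\<dots> = s\<^sup>2" using r1 by (simp add: \<delta>_def)
    finally show ?thesis .
  qed
  have "\<forall>A\<in>Q. \<exists>p. measure \<mu> {x \<in> space \<mu>. (x \<in> A) \<noteq> (map x [0..<fst p] \<in> snd p)} < \<delta>"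
  proof
    fix A assume "A \<in> Q"
    then have "A \<in> sets \<mu>" using Q(3) by blast
    then obtain k C where "measure \<mu> {x \<in> space \<mu>. (x \<in> A) \<noteq> (map x [0..<k] \<in> C)} < \<delta>"
      by (rule cylinder_approximation[OF _ \<delta>])
    then show "\<exists>p. measure \<mu> {x \<in> space \<mu>. (x \<in> A) \<noteq> (map x [0..<fst p] \<in> snd p)} < \<delta>"
      by (intro exI[of _ "(k, C)"]) simp
  qed
  from bchoice[OF this] obtain f where f: "\<forall>A\<in>Q. measure \<mu> {x \<in> space \<mu>. (x \<in> A) \<noteq> (map x [0..<fst (f A)] \<in> snd (f A))} < \<delta>" ..
  define k where "k A = fst (f A)" for A
  define C where "C A = snd (f A)" for A
  have kC: "measure \<mu> {x \<in> space \<mu>. (x \<in> A) \<noteq> (map x [0..<k A] \<in> C A)} < \<delta>" if "A \<in> Q" for A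
    using f that unfolding k_def C_def by blast
  define K where "K = Max (insert 0 (k ` Q))"
  define E where "E A = {l. take (k A) l \<in> C A}" for A
  have E: "(map x [0..<K] \<in> E A) = (map x [0..<k A] \<in> C A)" if "A \<in> Q" for A and x :: "nat \<Rightarrow> nat"
  proof -
    have "k A \<le> K" unfolding K_def using Q(2) that by (intro Max_ge) auto
    then show ?thesis by (simp add: E_def take_map)
  qed
  define X where "X A = {x \<in> space \<mu>. (x \<in> A) \<noteq> (map x [0..<K] \<in> E A)}" for A
  have X: "X A \<in> sets \<mu>" "measure \<mu> (X A) < \<delta>" if "A \<in> Q" for A
  proof -
    have "A \<inter> space \<mu> \<in> sets \<mu>" using that Q(3) by blast
    then show "X A \<in> sets \<mu>" unfolding X_def by (rule sets_mismatch)
    show "measure \<mu> (X A) < \<delta>" using kC[OF that] E[OF that] by (simp add: X_def)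
  qed
  \<comment> \<open>A guess of the cell from the prefix alone. Off the exceptional sets exactly one
    cell fits, so the guess is right there.\<close>
  define q where "q l = (SOME A. A \<in> Q \<and> l \<in> E A)" for l
  define D where "D x = (if q (map x [0..<K]) = partition_cell Q x then None else Some (partition_cell Q x))" for x
  have cell: "simple_function \<mu> (partition_cell Q)" by (rule simple_function_partition_cell[OF Q])
  have "simple_function \<mu> (\<lambda>x. (map x [0..<K], partition_cell Q x))"
    by (intro simple_function_Pair simple_function_prefix cell)
  from simple_function_comp[OF this, of "\<lambda>(l, A). if q l = A then None else Some A"]
  have D: "simple_function \<mu> D" by (simp add: D_def[abs_def])
  have err: "x \<in> (\<Union>A\<in>Q. X A)" if x: "x \<in> space \<mu>" "D x \<noteq> None" for x
  proof (rule ccontr)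
    assume "x \<notin> (\<Union>A\<in>Q. X A)"
    then have iff: "(x \<in> A) = (map x [0..<K] \<in> E A)" if "A \<in> Q" for A using that x by (auto simp: X_def)
    have "partition_cell Q x \<in> Q \<and> map x [0..<K] \<in> E (partition_cell Q x)"
      using iff partition_cell_in[OF Q(1) x(1)] by blast
    then have "q (map x [0..<K]) \<in> Q \<and> map x [0..<K] \<in> E (q (map x [0..<K]))"
      unfolding q_def by (rule someI)
    then have "q (map x [0..<K]) = partition_cell Q x"
      using iff partition_cell_eq[OF Q(1)] by metis
    then show False using x(2) by (simp add: D_def)
  qed
  have UX: "(\<Union>A\<in>Q. X A) \<in> sets \<mu>" using X(1) Q(2) by blast
  have "measure \<mu> (\<Union>A\<in>Q. X A) \<le> (\<Sum>A\<in>Q. measure \<mu> (X A))"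
    using X(1) Q(2) by (intro finite_measure_subadditive_finite) auto
  also have "\<dots> \<le> (\<Sum>A\<in>Q. \<delta>)" using X(2) by (intro sum_mono) (auto intro: less_imp_le)
  also have "\<dots> \<le> s\<^sup>2" using r\<delta> by (simp add: r_def)
  finally have UX_le: "measure \<mu> (\<Union>A\<in>Q. X A) \<le> s\<^sup>2" .
  have pS: "obs_prob \<mu> D (Some A) \<le> s\<^sup>2" for A
  proof -
    have "obs_prob \<mu> D (Some A) \<le> measure \<mu> (\<Union>A\<in>Q. X A)"
      unfolding obs_prob_def using err by (intro finite_measure_mono UX) auto
    then show ?thesis using UX_le by simp
  qed
  have pN: "1 - s\<^sup>2 \<le> obs_prob \<mu> D None"
  proof -
    have "1 - measure \<mu> (\<Union>A\<in>Q. X A) = measure \<mu> (space \<mu> - (\<Union>A\<in>Q. X A))"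
      using prob_compl[OF UX] by simp
    also have "\<dots> \<le> obs_prob \<mu> D None"
    proof -
      have "space \<mu> - (\<Union>A\<in>Q. X A) \<subseteq> D -` {None} \<inter> space \<mu>" using err by blast
      then show ?thesis
        unfolding obs_prob_def by (rule finite_measure_mono[OF _ simple_functionD(2)[OF D]])
    qed
    finally show ?thesis using UX_le by linarith
  qed
  have imD: "D ` space \<mu> \<subseteq> insert None (Some ` Q)" using partition_cell_in(1)[OF Q(1)] by (auto simp: D_def)
  have finD: "finite (insert None (Some ` Q))" using Q(2) by simp
  have "obs_entropy \<mu> D = - (obs_prob \<mu> D None * ln (obs_prob \<mu> D None))
      + (\<Sum>A\<in>Q. - (obs_prob \<mu> D (Some A) * ln (obs_prob \<mu> D (Some A))))"
    unfolding obs_entropy_superset[OF finD imD] using Q(2)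
    by (subst sum.insert) (auto simp: sum.reindex sum_negf)
  also have "- (obs_prob \<mu> D None * ln (obs_prob \<mu> D None)) \<le> s"
  proof (cases "obs_prob \<mu> D None = 0")
    case False
    define p where "p = obs_prob \<mu> D None"
    have p: "p > 0" using False obs_prob_nonneg[of \<mu> D None] by (simp add: p_def)
    have "- ln p = ln (1 / p)" using p by (simp add: ln_div)
    also have "\<dots> \<le> 1 / p - 1" using p by (intro ln_le_minus_one) auto
    finally have "p * (- ln p) \<le> p * (1 / p - 1)" using p by (intro mult_left_mono) auto
    also have "\<dots> = 1 - p" using p by (simp add: right_diff_distrib)
    also have "\<dots> \<le> s\<^sup>2" using pN by (simp add: p_def)
    also have "\<dots> \<le> s" using s by (simp add: power2_eq_square mult_left_le)
    finally show ?thesis by (simp add: p_def)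
  qed (use s in simp)
  also have "(\<Sum>A\<in>Q. - (obs_prob \<mu> D (Some A) * ln (obs_prob \<mu> D (Some A)))) \<le> (\<Sum>A\<in>Q. 2 * s)"
  proof (rule sum_mono)
    fix A
    have "- (obs_prob \<mu> D (Some A) * ln (obs_prob \<mu> D (Some A))) \<le> 2 * sqrt (obs_prob \<mu> D (Some A))"
      by (rule neg_x_ln_x_le_sqrt[OF obs_prob_nonneg])
    also have "sqrt (obs_prob \<mu> D (Some A)) \<le> sqrt (s\<^sup>2)" using pS by (rule real_sqrt_le_mono)
    also have "sqrt (s\<^sup>2) = s" using s by simp
    finally show "- (obs_prob \<mu> D (Some A) * ln (obs_prob \<mu> D (Some A))) \<le> 2 * s" by simp
  qed
  also have "s + (\<Sum>A\<in>Q. 2 * s) = (2 * r + 1) * s" by (simp add: r_def algebra_simps)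
  finally have "obs_entropy \<mu> D \<le> \<epsilon>" using s(3) by simp
  then show thesis using that[OF D, of q K] by (auto simp: D_def)
qed

section \<open>The partition by the first symbol generates\<close>

definition symbol_entropy :: real
  where "symbol_entropy = lim (\<lambda>n. obs_entropy \<mu> (\<lambda>x. map x [0..<n]) / n)"

lemma symbol_entropy_LIMSEQ: "(\<lambda>n. obs_entropy \<mu> (\<lambda>x. map x [0..<n]) / n) \<longlonglongrightarrow> symbol_entropy"
  unfolding symbol_entropy_def using entropy_rate_convergent[OF simple_function_first]
  by (simp add: itinerary_first convergent_LIMSEQ_iff)

lemma entropy_wrt_LIMSEQ:
  assumes Q: "partition_on (space \<mu>) Q" "finite Q" "Q \<subseteq> sets \<mu>"
  shows "(\<lambda>n. obs_entropy \<mu> (itinerary (partition_cell Q) n) / n) \<longlonglongrightarrow> entropy_wrt \<mu> left_shift Q"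
  unfolding entropy_wrt_def partition_entropy_iterated_join[OF Q]
  using entropy_rate_convergent[OF simple_function_partition_cell[OF Q]]
  by (simp add: convergent_LIMSEQ_iff)

text \<open>The itinerary of length \<open>n\<close> in any partition is a function of the prefix of
  length \<open>n + K\<close> and of \<open>n\<close> values of the correction process
  \<open>D\<close>. The latter have entropy at most \<open>n * \<epsilon>\<close>, and the fixed
  \<open>K\<close> disappears after division by \<open>n\<close>.\<close>

lemma entropy_wrt_le_symbol_entropy:
  assumes Q: "partition_on (space \<mu>) Q" "finite Q" "Q \<subseteq> sets \<mu>"
  shows "entropy_wrt \<mu> left_shift Q \<le> symbol_entropy"
proof (rule field_le_epsilon)
  fix \<epsilon> :: real assume \<epsilon>: "\<epsilon> > 0"
  obtain K D q where D: "simple_function \<mu> D" "obs_entropy \<mu> D \<le> \<epsilon>" and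
    cell: "\<forall>x\<in>space \<mu>. partition_cell Q x = (case D x of None \<Rightarrow> q (map x [0..<K]) | Some A \<Rightarrow> A)"
    by (rule partition_prefix_coding[OF Q \<epsilon>])
  define a where "a n = obs_entropy \<mu> (\<lambda>x. map x [0..<n])" for n
  have le: "obs_entropy \<mu> (itinerary (partition_cell Q) n) \<le> a (n + K) + n * \<epsilon>" for n
  proof -
    define F where "F p = map (\<lambda>i. case snd p ! i of None \<Rightarrow> q (take K (drop i (fst p))) | Some A \<Rightarrow> A) [0..<n]"
      for p :: "nat list \<times> (nat \<Rightarrow> nat) set option list"
    have simp: "simple_function \<mu> (\<lambda>x. (map x [0..<n + K], itinerary D n x))"
      by (intro simple_function_Pair simple_function_prefix simple_function_itinerary D(1))
    have F: "itinerary (partition_cell Q) n x = F (map x [0..<n + K], itinerary D n x)" if x: "x \<in> space \<mu>" for x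
    proof -
      have "partition_cell Q ((left_shift ^^ i) x) = (case D ((left_shift ^^ i) x) of
          None \<Rightarrow> q (take K (drop i (map x [0..<n + K]))) | Some A \<Rightarrow> A)" if "i < n" for i
      proof -
        have "(left_shift ^^ i) x \<in> space \<mu>" using measurable_space[OF funpow_measurable x] .
        moreover have "map ((left_shift ^^ i) x) [0..<K] = take K (drop i (map x [0..<n + K]))"
          using that by (intro nth_equalityI) (auto simp: funpow_left_shift add.commute)
        ultimately show ?thesis using cell by metis
      qed
      then show ?thesis by (simp add: itinerary_def F_def cong: option.case_cong)
    qed
    have "obs_entropy \<mu> (itinerary (partition_cell Q) n) = obs_entropy \<mu> (\<lambda>x. F (map x [0..<n + K], itinerary D n x))"
    proof -
      have "itinerary (partition_cell Q) n ` space \<mu> = (\<lambda>x. F (map x [0..<n + K], itinerary D n x)) ` space \<mu>"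
        using F by (rule image_cong[OF refl])
      moreover have "obs_prob \<mu> (itinerary (partition_cell Q) n) y = obs_prob \<mu> (\<lambda>x. F (map x [0..<n + K], itinerary D n x)) y" for y
        unfolding obs_prob_def using F by (intro arg_cong[of _ _ "measure \<mu>"]) auto
      ultimately show ?thesis by (simp add: obs_entropy_def)
    qed
    also have "\<dots> \<le> obs_entropy \<mu> (\<lambda>x. (map x [0..<n + K], itinerary D n x))" by (rule obs_entropy_comp_le[OF simp])
    also have "\<dots> \<le> a (n + K) + obs_entropy \<mu> (itinerary D n)"
      unfolding a_def by (intro obs_entropy_Pair_le simple_function_prefix simple_function_itinerary D(1))
    also have "obs_entropy \<mu> (itinerary D n) \<le> n * obs_entropy \<mu> D" by (rule obs_entropy_itinerary_le[OF D(1)])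
    also have "\<dots> \<le> n * \<epsilon>" using D(2) by (intro mult_left_mono) auto
    finally show ?thesis by simp
  qed
  have "(\<lambda>n. a (n + K) / real (n + K) * (1 + real K / real n) + \<epsilon>) \<longlonglongrightarrow> symbol_entropy * (1 + 0) + \<epsilon>"
    using LIMSEQ_ignore_initial_segment[OF symbol_entropy_LIMSEQ, of K]
    by (intro tendsto_intros lim_const_over_n) (simp add: a_def)
  moreover have "\<exists>N. \<forall>n\<ge>N. obs_entropy \<mu> (itinerary (partition_cell Q) n) / n \<le> a (n + K) / real (n + K) * (1 + real K / real n) + \<epsilon>"
  proof (intro exI[of _ 1] allI impI)
    fix n :: nat assume n: "n \<ge> 1"
    have "obs_entropy \<mu> (itinerary (partition_cell Q) n) / n \<le> (a (n + K) + n * \<epsilon>) / n"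
      using le by (rule divide_right_mono) simp
    also have "\<dots> = a (n + K) / n + \<epsilon>" using n by (simp add: add_divide_distrib)
    also have "a (n + K) / n = a (n + K) / real (n + K) * (real (n + K) / real n)" using n by simp
    also have "real (n + K) / real n = 1 + real K / real n" using n by (simp add: add_divide_distrib)
    finally show "obs_entropy \<mu> (itinerary (partition_cell Q) n) / n \<le> a (n + K) / real (n + K) * (1 + real K / real n) + \<epsilon>" .
  qed
  ultimately show "entropy_wrt \<mu> left_shift Q \<le> symbol_entropy + \<epsilon>"
    using LIMSEQ_le[OF entropy_wrt_LIMSEQ[OF Q]] by auto
qed

lemma ks_entropy_le_symbol_entropy: "ks_entropy \<mu> left_shift \<le> ereal symbol_entropy"
  unfolding ks_entropy_def by (rule SUP_least) (auto intro: entropy_wrt_le_symbol_entropy)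

end


section \<open>Measures with vanishing exponent have entropy at most the pressure\<close>

lemma (in prob_space) obs_entropy_cong:
  assumes "\<And>x. x \<in> space M \<Longrightarrow> X x = Y x"
  shows "obs_entropy M X = obs_entropy M Y"
proof -
  have "X ` space M = Y ` space M" using assms by (rule image_cong[OF refl])
  moreover have "obs_prob M X y = obs_prob M Y y" for y
    unfolding obs_prob_def using assms by (intro arg_cong[of _ _ "measure M"]) auto
  ultimately show ?thesis by (simp add: obs_entropy_def)
qed

context shift_measure
begin

text \<open>Prefixes are relabelled itineraries in the partition into the two cylinders of length
  one.\<close>

lemma symbol_entropy_le_ks_entropy: "ereal symbol_entropy \<le> ks_entropy \<mu> left_shift"
proof -
  define C where "C c = {x \<in> full_shift. x 0 = c}" for c :: nat
  define Q where "Q = {C 1, C 2}"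
  have C: "C c \<in> sets \<mu>" for c
  proof -
    have "C c = prefix_set 1 {[c]}" by (auto simp: C_def prefix_set_def)
    also have "\<dots> \<in> sets \<mu>" by (rule prefix_set_sets)
    finally show ?thesis .
  qed
  have ne: "(\<lambda>_. 1) \<in> C 1" "(\<lambda>_. 2) \<in> C 2" by (auto simp: C_def full_shift_def)
  have disj: "C 1 \<inter> C 2 = {}" by (auto simp: C_def)
  have cover: "C 1 \<union> C 2 = full_shift" by (auto simp: C_def full_shift_def)
  have Q: "partition_on (space \<mu>) Q" "finite Q" "Q \<subseteq> sets \<mu>"
  proof -
    show "partition_on (space \<mu>) Q"
    proof (rule partition_onI)
      show "\<Union>Q = space \<mu>" using cover by (simp add: Q_def space_eq)
      show "disjnt p p'" if "p \<in> Q" "p' \<in> Q" "p \<noteq> p'" for p p'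
        using that disj by (auto simp: Q_def disjnt_def)
      show "{} \<notin> Q" using ne by (auto simp: Q_def)
    qed
  qed (use C in \<open>auto simp: Q_def\<close>)
  define sym where "sym A = (if A = C 1 then 1 else 2 :: nat)" for A
  have C12: "C 2 \<noteq> C 1"
  proof
    assume "C 2 = C 1"
    then have "(\<lambda>_. 1) \<in> C 2" using ne(1) by (simp only:)
    then show False by (simp add: C_def)
  qed
  have sym: "sym (partition_cell Q x) = x 0" if "x \<in> space \<mu>" for x
  proof -
    have x: "x 0 = 1 \<or> x 0 = 2" "x \<in> C (x 0)" using that by (auto simp: space_eq full_shift_def C_def)
    have "C (x 0) \<in> Q" using x(1) by (auto simp: Q_def)
    from partition_cell_eq[OF Q(1) this x(2)] have "partition_cell Q x = C (x 0)" .
    moreover have "sym (C 1) = 1" "sym (C 2) = 2" using C12 by (simp_all add: sym_def)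
    ultimately show ?thesis using x(1) by (elim disjE) (simp_all only:)
  qed
  have le: "obs_entropy \<mu> (\<lambda>x. map x [0..<n]) \<le> obs_entropy \<mu> (itinerary (partition_cell Q) n)" for n
  proof -
    have "map x [0..<n] = map sym (itinerary (partition_cell Q) n x)" if x: "x \<in> space \<mu>" for x
    proof -
      have "sym (partition_cell Q ((left_shift ^^ i) x)) = x i" for i
        using sym[OF measurable_space[OF funpow_measurable x], of i] by (simp only: funpow_left_shift add_0)
      then show ?thesis by (simp add: itinerary_def)
    qed
    then have "obs_entropy \<mu> (\<lambda>x. map x [0..<n]) = obs_entropy \<mu> (\<lambda>x. map sym (itinerary (partition_cell Q) n x))"
      by (rule obs_entropy_cong)
    also have "\<dots> \<le> obs_entropy \<mu> (itinerary (partition_cell Q) n)"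
      by (rule obs_entropy_comp_le[OF simple_function_itinerary[OF simple_function_partition_cell[OF Q]]])
    finally show ?thesis .
  qed
  have "symbol_entropy \<le> entropy_wrt \<mu> left_shift Q"
    by (rule LIMSEQ_le[OF symbol_entropy_LIMSEQ entropy_wrt_LIMSEQ[OF Q]])
      (auto intro!: divide_right_mono le)
  also have "ereal (entropy_wrt \<mu> left_shift Q) \<le> ks_entropy \<mu> left_shift"
    unfolding ks_entropy_def using Q by (intro SUP_upper) auto
  finally show ?thesis by simp
qed

lemma ks_entropy_eq_symbol_entropy: "ks_entropy \<mu> left_shift = ereal symbol_entropy"
  using ks_entropy_le_symbol_entropy symbol_entropy_le_ks_entropy by (rule antisym)

end

context hyperbolic_rotation
begin

lemma ln_sn_bounds: "0 \<le> ln (spectral_norm (wm w))" "ln (spectral_norm (wm w)) \<le> length w * ln lam"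
proof -
  show "0 \<le> ln (spectral_norm (wm w))" using sn_ge_1 by simp
  have "ln (spectral_norm (wm w)) \<le> ln (lam ^ length w)"
    using spectral_norm_wm_le sn_pos lam by simp
  then show "ln (spectral_norm (wm w)) \<le> length w * ln lam" using lam by (simp add: ln_realpow)
qed

lemma ln_sn_append: "ln (spectral_norm (wm (u @ v))) \<le> ln (spectral_norm (wm u)) + ln (spectral_norm (wm v))"
proof -
  have "ln (spectral_norm (wm (u @ v))) \<le> ln (spectral_norm (wm v) * spectral_norm (wm u))"
  proof (subst ln_le_cancel_iff)
    show "spectral_norm (wm (u @ v)) \<le> spectral_norm (wm v) * spectral_norm (wm u)"
      by (simp add: word_matrix_append spectral_norm_mult)
  qed (use sn_pos in auto)
  then show ?thesis using sn_pos by (simp add: ln_mult_pos)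
qed

lemma top_lyapunov_eq:
  "top_lyapunov (generators lam \<theta>) \<mu> = lim (\<lambda>n. (\<integral>x. ln (spectral_norm (wm (map x [0..<n]))) \<partial>\<mu>) / n)"
  by (simp add: top_lyapunov_def cocycle_eq_word_matrix)

text \<open>The definition by \<open>lim\<close> carries information only once convergence is known;
  it follows from Fekete's lemma, by submultiplicativity of the norm and invariance of the
  measure.\<close>

lemma top_lyapunov_LIMSEQ:
  assumes "\<mu> \<in> invariant_measures"
  shows "(\<lambda>n. (\<integral>x. ln (spectral_norm (wm (map x [0..<n]))) \<partial>\<mu>) / n) \<longlonglongrightarrow> top_lyapunov (generators lam \<theta>) \<mu>"
proof -
  interpret shift_measure \<mu> by unfold_locales (rule assms)
  define f where "f w = ln (spectral_norm (wm w))" for w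
  define a where "a n = (\<integral>x. f (map x [0..<n]) \<partial>\<mu>)" for n
  have int: "integrable \<mu> (\<lambda>x. f (X x))" if X: "simple_function \<mu> X" "\<And>x. length (X x) = n" for n and X :: "_ \<Rightarrow> nat list"
  proof (rule integrable_const_bound[of _ "n * ln lam"])
    show "AE x in \<mu>. norm (f (X x)) \<le> n * ln lam"
      using ln_sn_bounds X(2) unfolding f_def by (intro AE_I2) (metis abs_of_nonneg real_norm_def)
    show "(\<lambda>x. f (X x)) \<in> borel_measurable \<mu>"
      by (rule borel_measurable_simple_function[OF simple_function_comp[OF X(1)]])
  qed
  have shift: "(\<integral>x. f (map ((left_shift ^^ m) x) [0..<n]) \<partial>\<mu>) = a n" for m n
  proof -
    note s = simple_function_prefix[of n]
    note fin = simple_functionD(1)[OF s]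
    have im: "(\<lambda>x. map ((left_shift ^^ m) x) [0..<n]) ` space \<mu> \<subseteq> (\<lambda>x. map x [0..<n]) ` space \<mu>"
      using measurable_space[OF funpow_measurable[of m]] by blast
    show ?thesis
      unfolding a_def
      using integral_finite_observable[OF s fin, of f]
        integral_finite_observable[OF simple_function_funpow[OF s] fin im, of f] obs_prob_funpow[OF s]
      by simp
  qed
  have "convergent (\<lambda>n. a n / n)"
  proof (rule subadditive_convergent(1))
    fix m n
    have split: "map x [0..<m + n] = map x [0..<m] @ map ((left_shift ^^ m) x) [0..<n]" for x
      using itinerary_add[of "\<lambda>x. x 0" m n x] unfolding itinerary_first .
    have i1: "integrable \<mu> (\<lambda>x. f (map x [0..<m]))" by (rule int[OF simple_function_prefix]) simp
    have i2: "integrable \<mu> (\<lambda>x. f (map ((left_shift ^^ m) x) [0..<n]))"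
      by (rule int[OF simple_function_funpow[OF simple_function_prefix]]) simp
    have "a (m + n) \<le> (\<integral>x. f (map x [0..<m]) + f (map ((left_shift ^^ m) x) [0..<n]) \<partial>\<mu>)"
      unfolding a_def
    proof (rule integral_mono)
      show "integrable \<mu> (\<lambda>x. f (map x [0..<m + n]))" by (rule int[OF simple_function_prefix]) simp
      show "f (map x [0..<m + n]) \<le> f (map x [0..<m]) + f (map ((left_shift ^^ m) x) [0..<n])" for x
        unfolding split f_def by (rule ln_sn_append)
    qed (use i1 i2 in simp)
    also have "\<dots> = a m + a n" using i1 i2 shift by (simp add: a_def)
    finally show "a (m + n) \<le> a m + a n" .
  next
    show "0 \<le> a n" for n unfolding a_def f_def using ln_sn_bounds(1) by (intro integral_nonneg_AE) simp
  qed
  then show ?thesis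
    unfolding top_lyapunov_eq a_def f_def by (simp add: convergent_LIMSEQ_iff)
qed

text \<open>The easy half of the variational principle. With vanishing exponent the energy term
  tends to 0 after division by \<open>n\<close>, so the same bound holds for every real
  \<open>t\<close>.\<close>

lemma ks_entropy_le_P:
  assumes "\<mu> \<in> invariant_measures" "top_lyapunov (generators lam \<theta>) \<mu> = 0"
  shows "ks_entropy \<mu> left_shift \<le> ereal (P t)"
proof -
  interpret shift_measure \<mu> by unfold_locales (rule assms(1))
  define a where "a n = (\<integral>x. ln (spectral_norm (wm (map x [0..<n]))) \<partial>\<mu>)" for n
  have a0: "(\<lambda>n. a n / n) \<longlonglongrightarrow> 0" using top_lyapunov_LIMSEQ[OF assms(1)] assms(2) by (simp add: a_def)
  have "obs_entropy \<mu> (\<lambda>x. map x [0..<n]) + t * a n \<le> ln (partition_sum t n)" for n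
  proof -
    note s = simple_function_prefix[of n]
    define p where "p = obs_prob \<mu> (\<lambda>x. map x [0..<n])"
    define N where "N w = spectral_norm (wm w)" for w
    define S where "S = partition_sum t n"
    have S: "S > 0" unfolding S_def by (rule partition_sum_pos)
    have N: "N w > 0" for w unfolding N_def by (rule sn_pos)
    have sum_p: "sum p (word_set n) = 1"
      unfolding p_def by (rule sum_obs_prob[OF s finite_word_set prefix_in_word_set])
    have "- (\<Sum>w\<in>word_set n. p w * ln (p w)) \<le> - (\<Sum>w\<in>word_set n. p w * ln (N w powr t / S))"
    proof (rule gibbs_inequality)
      show "0 \<le> p w" for w by (simp add: p_def obs_prob_nonneg)
      show "(\<Sum>w\<in>word_set n. N w powr t / S) \<le> 1"
        using S by (simp add: S_def partition_sum_def N_def flip: sum_divide_distrib)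
      show "0 < N w powr t / S" for w using S N[of w] by simp
      then show "0 \<le> N w powr t / S" for w by (simp add: less_imp_le)
    qed (use sum_p in auto)
    also have "(\<Sum>w\<in>word_set n. p w * ln (N w powr t / S)) = (\<Sum>w\<in>word_set n. t * (p w * ln (N w)) - p w * ln S)"
      using S N by (intro sum.cong) (auto simp: ln_div ln_powr algebra_simps less_imp_neq[symmetric])
    also have "\<dots> = t * (\<Sum>w\<in>word_set n. p w * ln (N w)) - ln S"
      using sum_p by (simp add: sum_subtractf flip: sum_distrib_left sum_distrib_right)
    also have "(\<Sum>w\<in>word_set n. p w * ln (N w)) = a n"
      unfolding a_def N_def p_def
      by (rule integral_finite_observable[OF s finite_word_set prefix_in_word_set, symmetric])
    finally show ?thesis
      unfolding obs_entropy_superset[OF finite_word_set prefix_in_word_set] S_def p_def by simp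
  qed
  then have "(obs_entropy \<mu> (\<lambda>x. map x [0..<n]) + t * a n) / n \<le> ln (partition_sum t n) / n" for n
    by (rule divide_right_mono) simp
  then have le: "obs_entropy \<mu> (\<lambda>x. map x [0..<n]) / n + t * (a n / n) \<le> ln (partition_sum t n) / n" for n
    by (simp add: add_divide_distrib)
  have "(\<lambda>n. obs_entropy \<mu> (\<lambda>x. map x [0..<n]) / n + t * (a n / n)) \<longlonglongrightarrow> symbol_entropy + t * 0"
    by (intro tendsto_intros symbol_entropy_LIMSEQ a0)
  from LIMSEQ_le[OF this P_LIMSEQ] le have "symbol_entropy \<le> P t" by auto
  then show ?thesis by (simp add: ks_entropy_eq_symbol_entropy)
qed

end


section \<open>Invariant measures with prescribed cylinder probabilities\<close>

lemma prefix_set_Int: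
  "prefix_set m C \<inter> prefix_set n D = prefix_set (max m n) {l. take m l \<in> C \<and> take n l \<in> D}"
  by (auto simp: prefix_set_def take_map)

text \<open>The unit interval is cut into intervals \<open>[left_end p w, left_end p w + p w)\<close>, ordered
  lexicographically; \<open>interval_code p u n\<close> is the word of length \<open>n\<close> whose interval contains \<open>u\<close>.\<close>

definition left_end :: "(nat list \<Rightarrow> real) \<Rightarrow> nat list \<Rightarrow> real"
  where "left_end p w = (\<Sum>i<length w. if w ! i = 2 then p (take i w @ [1]) else 0)"

primrec interval_code :: "(nat list \<Rightarrow> real) \<Rightarrow> real \<Rightarrow> nat \<Rightarrow> nat list"
  where
    "interval_code p u 0 = []"
  | "interval_code p u (Suc n) = interval_code p u n @
      [if u < left_end p (interval_code p u n) + p (interval_code p u n @ [1]) then 1 else 2]"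

lemma left_end_snoc: "left_end p (w @ [c]) = left_end p w + (if c = 2 then p (w @ [1]) else 0)"
proof -
  have "(\<Sum>i<length w. if (w @ [c]) ! i = 2 then p (take i (w @ [c]) @ [1]) else 0) = left_end p w"
    unfolding left_end_def by (intro sum.cong) (auto simp: nth_append)
  then show ?thesis by (simp add: left_end_def)
qed

lemma word_set_Suc_iff: "w \<in> word_set (Suc n) \<longleftrightarrow> (\<exists>v c. w = v @ [c] \<and> v \<in> word_set n \<and> c \<in> {1, 2})"
proof
  assume w: "w \<in> word_set (Suc n)"
  then have "w \<noteq> []" by (auto simp: word_set_def)
  then have "w = butlast w @ [last w]" by simp
  moreover have "butlast w \<in> word_set n" using w by (auto simp: word_set_def dest: in_set_butlastD)
  moreover have "set w \<subseteq> {1, 2}" using w by (simp add: word_set_def)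
  then have "last w \<in> {1, 2}" using last_in_set[OF \<open>w \<noteq> []\<close>] by (rule subsetD)
  ultimately show "\<exists>v c. w = v @ [c] \<and> v \<in> word_set n \<and> c \<in> {1, 2}" by blast
qed (auto simp: word_set_def)

lemma interval_code_in_word_set: "interval_code p u n \<in> word_set n"
  by (induction n) (auto simp: word_set_def)

text \<open>The condition \<open>p_right\<close> is Kolmogorov consistency, and
  \<open>p_left\<close> is shift invariance on cylinders.\<close>

locale cylinder_probabilities =
  fixes p :: "nat list \<Rightarrow> real"
  assumes p_Nil: "p [] = 1" and p_nonneg: "\<And>w. 0 \<le> p w"
    and p_right: "\<And>n w. w \<in> word_set n \<Longrightarrow> p w = p (w @ [1]) + p (w @ [2])"
    and p_left: "\<And>n w. w \<in> word_set n \<Longrightarrow> p w = p (1 # w) + p (2 # w)"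
begin

lemma left_end_bounds: "w \<in> word_set n \<Longrightarrow> 0 \<le> left_end p w \<and> left_end p w + p w \<le> 1"
proof (induction n arbitrary: w)
  case 0
  then show ?case by (simp add: left_end_def p_Nil)
next
  case (Suc n)
  then obtain v c where v: "w = v @ [c]" "v \<in> word_set n" "c \<in> {1, 2}" by (auto simp: word_set_Suc_iff)
  then show ?case
    using Suc.IH[OF v(2)] p_right[OF v(2)] p_nonneg[of "v @ [1]"] p_nonneg[of "v @ [2]"]
    by (auto simp: left_end_snoc)
qed

lemma interval_code_iff:
  assumes u: "0 \<le> u" "u < 1"
  shows "w \<in> word_set n \<Longrightarrow> interval_code p u n = w \<longleftrightarrow> left_end p w \<le> u \<and> u < left_end p w + p w"
proof (induction n arbitrary: w)
  case 0
  then show ?case using u by (simp add: left_end_def p_Nil)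
next
  case (Suc n)
  then obtain v c where v: "w = v @ [c]" "v \<in> word_set n" "c = 1 \<or> c = 2" by (auto simp: word_set_Suc_iff)
  have "interval_code p u (Suc n) = w \<longleftrightarrow>
    interval_code p u n = v \<and> (if u < left_end p v + p (v @ [1]) then 1 else 2) = c"
    using v(1) by auto
  also have "\<dots> \<longleftrightarrow> left_end p w \<le> u \<and> u < left_end p w + p w"
    unfolding Suc.IH[OF v(2)] using v(1,3) p_right[OF v(2)] p_nonneg[of "v @ [1]"] p_nonneg[of "v @ [2]"]
    by (auto simp: left_end_snoc)
  finally show ?case .
qed

definition coded_point :: "real \<Rightarrow> nat \<Rightarrow> nat"
  where "coded_point u n = last (interval_code p u (Suc n))"

lemma prefix_coded_point: "map (coded_point u) [0..<n] = interval_code p u n"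
proof (induction n)
  case (Suc n)
  have "map (coded_point u) [0..<Suc n] = interval_code p u n @ [coded_point u n]" using Suc by simp
  moreover have "interval_code p u (Suc n) = interval_code p u n @ [coded_point u n]"
    by (simp add: coded_point_def)
  ultimately show ?case by (simp only:)
qed simp

lemma coded_point_in_full_shift: "coded_point u \<in> full_shift"
  by (auto simp: full_shift_def coded_point_def)

definition unit_lebesgue :: "real measure"
  where "unit_lebesgue = restrict_space lborel {0..<1}"

lemma space_unit_lebesgue: "space unit_lebesgue = {0..<1}"
  by (simp add: unit_lebesgue_def space_restrict_space)

lemma interval_code_vimage:
  assumes "w \<in> word_set n"
  shows "(\<lambda>u. interval_code p u n) -` {w} \<inter> space unit_lebesgue = {left_end p w..<left_end p w + p w}"
proof (rule set_eqI)
  fix u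
  have "u \<in> (\<lambda>u. interval_code p u n) -` {w} \<inter> space unit_lebesgue \<longleftrightarrow> 0 \<le> u \<and> u < 1 \<and> interval_code p u n = w"
    by (auto simp: space_unit_lebesgue)
  also have "\<dots> \<longleftrightarrow> 0 \<le> u \<and> u < 1 \<and> left_end p w \<le> u \<and> u < left_end p w + p w"
    using interval_code_iff[OF _ _ assms, of u] by blast
  also have "\<dots> \<longleftrightarrow> u \<in> {left_end p w..<left_end p w + p w}"
    using left_end_bounds[OF assms] by auto
  finally show "u \<in> (\<lambda>u. interval_code p u n) -` {w} \<inter> space unit_lebesgue
      \<longleftrightarrow> u \<in> {left_end p w..<left_end p w + p w}" .
qed

lemma interval_in_sets:
  assumes "w \<in> word_set n"
  shows "{left_end p w..<left_end p w + p w} \<in> sets unit_lebesgue"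
  using left_end_bounds[OF assms] unfolding unit_lebesgue_def
  by (subst sets_restrict_space_iff) auto

lemma interval_code_measurable: "(\<lambda>u. interval_code p u n) \<in> measurable unit_lebesgue (count_space UNIV)"
proof (subst measurable_count_space_eq2_countable, intro conjI ballI)
  fix a :: "nat list"
  show "(\<lambda>u. interval_code p u n) -` {a} \<inter> space unit_lebesgue \<in> sets unit_lebesgue"
  proof (cases "a \<in> word_set n")
    case False
    then have "(\<lambda>u. interval_code p u n) -` {a} = {}" using interval_code_in_word_set by auto
    then show ?thesis by simp
  qed (simp add: interval_code_vimage interval_in_sets)
qed simp

lemma coded_point_measurable: "coded_point \<in> measurable unit_lebesgue (restrict_space borel full_shift)"
proof (rule measurable_restrict_space2)
  show "coded_point \<in> borel_measurable unit_lebesgue"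
  proof (rule measurable_coordinatewise_then_product)
    fix i
    have "last \<in> measurable (count_space UNIV) (borel :: nat measure)" by simp
    from measurable_compose[OF interval_code_measurable[of "Suc i"] this]
    show "(\<lambda>u. coded_point u i) \<in> borel_measurable unit_lebesgue"
      unfolding coded_point_def .
  qed
qed (simp add: coded_point_in_full_shift)

text \<open>Pushing Lebesgue measure through the coding gives each cylinder the length of its
  interval, which realises \<open>p\<close> as a measure without an extension theorem.\<close>

definition coded_measure :: "(nat \<Rightarrow> nat) measure"
  where "coded_measure = distr unit_lebesgue (restrict_space borel full_shift) coded_point"

lemma prob_space_coded_measure: "prob_space coded_measure"
proof -
  have "prob_space unit_lebesgue"
    unfolding unit_lebesgue_def by (rule prob_space_restrict_space) auto
  then show ?thesis
    unfolding coded_measure_def by (rule prob_space.prob_space_distr[OF _ coded_point_measurable])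
qed

lemma sets_coded_measure: "sets coded_measure = sets (restrict_space borel full_shift)"
  by (simp add: coded_measure_def)

lemma measure_prefix_set_word:
  assumes "w \<in> word_set n"
  shows "measure coded_measure (prefix_set n {w}) = p w"
proof -
  have "measure coded_measure (prefix_set n {w}) = measure unit_lebesgue (coded_point -` prefix_set n {w} \<inter> space unit_lebesgue)"
    unfolding coded_measure_def by (rule measure_distr[OF coded_point_measurable prefix_set_in_sets])
  also have "coded_point -` prefix_set n {w} \<inter> space unit_lebesgue = (\<lambda>u. interval_code p u n) -` {w} \<inter> space unit_lebesgue"
    by (auto simp: prefix_set_def prefix_coded_point coded_point_in_full_shift)
  also have "\<dots> = {left_end p w..<left_end p w + p w}" by (rule interval_code_vimage[OF assms])
  also have "measure unit_lebesgue \<dots> = measure lborel {left_end p w..<left_end p w + p w}"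
    unfolding unit_lebesgue_def using left_end_bounds[OF assms] by (intro measure_restrict_space) auto
  also have "\<dots> = p w" using p_nonneg[of w] by simp
  finally show ?thesis .
qed

lemma measure_prefix_set:
  "measure coded_measure (prefix_set n C) = (\<Sum>w\<in>word_set n \<inter> C. p w)"
proof -
  interpret prob_space coded_measure by (rule prob_space_coded_measure)
  have "prefix_set n C = (\<Union>w\<in>word_set n \<inter> C. prefix_set n {w})"
    by (auto simp: prefix_set_def full_shift_def word_set_def)
  also have "measure coded_measure \<dots> = (\<Sum>w\<in>word_set n \<inter> C. measure coded_measure (prefix_set n {w}))"
  proof (rule finite_measure_finite_Union)
    show "(\<lambda>w. prefix_set n {w}) ` (word_set n \<inter> C) \<subseteq> sets coded_measure"
      unfolding sets_coded_measure using prefix_set_in_sets by blast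
    show "disjoint_family_on (\<lambda>w. prefix_set n {w}) (word_set n \<inter> C)"
      by (auto simp: disjoint_family_on_def prefix_set_def)
  qed simp
  finally show ?thesis by (simp add: measure_prefix_set_word)
qed

text \<open>Prefix sets form an intersection-stable generator. The shift preimage of one leaves the
  first letter free, and summing over that letter is what \<open>p_left\<close> describes.\<close>

lemma coded_measure_invariant: "coded_measure \<in> invariant_measures"
proof -
  interpret prob_space coded_measure by (rule prob_space_coded_measure)
  have space: "space coded_measure = full_shift"
    by (simp add: coded_measure_def space_restrict_space)
  have shift_meas: "left_shift \<in> measurable coded_measure coded_measure"
    using left_shift_measurable_full_shift measurable_cong_sets[OF sets_coded_measure sets_coded_measure] by blast
  interpret D: prob_space "distr coded_measure coded_measure left_shift"
    by (rule prob_space_distr[OF shift_meas])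
  have "distr coded_measure coded_measure left_shift = coded_measure"
  proof (rule measure_eqI_generator_eq[where A = "\<lambda>_. full_shift"])
    show "Int_stable {prefix_set n C |n C. True}"
      unfolding Int_stable_def using prefix_set_Int by blast
    show "{prefix_set n C |n C. True} \<subseteq> Pow full_shift" by (auto simp: prefix_set_def)
    show "sets coded_measure = sigma_sets full_shift {prefix_set n C |n C. True}"
      using sets_coded_measure sets_full_shift_eq by simp
    then show "sets (distr coded_measure coded_measure left_shift) = sigma_sets full_shift {prefix_set n C |n C. True}"
      by simp
    have "full_shift = prefix_set 0 UNIV" by (auto simp: prefix_set_def)
    then show "range (\<lambda>_. full_shift) \<subseteq> {prefix_set n C |n C. True}" by blast
    show "emeasure (distr coded_measure coded_measure left_shift) full_shift \<noteq> \<infinity>" by simp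
    fix X assume "X \<in> {prefix_set n C |n C. True}"
    then obtain n C where X: "X = prefix_set n C" by blast
    have "measure (distr coded_measure coded_measure left_shift) X
        = measure coded_measure (left_shift -` X \<inter> space coded_measure)"
      by (rule measure_distr[OF shift_meas]) (simp add: X sets_coded_measure prefix_set_in_sets)
    also have "left_shift -` X \<inter> space coded_measure = prefix_set (Suc n) {l. tl l \<in> C}"
    proof -
      have "map (left_shift x) [0..<n] = tl (map x [0..<Suc n])" for x
        by (intro nth_equalityI) (auto simp: left_shift_def nth_tl simp del: upt_Suc)
      then show ?thesis
        unfolding X space prefix_set_def by (auto simp: full_shift_def left_shift_def)
    qed
    also have "measure coded_measure (prefix_set (Suc n) {l. tl l \<in> C}) = (\<Sum>w\<in>word_set (Suc n) \<inter> {l. tl l \<in> C}. p w)"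
      by (rule measure_prefix_set)
    also have "word_set (Suc n) \<inter> {l. tl l \<in> C} = Cons 1 ` (word_set n \<inter> C) \<union> Cons 2 ` (word_set n \<inter> C)"
    proof (intro equalityI subsetI)
      fix w assume "w \<in> word_set (Suc n) \<inter> {l. tl l \<in> C}"
      then show "w \<in> Cons 1 ` (word_set n \<inter> C) \<union> Cons 2 ` (word_set n \<inter> C)"
        by (cases w) (auto simp: word_set_def)
    qed (auto simp: word_set_def)
    also have "(\<Sum>w\<in>\<dots>. p w) = (\<Sum>w\<in>Cons 1 ` (word_set n \<inter> C). p w) + (\<Sum>w\<in>Cons 2 ` (word_set n \<inter> C). p w)"
      by (rule sum.union_disjoint) auto
    also have "\<dots> = (\<Sum>w\<in>word_set n \<inter> C. p (1 # w) + p (2 # w))"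
      by (simp add: sum.reindex sum.distrib)
    also have "\<dots> = (\<Sum>w\<in>word_set n \<inter> C. p w)" using p_left by (intro sum.cong) auto
    also have "\<dots> = measure coded_measure X" unfolding X by (rule measure_prefix_set[symmetric])
    finally show "emeasure (distr coded_measure coded_measure left_shift) X = emeasure coded_measure X"
      by (simp add: emeasure_eq_measure D.emeasure_eq_measure)
  qed simp
  then show ?thesis
    using prob_space_axioms sets_coded_measure by (simp add: invariant_measures_def)
qed

lemma obs_prob_coded_measure:
  assumes "w \<in> word_set n"
  shows "obs_prob coded_measure (\<lambda>x. map x [0..<n]) w = p w"
proof -
  have "(\<lambda>x. map x [0..<n]) -` {w} \<inter> space coded_measure = prefix_set n {w}"
    by (auto simp: coded_measure_def space_restrict_space prefix_set_def)
  then show ?thesis by (simp add: obs_prob_def measure_prefix_set_word[OF assms])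
qed

end


section \<open>Occurrences of words in corrected block sequences\<close>

definition occurrences :: "'a list \<Rightarrow> 'a list \<Rightarrow> nat set"
  where "occurrences V w = {i. i + length w \<le> length V \<and> take (length w) (drop i V) = w}"

lemma occurrences_subset: "occurrences V w \<subseteq> {..length V}"
  by (auto simp: occurrences_def)

lemma finite_occurrences [simp]: "finite (occurrences V w)"
  by (rule finite_subset[OF occurrences_subset]) simp

lemma occurrences_Nil: "occurrences V [] = {..length V}"
  by (auto simp: occurrences_def)

lemma occurrences_snoc:
  "i \<in> occurrences V (w @ [c]) \<longleftrightarrow> i \<in> occurrences V w \<and> i + length w < length V \<and> V ! (i + length w) = c"
proof (cases "i + length w < length V")
  case True
  then have "take (Suc (length w)) (drop i V) = take (length w) (drop i V) @ [V ! (i + length w)]"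
    by (simp add: take_Suc_conv_app_nth)
  then show ?thesis using True by (auto simp: occurrences_def)
qed (auto simp: occurrences_def)

lemma occurrences_Cons:
  "i \<in> occurrences V (c # w) \<longleftrightarrow> Suc i \<in> occurrences V w \<and> V ! i = c"
proof (cases "i < length V")
  case True
  then have "drop i V = V ! i # drop (Suc i) V" by (simp add: Cons_nth_drop_Suc)
  then show ?thesis by (auto simp: occurrences_def)
qed (auto simp: occurrences_def)

text \<open>Each occurrence has a unique following letter, except for one that ends where
  \<open>V\<close> ends; this is the additional 1.\<close>

lemma card_occurrences_right:
  assumes V: "set V \<subseteq> {1, 2 :: nat}"
  shows "card (occurrences V (w @ [1])) + card (occurrences V (w @ [2])) \<le> card (occurrences V w)"
    and "card (occurrences V w) \<le> card (occurrences V (w @ [1])) + card (occurrences V (w @ [2])) + 1"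
proof -
  define U where "U = occurrences V (w @ [1]) \<union> occurrences V (w @ [2])"
  have "occurrences V (w @ [1]) \<inter> occurrences V (w @ [2]) = {}" by (auto simp: occurrences_snoc)
  then have card_U: "card U = card (occurrences V (w @ [1])) + card (occurrences V (w @ [2]))"
    unfolding U_def by (intro card_Un_disjoint) auto
  have U: "finite U" by (simp add: U_def)
  have "U \<subseteq> occurrences V w" by (auto simp: U_def occurrences_snoc)
  then have "card U \<le> card (occurrences V w)" by (intro card_mono) auto
  then show "card (occurrences V (w @ [1])) + card (occurrences V (w @ [2])) \<le> card (occurrences V w)"
    using card_U by simp
  have "occurrences V w \<subseteq> insert (length V - length w) U"
  proof
    fix i assume i: "i \<in> occurrences V w"
    show "i \<in> insert (length V - length w) U"
    proof (cases "i + length w < length V")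
      case True
      then have "V ! (i + length w) \<in> {1, 2}" using V nth_mem by blast
      then show ?thesis using i True by (auto simp: U_def occurrences_snoc)
    qed (use i in \<open>auto simp: occurrences_def\<close>)
  qed
  then have "card (occurrences V w) \<le> card (insert (length V - length w) U)" using U by (intro card_mono) auto
  also have "\<dots> \<le> card U + 1" using card_insert_le_m1[of "Suc (card U)" U] by (simp add: card_insert_if U)
  finally show "card (occurrences V w) \<le> card (occurrences V (w @ [1])) + card (occurrences V (w @ [2])) + 1"
    using card_U by simp
qed

text \<open>The mirror image: only an occurrence at position 0 has no preceding letter.\<close>

lemma card_occurrences_left:
  assumes V: "set V \<subseteq> {1, 2 :: nat}"
  shows "card (occurrences V (1 # w)) + card (occurrences V (2 # w)) \<le> card (occurrences V w)"
    and "card (occurrences V w) \<le> card (occurrences V (1 # w)) + card (occurrences V (2 # w)) + 1"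
proof -
  define U where "U = Suc ` (occurrences V (1 # w) \<union> occurrences V (2 # w))"
  have "occurrences V (1 # w) \<inter> occurrences V (2 # w) = {}" by (auto simp: occurrences_Cons)
  then have "card (occurrences V (1 # w) \<union> occurrences V (2 # w)) = card (occurrences V (1 # w)) + card (occurrences V (2 # w))"
    by (intro card_Un_disjoint) auto
  then have card_U: "card U = card (occurrences V (1 # w)) + card (occurrences V (2 # w))"
    unfolding U_def by (simp add: card_image)
  have U: "finite U" by (simp add: U_def)
  have "U \<subseteq> occurrences V w" by (auto simp: U_def occurrences_Cons)
  then have "card U \<le> card (occurrences V w)" by (intro card_mono) auto
  then show "card (occurrences V (1 # w)) + card (occurrences V (2 # w)) \<le> card (occurrences V w)"
    using card_U by simp
  have "occurrences V w \<subseteq> insert 0 U"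
  proof
    fix i assume i: "i \<in> occurrences V w"
    show "i \<in> insert 0 U"
    proof (cases i)
      case (Suc j)
      then have "j < length V" using i by (auto simp: occurrences_def)
      then have "V ! j \<in> {1, 2}" using V nth_mem by blast
      then have "j \<in> occurrences V (1 # w) \<union> occurrences V (2 # w)"
        using i Suc by (auto simp: occurrences_Cons)
      then show ?thesis using Suc by (simp add: U_def)
    qed simp
  qed
  then have "card (occurrences V w) \<le> card (insert 0 U)" using U by (intro card_mono) auto
  also have "\<dots> \<le> card U + 1" by (simp add: card_insert_if U)
  finally show "card (occurrences V w) \<le> card (occurrences V (1 # w)) + card (occurrences V (2 # w)) + 1"
    using card_U by simp
qed

text \<open>After each block a word of fixed length \<open>L\<close> is appended that depends on the whole past.\<close>

locale corrected_blocks =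
  fixes B :: "nat list set" and n L :: nat and J :: "nat list \<Rightarrow> nat list"
  assumes B: "finite B" "B \<noteq> {}" "B \<subseteq> word_set n" and n: "n > 0"
    and J: "\<And>w. J w \<in> word_set L"
begin

definition chain :: "nat list list \<Rightarrow> nat list"
  where "chain bs = foldl (\<lambda>v I. v @ I @ J (v @ I)) [] bs"

lemma chain_Nil: "chain [] = []"
  by (simp add: chain_def)

lemma chain_snoc: "chain (bs @ [I]) = chain bs @ I @ J (chain bs @ I)"
  by (simp add: chain_def)

lemma chain_in_word_set: "set bs \<subseteq> B \<Longrightarrow> chain bs \<in> word_set (length bs * (n + L))"
proof (induction bs rule: rev_induct)
  case (snoc I bs)
  then have "chain bs \<in> word_set (length bs * (n + L))" "I \<in> word_set n" using B by auto
  from word_set_append[OF this(1) word_set_append[OF this(2) J]]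
  show ?case by (simp add: chain_snoc add.commute)
qed (simp add: chain_Nil)

lemma length_chain: "set bs \<subseteq> B \<Longrightarrow> length (chain bs) = length bs * (n + L)"
  using chain_in_word_set by (auto simp: word_set_def)

lemma block_of_chain:
  "set bs \<subseteq> B \<Longrightarrow> k < length bs \<Longrightarrow> take n (drop (k * (n + L)) (chain bs)) = bs ! k"
proof (induction bs rule: rev_induct)
  case (snoc I bs)
  then have bs: "set bs \<subseteq> B" and I: "length I = n" using B by (auto simp: word_set_def)
  note len = length_chain[OF bs]
  show ?case
  proof (cases "k < length bs")
    case True
    have "(k + 1) * (n + L) \<le> length bs * (n + L)" using True by (intro mult_le_mono1) simp
    then have "k * (n + L) + n \<le> length (chain bs)" using len by (simp add: algebra_simps)
    then have "take n (drop (k * (n + L)) (chain (bs @ [I]))) = take n (drop (k * (n + L)) (chain bs))"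
      by (simp add: chain_snoc)
    then show ?thesis using snoc.IH[OF bs True] True by (simp add: nth_append)
  next
    case False
    then have "k = length bs" using snoc.prems by simp
    then show ?thesis using len I by (simp add: chain_snoc)
  qed
qed simp

definition blocks :: "nat \<Rightarrow> nat list list set"
  where "blocks N = {bs. set bs \<subseteq> B \<and> length bs = N}"

lemma finite_blocks [simp]: "finite (blocks N)"
  unfolding blocks_def using finite_lists_length_eq[OF B(1)] .

lemma card_blocks: "card (blocks N) = card B ^ N"
  unfolding blocks_def using card_lists_length_eq[OF B(1)] .

lemma card_B_pos: "card B > 0"
  using B by (simp add: card_gt_0_iff)

text \<open>An occurrence of \<open>w\<close> at a given place determines all blocks that it covers completely.\<close>

lemma card_occurrence_at:
  "card {bs \<in> blocks N. i \<in> occurrences (chain bs) w} * card B ^ (length w div (n + L) - 1) \<le> card B ^ N"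
proof (cases "{bs \<in> blocks N. i \<in> occurrences (chain bs) w} = {} \<or> length w div (n + L) - 1 = 0")
  case True
  have le: "card {bs \<in> blocks N. i \<in> occurrences (chain bs) w} \<le> card (blocks N)" by (intro card_mono) auto
  from True show ?thesis
  proof
    assume "{bs \<in> blocks N. i \<in> occurrences (chain bs) w} = {}"
    then show ?thesis by (simp only: card.empty mult_0 le0)
  qed (use le in \<open>simp add: card_blocks\<close>)
next
  case False
  define l where "l = n + L"
  \<comment> \<open>A window as long as \<open>w\<close> covers at least this many full periods
    \<open>l\<close>, one being given up for the period in which it starts.\<close>
  define q where "q = length w div l - 1"
  define S where "S = {bs \<in> blocks N. i \<in> occurrences (chain bs) w}"
  have l: "l > 0" using n by (simp add: l_def)
  have q: "q * l + l \<le> length w"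
  proof -
    have "q + 1 = length w div l" using False by (simp add: q_def l_def)
    then have "q * l + l = (length w div l) * l" by (metis add_mult_distrib mult_1)
    then show ?thesis by simp
  qed
  \<comment> \<open>\<open>i / l\<close> rounded up: the first block that starts at or after
    position \<open>i\<close>.\<close>
  define j where "j = (i + l - 1) div l"
  have "j * l \<le> i + l - 1" by (simp add: j_def)
  moreover have "i + l - 1 < j * l + l" using l unfolding j_def
    by (metis add.commute mult.commute dividend_less_div_times)
  ultimately have j: "i \<le> j * l" "j * l \<le> i + l - 1" by linarith+
  have "length w + i \<le> N * l"
  proof -
    obtain bs where "bs \<in> S" using False by (auto simp: S_def)
    then show ?thesis using length_chain[of bs] by (auto simp: S_def blocks_def occurrences_def l_def)
  qed
  then have "(j + q) * l < N * l" using j q l by (simp add: add_mult_distrib)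
  then have jqN: "j + q \<le> N" by simp
  have det: "bs ! (j + r) = take n (drop ((j + r) * l - i) w)" if bs: "bs \<in> S" and r: "r < q" for bs r
  proof -
    have s: "set bs \<subseteq> B" "length bs = N" "take (length w) (drop i (chain bs)) = w"
      using bs by (auto simp: S_def blocks_def occurrences_def)
    have "(r + 1) * l \<le> q * l" using r by (intro mult_le_mono1) simp
    then have a: "i \<le> (j + r) * l" "(j + r) * l - i + n \<le> length w"
      using j q by (auto simp: add_mult_distrib l_def)
    have "bs ! (j + r) = take n (drop ((j + r) * l) (chain bs))"
      using block_of_chain[OF s(1), of "j + r"] r jqN s(2) by (simp add: l_def)
    also have "drop ((j + r) * l) (chain bs) = drop ((j + r) * l - i) (drop i (chain bs))" using a(1) by simp
    also have "take n (drop ((j + r) * l - i) (drop i (chain bs)))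
        = take n (drop ((j + r) * l - i) (take (length w) (drop i (chain bs))))"
      using a(2) by (simp add: drop_take min_def)
    finally show ?thesis using s(3) by simp
  qed
  \<comment> \<open>The \<open>q\<close> blocks from index \<open>j\<close> on can be read off
    \<open>w\<close>, so a chain in \<open>S\<close> is determined by the blocks before and after
    them.\<close>
  have inj: "inj_on (\<lambda>bs. (take j bs, drop (j + q) bs)) S"
  proof (rule inj_onI)
    fix bs bs' assume s: "bs \<in> S" "bs' \<in> S" and eq: "(take j bs, drop (j + q) bs) = (take j bs', drop (j + q) bs')"
    have len: "length bs = N" "length bs' = N" using s by (auto simp: S_def blocks_def)
    show "bs = bs'"
    proof (rule nth_equalityI)
      fix k assume k: "k < length bs"
      consider "k < j" | r where "k = j + r" "r < q" | r where "k = j + q + r"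
        by (metis le_Suc_ex linorder_not_less nat_add_left_cancel_less add.assoc)
      then show "bs ! k = bs' ! k"
      proof cases
        case 1
        then show ?thesis using eq by (metis Pair_inject nth_take)
      next
        case 2
        then show ?thesis using det[OF s(1)] det[OF s(2)] by simp
      next
        case 3
        have "drop (j + q) bs ! r = drop (j + q) bs' ! r" using eq by simp
        then show ?thesis using 3 k len by simp
      qed
    qed (use len in simp)
  qed
  have "(\<lambda>bs. (take j bs, drop (j + q) bs)) ` S \<subseteq> blocks j \<times> blocks (N - (j + q))"
    using jqN by (auto simp: S_def blocks_def dest: in_set_takeD in_set_dropD)
  then have "card S \<le> card (blocks j \<times> blocks (N - (j + q)))"
    by (rule card_inj_on_le[OF inj]) simp
  also have "\<dots> = card B ^ (j + (N - (j + q)))" by (simp add: card_cartesian_product card_blocks power_add)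
  finally have "card S * card B ^ q \<le> card B ^ (j + (N - (j + q))) * card B ^ q" by (rule mult_le_mono1)
  also have "\<dots> = card B ^ N" using jqN by (simp flip: power_add)
  finally show ?thesis by (simp add: S_def q_def l_def)
qed

text \<open>The mean number of occurrences in the chain of \<open>N\<close> uniformly random blocks,
  divided by the length of the chain. Consistency and shift invariance hold up to boundary effects
  of order \<open>1 / N\<close>, hence exactly for limits.\<close>

definition frequency :: "nat \<Rightarrow> nat list \<Rightarrow> real"
  where "frequency N w = (\<Sum>bs\<in>blocks N. real (card (occurrences (chain bs) w))) / (real (card B) ^ N * (N * (n + L)))"

lemma chain_block:
  assumes "bs \<in> blocks N"
  shows "set (chain bs) \<subseteq> {1, 2}" "length (chain bs) = N * (n + L)"
  using assms chain_in_word_set[of bs] by (auto simp: blocks_def word_set_def)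

lemma average_over_blocks_le:
  assumes "N > 0" "\<And>bs. bs \<in> blocks N \<Longrightarrow> f bs \<le> c"
  shows "(\<Sum>bs\<in>blocks N. f bs) / (real (card B) ^ N * (N * (n + L))) \<le> c / (N * (n + L))"
proof -
  have "(\<Sum>bs\<in>blocks N. f bs) \<le> real (card B) ^ N * c"
    using sum_mono[of "blocks N" f "\<lambda>_. c"] assms(2) by (simp add: card_blocks)
  then have "(\<Sum>bs\<in>blocks N. f bs) / (real (card B) ^ N * (N * (n + L))) \<le> (real (card B) ^ N * c) / (real (card B) ^ N * (N * (n + L)))"
    by (rule divide_right_mono) simp
  then show ?thesis using card_B_pos by simp
qed

lemma inverse_length_le: "N > 0 \<Longrightarrow> 1 / real (N * (n + L)) \<le> 1 / N"
proof -
  assume N: "N > 0"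
  have "real N * 1 \<le> real N * real (n + L)" using n by (intro mult_left_mono) auto
  then have "real N \<le> real (N * (n + L))" by simp
  then show ?thesis using N by (intro divide_left_mono) (auto simp: n)
qed

lemma frequency_nonneg: "0 \<le> frequency N w"
  by (auto simp: frequency_def intro!: divide_nonneg_nonneg sum_nonneg)

lemma frequency_difference:
  assumes N: "N > 0" and f: "\<And>bs. bs \<in> blocks N \<Longrightarrow>
    card (occurrences (chain bs) u) + card (occurrences (chain bs) v) \<le> card (occurrences (chain bs) w) \<and>
    card (occurrences (chain bs) w) \<le> card (occurrences (chain bs) u) + card (occurrences (chain bs) v) + 1"
  shows "\<bar>frequency N w - (frequency N u + frequency N v)\<bar> \<le> 1 / N"
proof -
  define g where "g bs = real (card (occurrences (chain bs) w)) - (real (card (occurrences (chain bs) u)) + real (card (occurrences (chain bs) v)))" for bs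
  have g: "0 \<le> g bs" "g bs \<le> 1" if "bs \<in> blocks N" for bs using f[OF that] by (auto simp: g_def)
  have eq: "frequency N w - (frequency N u + frequency N v) = (\<Sum>bs\<in>blocks N. g bs) / (real (card B) ^ N * (N * (n + L)))"
    unfolding frequency_def g_def by (simp add: sum_subtractf sum.distrib diff_divide_distrib add_divide_distrib)
  have "0 \<le> frequency N w - (frequency N u + frequency N v)"
    unfolding eq using g(1) by (intro divide_nonneg_nonneg sum_nonneg) auto
  moreover have "frequency N w - (frequency N u + frequency N v) \<le> 1 / real (N * (n + L))"
    unfolding eq using average_over_blocks_le[OF N, of g 1] g(2) by simp
  ultimately show ?thesis using inverse_length_le[OF N] by linarith
qed

lemma frequency_right: "N > 0 \<Longrightarrow> \<bar>frequency N w - (frequency N (w @ [1]) + frequency N (w @ [2]))\<bar> \<le> 1 / N"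
  by (rule frequency_difference) (use card_occurrences_right[OF chain_block(1)] in auto)

lemma frequency_left: "N > 0 \<Longrightarrow> \<bar>frequency N w - (frequency N (1 # w) + frequency N (2 # w))\<bar> \<le> 1 / N"
  by (rule frequency_difference) (use card_occurrences_left[OF chain_block(1)] in auto)

text \<open>Double counting: \<open>card_occurrence_at\<close> is summed over all positions.\<close>

lemma frequency_le:
  assumes N: "N > 0"
  shows "frequency N w * real (card B) ^ (length w div (n + L) - 1) \<le> 1 + 1 / N"
proof -
  define q where "q = length w div (n + L) - 1"
  define D where "D = N * (n + L)"
  have D: "D > 0" using N n by (simp add: D_def)
  have "(\<Sum>bs\<in>blocks N. card (occurrences (chain bs) w)) = (\<Sum>bs\<in>blocks N. \<Sum>i\<in>{..D}. if i \<in> occurrences (chain bs) w then 1 else 0)"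
  proof (rule sum.cong[OF refl])
    fix bs assume "bs \<in> blocks N"
    then have "occurrences (chain bs) w \<subseteq> {..D}"
      using occurrences_subset[of "chain bs" w] chain_block(2) by (simp add: D_def)
    then show "card (occurrences (chain bs) w) = (\<Sum>i\<in>{..D}. if i \<in> occurrences (chain bs) w then 1 else 0)"
      by (simp add: sum.If_cases Int_absorb1)
  qed
  also have "\<dots> = (\<Sum>i\<in>{..D}. \<Sum>bs\<in>blocks N. if i \<in> occurrences (chain bs) w then 1 else 0)" by (rule sum.swap)
  also have "\<dots> = (\<Sum>i\<in>{..D}. card {bs \<in> blocks N. i \<in> occurrences (chain bs) w})"
    by (intro sum.cong refl) (simp add: sum.If_cases Int_def)
  finally have "(\<Sum>bs\<in>blocks N. card (occurrences (chain bs) w)) * card B ^ q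
      = (\<Sum>i\<in>{..D}. card {bs \<in> blocks N. i \<in> occurrences (chain bs) w} * card B ^ q)"
    by (simp add: sum_distrib_right)
  also have "\<dots> \<le> (\<Sum>i\<in>{..D}. card B ^ N)" unfolding q_def by (rule sum_mono) (rule card_occurrence_at)
  also have "\<dots> = (D + 1) * card B ^ N" by simp
  finally have "real ((\<Sum>bs\<in>blocks N. card (occurrences (chain bs) w)) * card B ^ q) \<le> real ((D + 1) * card B ^ N)"
    by (rule of_nat_mono)
  then have "(\<Sum>bs\<in>blocks N. real (card (occurrences (chain bs) w))) * real (card B) ^ q \<le> (real D + 1) * real (card B) ^ N"
    by (simp add: algebra_simps)
  then have "((\<Sum>bs\<in>blocks N. real (card (occurrences (chain bs) w))) * real (card B) ^ q) / (real (card B) ^ N * D)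
      \<le> ((real D + 1) * real (card B) ^ N) / (real (card B) ^ N * D)"
    by (rule divide_right_mono) simp
  also have "\<dots> = 1 + 1 / D" using card_B_pos D by (simp add: field_simps)
  also have "\<dots> \<le> 1 + 1 / N" using inverse_length_le[OF N] by (simp add: D_def)
  finally show ?thesis by (simp add: frequency_def q_def D_def)
qed

lemma frequency_Nil:
  assumes N: "N > 0"
  shows "\<bar>frequency N [] - 1\<bar> \<le> 1 / N"
proof -
  have "(\<Sum>bs\<in>blocks N. real (card (occurrences (chain bs) []))) = real (card B) ^ N * (real (N * (n + L)) + 1)"
    using chain_block(2)[of _ N] by (simp add: occurrences_Nil card_blocks)
  then have "frequency N [] = (real (N * (n + L)) + 1) / real (N * (n + L))"
    using card_B_pos by (simp add: frequency_def)
  also have "\<dots> = 1 + 1 / real (N * (n + L))" using N n by (simp add: add_divide_distrib)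
  finally show ?thesis using inverse_length_le[OF N] by simp
qed

lemma frequency_pos:
  assumes "frequency N w > 0"
  shows "\<exists>bs u v. set bs \<subseteq> B \<and> chain bs = u @ w @ v"
proof -
  have "\<exists>bs\<in>blocks N. occurrences (chain bs) w \<noteq> {}"
  proof (rule ccontr)
    assume "\<not> ?thesis"
    then have "frequency N w = 0" by (simp add: frequency_def)
    then show False using assms by simp
  qed
  then obtain bs i where bs: "set bs \<subseteq> B" and i: "take (length w) (drop i (chain bs)) = w"
    by (auto simp: blocks_def occurrences_def)
  have "chain bs = take i (chain bs) @ w @ drop (length w) (drop i (chain bs))"
    by (metis append_take_drop_id i)
  then show ?thesis using bs by blast
qed

text \<open>The frequencies lie in a compact product of intervals, so a subsequence converges at
  every word. A positive limit forces positive frequencies along the way, so such a word really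
  occurs in some chain.\<close>

lemma limit_probabilities:
  obtains p where "cylinder_probabilities p"
    "\<forall>w. p w * real (card B) ^ (length w div (n + L) - 1) \<le> 1"
    "\<forall>w. p w > 0 \<longrightarrow> (\<exists>bs u v. set bs \<subseteq> B \<and> chain bs = u @ w @ v)"
proof -
  \<comment> \<open>The bound 2 comes from \<open>1 + 1 / N\<close> with
    \<open>N \<ge> 1\<close>.\<close>
  define X :: "(nat list \<Rightarrow> real) set" where "X = (UNIV \<rightarrow>\<^sub>E {0..2})"
  have "compactin (product_topology (\<lambda>_. euclidean) UNIV) X"
    unfolding X_def by (subst compactin_PiE) simp
  then have "compact X" by (simp add: euclidean_product_topology)
  then have "seq_compact X" by (rule compact_imp_seq_compact)
  moreover have "frequency (Suc k) \<in> X" for k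
  proof -
    have "frequency (Suc k) w \<le> 2" for w
    proof -
      have "1 \<le> real (card B)" using card_B_pos by simp
      then have "1 \<le> real (card B) ^ (length w div (n + L) - 1)" by (rule one_le_power)
      then have "frequency (Suc k) w * 1 \<le> frequency (Suc k) w * real (card B) ^ (length w div (n + L) - 1)"
        using frequency_nonneg by (intro mult_left_mono) auto
      also have "\<dots> \<le> 1 + 1 / real (Suc k)" by (rule frequency_le) simp
      also have "\<dots> \<le> 2" by (simp add: divide_le_eq)
      finally show ?thesis by simp
    qed
    then show ?thesis using frequency_nonneg by (auto simp: X_def)
  qed
  ultimately have "\<exists>p\<in>X. \<exists>r. strict_mono (r :: nat \<Rightarrow> nat) \<and> ((\<lambda>k. frequency (Suc k)) \<circ> r) \<longlonglongrightarrow> p"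
    unfolding seq_compact_def by (elim allE[of _ "\<lambda>k. frequency (Suc k)"]) simp
  then obtain p r where r: "strict_mono (r :: nat \<Rightarrow> nat)" and lim: "((\<lambda>k. frequency (Suc k)) \<circ> r) \<longlonglongrightarrow> p"
    by blast
  have p: "(\<lambda>k. frequency (Suc (r k)) w) \<longlonglongrightarrow> p w" for w
    using continuous_on_tendsto_compose[OF continuous_on_product_coordinates[of w] lim] by (simp add: o_def)
  have inv: "(\<lambda>k. 1 / real (Suc (r k))) \<longlonglongrightarrow> 0"
    using LIMSEQ_subseq_LIMSEQ[OF LIMSEQ_inverse_real_of_nat r] by (simp add: o_def inverse_eq_divide)
  have small: "a = 0" if a: "s \<longlonglongrightarrow> a" and le: "\<And>k. \<bar>s k\<bar> \<le> 1 / real (Suc (r k))" for a and s :: "nat \<Rightarrow> real"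
  proof -
    have "s \<longlonglongrightarrow> 0" by (rule tendsto_rabs_zero_cancel, rule tendsto_sandwich[OF _ _ tendsto_const inv]) (use le in auto)
    then show ?thesis using a LIMSEQ_unique by blast
  qed
  show thesis
  proof (rule that[of p])
    show "cylinder_probabilities p"
    proof
      have "(\<lambda>k. frequency (Suc (r k)) [] - 1) \<longlonglongrightarrow> p [] - 1" by (intro tendsto_intros p)
      from small[OF this frequency_Nil[OF zero_less_Suc]] have "p [] - 1 = 0" .
      then show "p [] = 1" by simp
      show "0 \<le> p w" for w by (rule LIMSEQ_le_const[OF p]) (use frequency_nonneg in auto)
      show "p w = p (w @ [1]) + p (w @ [2])" for w
      proof -
        have "(\<lambda>k. frequency (Suc (r k)) w - (frequency (Suc (r k)) (w @ [1]) + frequency (Suc (r k)) (w @ [2])))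
            \<longlonglongrightarrow> p w - (p (w @ [1]) + p (w @ [2]))" by (intro tendsto_intros p)
        from small[OF this frequency_right[OF zero_less_Suc]] have "p w - (p (w @ [1]) + p (w @ [2])) = 0" .
        then show ?thesis by simp
      qed
      show "p w = p (1 # w) + p (2 # w)" for w
      proof -
        have "(\<lambda>k. frequency (Suc (r k)) w - (frequency (Suc (r k)) (1 # w) + frequency (Suc (r k)) (2 # w)))
            \<longlonglongrightarrow> p w - (p (1 # w) + p (2 # w))" by (intro tendsto_intros p)
        from small[OF this frequency_left[OF zero_less_Suc]] have "p w - (p (1 # w) + p (2 # w)) = 0" .
        then show ?thesis by simp
      qed
    qed
    show "\<forall>w. p w * real (card B) ^ (length w div (n + L) - 1) \<le> 1"
    proof
      fix w
      have 1: "(\<lambda>k. frequency (Suc (r k)) w * real (card B) ^ (length w div (n + L) - 1))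
          \<longlonglongrightarrow> p w * real (card B) ^ (length w div (n + L) - 1)" by (intro tendsto_intros p)
      have 2: "(\<lambda>k. 1 + 1 / real (Suc (r k))) \<longlonglongrightarrow> 1 + 0" by (intro tendsto_intros inv)
      have "p w * real (card B) ^ (length w div (n + L) - 1) \<le> 1 + 0"
        by (rule LIMSEQ_le[OF 1 2]) (use frequency_le[of "Suc (r _)" w] in blast)
      then show "p w * real (card B) ^ (length w div (n + L) - 1) \<le> 1" by simp
    qed
    show "\<forall>w. p w > 0 \<longrightarrow> (\<exists>bs u v. set bs \<subseteq> B \<and> chain bs = u @ w @ v)"
    proof (intro allI impI)
      fix w assume "p w > 0"
      from order_tendstoD(1)[OF p this] obtain k where "frequency (Suc (r k)) w > 0"
        by (auto simp: eventually_sequentially)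
      then show "\<exists>bs u v. set bs \<subseteq> B \<and> chain bs = u @ w @ v" by (rule frequency_pos)
    qed
  qed
qed

end


section \<open>Measures with vanishing exponent and large entropy\<close>

context hyperbolic_rotation
begin

definition bounded_words :: "real \<Rightarrow> nat \<Rightarrow> nat list set"
  where "bounded_words F0 n = {w \<in> word_set n. frob (wm w) \<le> F0}"

lemma finite_bounded_words [simp]: "finite (bounded_words F0 n)"
  by (simp add: bounded_words_def)

lemma frob_wm_le: "frob (wm u) \<le> 2 * lam ^ (2 * length u)"
proof -
  have "frob (wm u) \<le> 2 * (spectral_norm (wm u))\<^sup>2" by (rule frob_le_spectral_norm_sq)
  also have "\<dots> \<le> 2 * (lam ^ length u)\<^sup>2"
    using spectral_norm_wm_le[of u] spectral_norm_nonneg by (intro mult_left_mono power_mono) auto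
  also have "(lam ^ length u)\<^sup>2 = lam ^ (2 * length u)" by (simp add: mult.commute flip: power_mult)
  finally show ?thesis .
qed

lemma frob_subword: "frob (wm w) \<le> frob (wm (u @ w)) * frob (wm u)"
  unfolding word_matrix_append by (rule frob_cancel_right[OF det_wm])

text \<open>Bounded products at the block ends give bounded products for all prefixes, since at most
  one period of letters is added, and then for all subwords, since a prefix can be cancelled. Words
  of positive probability are such subwords, so the mean logarithmic norm stays bounded and the
  exponent vanishes. The entropy comes from the bound on cylinder probabilities.\<close>

lemma bounded_chain_measure:
  assumes blocks: "corrected_blocks B n L J" and F0: "F0 \<ge> 2"
    and bounded: "\<And>bs. set bs \<subseteq> B \<Longrightarrow> frob (wm (corrected_blocks.chain J bs)) \<le> F0"
  obtains \<mu> where "\<mu> \<in> invariant_measures" "top_lyapunov (generators lam \<theta>) \<mu> = 0"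
    "ereal (ln (card B) / real (n + L)) \<le> ks_entropy \<mu> left_shift"
proof -
  interpret corrected_blocks B n L J by (rule blocks)
  define l where "l = n + L"
  have l: "l > 0" using n by (simp add: l_def)
  \<comment> \<open>Accounts for at most \<open>l\<close> letters beyond a block end;
    \<open>2 * lam ^ (2 * l)\<close> bounds \<open>frob\<close> of such a piece.\<close>
  define F1 where "F1 = 2 * lam ^ (2 * l) * F0"
  have F1: "F1 \<ge> F0"
  proof -
    have "1 \<le> 2 * lam ^ (2 * l)" using one_le_power[of lam "2 * l"] lam by linarith
    then show ?thesis unfolding F1_def using F0 by (simp add: mult_le_cancel_right1)
  qed
  have prefix: "frob (wm u) \<le> F1" if "set bs \<subseteq> B" "chain bs = u @ v" for bs u v
    using that
  proof (induction bs arbitrary: v rule: rev_induct)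
    case Nil
    then have "u = []" by (simp add: chain_Nil)
    then show ?case using bounded[of "[]"] F1 by (simp add: chain_Nil)
  next
    case (snoc I bs)
    define x where "x = I @ J (chain bs @ I)"
    have bs: "set bs \<subseteq> B" and "I \<in> word_set n" using snoc.prems(1) B by auto
    then have len: "length x = l" using J[of "chain bs @ I"] by (auto simp: x_def word_set_def l_def)
    have "chain bs @ x = u @ v" using snoc.prems(2) by (simp add: chain_snoc x_def)
    then consider z where "chain bs = u @ z" | z where "u = chain bs @ z" "z @ v = x"
      by (auto simp: append_eq_append_conv2)
    then show ?case
    proof cases
      case 1
      then show ?thesis by (rule snoc.IH[OF bs])
    next
      case 2
      have "length z \<le> l" using 2(2) len by auto
      have "frob (wm u) \<le> frob (wm z) * frob (wm (chain bs))"
        unfolding 2(1) word_matrix_append by (rule frob_mult)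
      also have "\<dots> \<le> (2 * lam ^ (2 * length z)) * F0"
        using bounded[OF bs] frob_wm_le[of z] lam by (intro mult_mono) (auto simp: frob_nonneg)
      also have "\<dots> \<le> F1"
        unfolding F1_def using \<open>length z \<le> l\<close> lam F0 by (intro mult_right_mono mult_left_mono power_increasing) auto
      finally show ?thesis .
    qed
  qed
  have subword: "frob (wm w) \<le> F1 * F1" if "set bs \<subseteq> B" "chain bs = u @ w @ v" for bs u w v
  proof -
    have "frob (wm (u @ w)) \<le> F1" "frob (wm u) \<le> F1"
      using prefix[OF that(1), of "u @ w" v] prefix[OF that(1), of u "w @ v"] that(2) by auto
    then have "frob (wm (u @ w)) * frob (wm u) \<le> F1 * F1"
      using F1 F0 by (intro mult_mono) (auto simp: frob_nonneg)
    then show ?thesis using frob_subword[of w u] by linarith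
  qed
  obtain p where p: "cylinder_probabilities p"
    and p_le: "\<forall>w. p w * real (card B) ^ (length w div (n + L) - 1) \<le> 1"
    and p_pos: "\<forall>w. p w > 0 \<longrightarrow> (\<exists>bs u v. set bs \<subseteq> B \<and> chain bs = u @ w @ v)"
    by (rule limit_probabilities)
  interpret cylinder_probabilities p by (rule p)
  interpret shift_measure coded_measure by unfold_locales (rule coded_measure_invariant)
  define c where "c = ln (F1 * F1)"
  have F11: "F1 * F1 \<ge> 2 * 2" using F1 F0 by (intro mult_mono) auto
  define a where "a m = (\<integral>x. ln (spectral_norm (wm (map x [0..<m]))) \<partial>coded_measure)" for m
  have a: "0 \<le> a m" "a m \<le> c" for m
  proof -
    have sum_p: "(\<Sum>w\<in>word_set m. p w) = 1"
      using sum_obs_prob[OF simple_function_prefix finite_word_set prefix_in_word_set, of m]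
      by (simp add: obs_prob_coded_measure)
    have eq: "a m = (\<Sum>w\<in>word_set m. p w * ln (spectral_norm (wm w)))"
      unfolding a_def
      by (subst integral_finite_observable[OF simple_function_prefix finite_word_set prefix_in_word_set])
        (simp add: obs_prob_coded_measure)
    show "0 \<le> a m" unfolding eq by (intro sum_nonneg mult_nonneg_nonneg p_nonneg ln_sn_bounds(1))
    have "a m \<le> (\<Sum>w\<in>word_set m. p w * c)" unfolding eq
    proof (rule sum_mono)
      fix w
      show "p w * ln (spectral_norm (wm w)) \<le> p w * c"
      proof (cases "p w > 0")
        case True
        then obtain bs u v where "set bs \<subseteq> B" "chain bs = u @ w @ v" using p_pos by blast
        then have "frob (wm w) \<le> F1 * F1" by (rule subword)
        moreover have "spectral_norm (wm w) \<le> (spectral_norm (wm w))\<^sup>2"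
          using sn_ge_1[of w] by (simp add: power2_eq_square mult_le_cancel_right1)
        ultimately have "spectral_norm (wm w) \<le> F1 * F1" using spectral_norm_sq_le_frob[of "wm w"] by linarith
        then have "ln (spectral_norm (wm w)) \<le> c" unfolding c_def using sn_pos[of w] F11 by simp
        then show ?thesis using True by (intro mult_left_mono) auto
      next
        case False
        then have "p w = 0" using p_nonneg[of w] by simp
        then show ?thesis by simp
      qed
    qed
    also have "\<dots> = c" using sum_p by (simp flip: sum_distrib_right)
    finally show "a m \<le> c" .
  qed
  have "(\<lambda>m. a m / m) \<longlonglongrightarrow> 0"
    by (rule tendsto_sandwich[OF _ _ tendsto_const lim_const_over_n[of c]])
      (use a in \<open>auto intro!: always_eventually divide_right_mono\<close>)
  then have lyap: "top_lyapunov (generators lam \<theta>) coded_measure = 0"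
    unfolding top_lyapunov_eq a_def by (rule limI)
  have ent: "(real m / l - 2) * ln (card B) \<le> obs_entropy coded_measure (\<lambda>x. map x [0..<m])" for m
  proof -
    define q where "q = m div l - 1"
    have B1: "real (card B) \<ge> 1" using card_B_pos by simp
    \<comment> \<open>The loss of 2 is one unit for rounding down and one for the incomplete period;
      it disappears after division by \<open>m\<close>.\<close>
    have "real m / l - 2 \<le> real q"
    proof -
      have "m < l + (m div l) * l" using l by (rule dividend_less_div_times)
      then have "real m < real (l + (m div l) * l)" by (simp only: of_nat_less_iff)
      then have "real m < (real (m div l) + 1) * real l" by (simp add: distrib_right)
      then have "real m / l < real (m div l) + 1" using l by (simp add: pos_divide_less_eq)
      then show ?thesis unfolding q_def by linarith
    qed
    then have "(real m / l - 2) * ln (card B) \<le> q * ln (card B)" using B1 by (intro mult_right_mono) auto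
    also have "\<dots> = - ln (1 / real (card B) ^ q)" using card_B_pos by (simp add: ln_div ln_realpow)
    also have "\<dots> \<le> obs_entropy coded_measure (\<lambda>x. map x [0..<m])"
    proof (rule obs_entropy_ge[OF simple_function_prefix])
      show "0 < 1 / real (card B) ^ q" using card_B_pos by simp
      fix w
      show "obs_prob coded_measure (\<lambda>x. map x [0..<m]) w \<le> 1 / real (card B) ^ q"
      proof (cases "w \<in> word_set m")
        case True
        then have "length w = m" by (simp add: word_set_def)
        then have "p w * real (card B) ^ q \<le> 1" using p_le[rule_format, of w] by (simp add: q_def l_def)
        then show ?thesis using card_B_pos by (simp add: obs_prob_coded_measure[OF True] pos_le_divide_eq)
      next
        case False
        then have "w \<notin> (\<lambda>x. map x [0..<m]) ` space coded_measure" using prefix_in_word_set by blast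
        then show ?thesis by (simp add: obs_prob_outside)
      qed
    qed
    finally show ?thesis .
  qed
  have "ln (card B) / l \<le> symbol_entropy"
  proof (rule LIMSEQ_le[OF _ symbol_entropy_LIMSEQ])
    have "(\<lambda>m. ln (card B) / l - 2 * ln (card B) / real m) \<longlonglongrightarrow> ln (card B) / l - 0"
      by (intro tendsto_intros lim_const_over_n)
    then show "(\<lambda>m. ln (card B) / l - 2 * ln (card B) / real m) \<longlonglongrightarrow> ln (card B) / l" by simp
    show "\<exists>N. \<forall>m\<ge>N. ln (card B) / l - 2 * ln (card B) / real m \<le> obs_entropy coded_measure (\<lambda>x. map x [0..<m]) / m"
    proof (intro exI[of _ 1] allI impI)
      fix m :: nat assume m: "1 \<le> m"
      have "ln (card B) / l - 2 * ln (card B) / real m = (real m / l - 2) * ln (card B) / m"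
        using m by (simp add: left_diff_distrib diff_divide_distrib)
      also have "\<dots> \<le> obs_entropy coded_measure (\<lambda>x. map x [0..<m]) / m" by (rule divide_right_mono[OF ent]) simp
      finally show "ln (card B) / l - 2 * ln (card B) / real m \<le> obs_entropy coded_measure (\<lambda>x. map x [0..<m]) / m" .
    qed
  qed
  then have "ereal (ln (card B) / real (n + L)) \<le> ks_entropy coded_measure left_shift"
    by (simp add: ks_entropy_eq_symbol_entropy l_def)
  with coded_measure_invariant lyap show thesis by (intro that[of coded_measure]) simp_all
qed

lemma large_entropy_measures:
  obtains K L F0 \<kappa> where "0 < \<kappa>" "\<kappa> < 1" "2 \<le> F0"
    "\<forall>j n. card {w \<in> word_set n. frob (wm w) \<le> F0 / \<kappa> ^ j} \<le> card (bounded_words F0 (n + j * K))"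
    "\<forall>n>0. \<exists>\<mu>\<in>invariant_measures. top_lyapunov (generators lam \<theta>) \<mu> = 0 \<and>
      ereal (ln (card (bounded_words F0 n)) / real (n + L)) \<le> ks_entropy \<mu> left_shift"
proof (rule correcting_word)
  fix K F0 \<kappa> assume \<kappa>: "0 < \<kappa>" "\<kappa> < 1" and F0: "2 \<le> F0" and
    corr: "\<And>j M. det M = 1 \<Longrightarrow> frob M \<le> F0 / \<kappa> ^ j \<Longrightarrow> \<exists>J\<in>word_set (j * K). frob (wm J ** M) \<le> F0"

  have count: "card {w \<in> word_set n. frob (wm w) \<le> F0 / \<kappa> ^ j} \<le> card (bounded_words F0 (n + j * K))" for j n
  proof -
    define S where "S = {w \<in> word_set n. frob (wm w) \<le> F0 / \<kappa> ^ j}"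
    have "\<forall>w\<in>S. \<exists>J. J \<in> word_set (j * K) \<and> frob (wm J ** wm w) \<le> F0"
      using corr[OF det_wm] by (auto simp: S_def)
    from bchoice[OF this] obtain J where J: "\<forall>w\<in>S. J w \<in> word_set (j * K) \<and> frob (wm (J w) ** wm w) \<le> F0" ..
    have "inj_on (\<lambda>w. w @ J w) S"
    proof (rule inj_onI)
      fix v w assume "v \<in> S" "w \<in> S" and eq: "v @ J v = w @ J w"
      then have "length v = length w" by (simp add: S_def word_set_def)
      then show "v = w" using eq by simp
    qed
    moreover have "(\<lambda>w. w @ J w) ` S \<subseteq> bounded_words F0 (n + j * K)"
      using J by (auto simp: S_def bounded_words_def word_matrix_append intro: word_set_append)
    ultimately show ?thesis unfolding S_def[symmetric] by (rule card_inj_on_le) simp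
  qed
  \<comment> \<open>A bounded past followed by a bounded block has \<open>frob\<close> at most
    \<open>F0 * F0\<close>. The number of rounds that corrects this does not depend on the block
    length, hence neither does \<open>L\<close>.\<close>
  obtain j where j: "\<kappa> ^ j < 1 / F0" using real_arch_pow_inv[of "1 / F0" \<kappa>] \<kappa> F0 by auto
  then have j': "F0 * F0 \<le> F0 / \<kappa> ^ j" using \<kappa> F0 by (simp add: field_simps)
  define L where "L = j * K"
  \<comment> \<open>\<open>corrected_blocks\<close> asks for a word of length \<open>L\<close> after
    every past, so pasts that are too large receive an arbitrary one; they do not arise in chains of
    bounded blocks.\<close>
  define J where "J w = (SOME u. u \<in> word_set L \<and> (frob (wm w) \<le> F0 / \<kappa> ^ j \<longrightarrow> frob (wm u ** wm w) \<le> F0))" for w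
  have JL: "J w \<in> word_set L \<and> (frob (wm w) \<le> F0 / \<kappa> ^ j \<longrightarrow> frob (wm (J w) ** wm w) \<le> F0)" for w
  proof -
    have "\<exists>u. u \<in> word_set L \<and> (frob (wm w) \<le> F0 / \<kappa> ^ j \<longrightarrow> frob (wm u ** wm w) \<le> F0)"
    proof (cases "frob (wm w) \<le> F0 / \<kappa> ^ j")
      case True
      then show ?thesis using corr[OF det_wm True] by (auto simp: L_def)
    next
      case False
      have "replicate L 2 \<in> word_set L" by (auto simp: word_set_def)
      then show ?thesis using False by blast
    qed
    then show ?thesis unfolding J_def by (rule someI_ex)
  qed
  have "\<exists>\<mu>\<in>invariant_measures. top_lyapunov (generators lam \<theta>) \<mu> = 0 \<and>
      ereal (ln (card (bounded_words F0 n)) / real (n + L)) \<le> ks_entropy \<mu> left_shift" if n: "n > 0" for n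
  proof -
    have "frob (mat 1) = 2" by (simp add: frob_def mat_def)
    then have "frob (wm (replicate n 2)) = 2" using frob_replicate_2[of n "mat 1"] by simp
    then have "replicate n 2 \<in> bounded_words F0 n"
      using F0 by (auto simp: bounded_words_def word_set_def)
    then have ne: "bounded_words F0 n \<noteq> {}" by blast
    have cb: "corrected_blocks (bounded_words F0 n) n L J"
      by unfold_locales (use ne n JL in \<open>auto simp: bounded_words_def\<close>)
    interpret corrected_blocks "bounded_words F0 n" n L J by (rule cb)
    have "frob (wm (chain bs)) \<le> F0" if "set bs \<subseteq> bounded_words F0 n" for bs
      using that
    proof (induction bs rule: rev_induct)
      case Nil
      then show ?case using F0 by (simp add: chain_Nil frob_def mat_def)
    next
      case (snoc I bs)
      then have "frob (wm (chain bs)) \<le> F0" "frob (wm I) \<le> F0" by (auto simp: bounded_words_def)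
      then have "frob (wm I) * frob (wm (chain bs)) \<le> F0 * F0" using F0 by (intro mult_mono) (auto simp: frob_nonneg)
      then have "frob (wm (chain bs @ I)) \<le> F0 / \<kappa> ^ j"
        using frob_mult[of "wm I" "wm (chain bs)"] j' by (simp add: word_matrix_append)
      then have "frob (wm (J (chain bs @ I)) ** wm (chain bs @ I)) \<le> F0" using JL by blast
      moreover have "chain (bs @ [I]) = (chain bs @ I) @ J (chain bs @ I)" by (simp add: chain_snoc)
      ultimately show ?case by (simp only: word_matrix_append)
    qed
    then obtain \<mu> where "\<mu> \<in> invariant_measures" "top_lyapunov (generators lam \<theta>) \<mu> = 0"
      "ereal (ln (card (bounded_words F0 n)) / real (n + L)) \<le> ks_entropy \<mu> left_shift"
      by (rule bounded_chain_measure[OF cb F0])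
    then show ?thesis by (intro bexI[of _ \<mu>] conjI)
  qed
  then have all: "\<forall>n>0. \<exists>\<mu>\<in>invariant_measures. top_lyapunov (generators lam \<theta>) \<mu> = 0 \<and>
      ereal (ln (card (bounded_words F0 n)) / real (n + L)) \<le> ks_entropy \<mu> left_shift" by blast
  have cnt: "\<forall>j n. card {w \<in> word_set n. frob (wm w) \<le> F0 / \<kappa> ^ j} \<le> card (bounded_words F0 (n + j * K))"
    by (intro allI count)
  show thesis by (rule that[OF \<kappa> F0 cnt all])
qed

section \<open>The pressure at very negative parameters\<close>

definition zero_exponent_entropy :: ereal
  where "zero_exponent_entropy =
    (SUP \<mu>\<in>{\<mu> \<in> invariant_measures. top_lyapunov (generators lam \<theta>) \<mu> = 0}. ks_entropy \<mu> left_shift)"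

lemma zero_exponent_entropy_le_P: "zero_exponent_entropy \<le> ereal (P t)"
  unfolding zero_exponent_entropy_def by (rule SUP_least) (use ks_entropy_le_P in blast)

text \<open>A word with \<open>frob\<close> between \<open>F0 / \<kappa> ^ (j - 1)\<close> and \<open>F0 / \<kappa> ^ j\<close> contributes at most
  \<open>\<kappa> ^ ((j - 1) s / 2)\<close> to the partition sum at \<open>- s\<close>; for large \<open>s\<close> this outweighs the number
  of such words, which a correction of length \<open>j K\<close> bounds in terms of the entropy.\<close>

lemma zero_exponent_entropy_attained:
  obtains s h where "zero_exponent_entropy = ereal h" "P (- s) \<le> h"
proof -
  obtain K L F0 \<kappa> where \<kappa>: "0 < \<kappa>" "\<kappa> < 1" and F0: "2 \<le> F0" and
    count: "\<forall>j n. card {w \<in> word_set n. frob (wm w) \<le> F0 / \<kappa> ^ j} \<le> card (bounded_words F0 (n + j * K))" and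
    meas: "\<forall>n>0. \<exists>\<mu>\<in>invariant_measures. top_lyapunov (generators lam \<theta>) \<mu> = 0 \<and>
      ereal (ln (card (bounded_words F0 n)) / real (n + L)) \<le> ks_entropy \<mu> left_shift"
    by (rule large_entropy_measures)
  have ent: "ereal (ln (card (bounded_words F0 n)) / real (n + L)) \<le> zero_exponent_entropy" if n: "n > 0" for n
  proof -
    obtain \<mu> where \<mu>: "\<mu> \<in> invariant_measures" "top_lyapunov (generators lam \<theta>) \<mu> = 0"
      and le: "ereal (ln (card (bounded_words F0 n)) / real (n + L)) \<le> ks_entropy \<mu> left_shift"
      using meas n by blast
    have "ks_entropy \<mu> left_shift \<le> zero_exponent_entropy"
      unfolding zero_exponent_entropy_def using \<mu> by (intro SUP_upper) auto
    with le show ?thesis by (rule order_trans)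
  qed
  \<comment> \<open>The supremum is finite: the measure obtained for length 1 bounds it from below,
    and \<open>P 0\<close> from above.\<close>
  obtain h where h: "zero_exponent_entropy = ereal h"
    using ent[of 1] zero_exponent_entropy_le_P[of 0] by (cases zero_exponent_entropy) auto
  define c where "c n = real (card (bounded_words F0 n))" for n
  have c: "c n \<le> exp (h * (n + L))" if n: "n > 0" for n
  proof (cases "c n = 0")
    case False
    then have c0: "c n > 0" by (simp add: c_def card_gt_0_iff)
    have "ln (c n) / (n + L) \<le> h" using ent[OF n] by (simp add: h c_def)
    then have "ln (c n) \<le> h * (n + L)" using n by (simp add: pos_divide_le_eq)
    then have "exp (ln (c n)) \<le> exp (h * (n + L))" by simp
    then show ?thesis using c0 by simp
  qed simp
  \<comment> \<open>Chosen so that \<open>r\<close> times \<open>exp (\<bar>h\<bar> * K)\<close> is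
    \<open>1 / 2\<close>. Passing to the next scale \<open>j\<close> multiplies the bound on the
    number of words by \<open>exp (h * K)\<close> and their weight by \<open>r\<close>, so the sum
    over scales is geometric.\<close>
  define s where "s = 2 * (ln 2 + \<bar>h\<bar> * K) / (- ln \<kappa>)"
  have ln\<kappa>: "ln \<kappa> < 0" using \<kappa> by simp
  have s0: "s \<ge> 0" unfolding s_def using ln\<kappa> by (intro divide_nonneg_nonneg) auto
  define r where "r = \<kappa> powr (s / 2)"
  have r0: "0 < r" "r \<le> 1" unfolding r_def using \<kappa> s0 by (auto intro: powr_le1)
  have rh: "r * exp (h * K) \<le> 1 / 2"
  proof -
    have "s / 2 * ln \<kappa> = - (ln 2 + \<bar>h\<bar> * K)" using ln\<kappa> by (simp add: s_def field_simps)
    then have "r = exp (- (ln 2 + \<bar>h\<bar> * K))" using \<kappa> by (simp add: r_def powr_def)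
    then have "r * exp (h * K) = exp (h * K - \<bar>h\<bar> * K) / 2"
      by (simp add: exp_minus exp_add exp_diff field_simps)
    also have "\<dots> \<le> 1 / 2" by (simp add: mult_right_mono)
    finally show ?thesis .
  qed
  \<comment> \<open>The factor 2 sums the geometric series, \<open>exp (h * L)\<close> pays for the
    correction between blocks, and \<open>1 / r\<close> for the scale lost to the lower bound on
    \<open>frob\<close>.\<close>
  define C where "C = 2 * exp (h * L) / r"
  have C: "C > 0" using r0 by (simp add: C_def)
  have bound: "partition_sum (- s) n \<le> C * exp (h * n)" if n: "n > 0" for n
  proof -
    define jj where "jj w = (LEAST j. frob (wm w) \<le> F0 / \<kappa> ^ j)" for w
    have ex: "\<exists>j. frob (wm w) \<le> F0 / \<kappa> ^ j" for w
    proof -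
      have f0: "frob (wm w) > 0" using frob_ge_2[OF det_wm[of w]] by linarith
      then obtain j where "\<kappa> ^ j < F0 / frob (wm w)" using real_arch_pow_inv[of "F0 / frob (wm w)" \<kappa>] \<kappa> F0 by auto
      then have "frob (wm w) \<le> F0 / \<kappa> ^ j" using \<kappa> f0 by (simp add: field_simps)
      then show ?thesis ..
    qed
    have jj: "frob (wm w) \<le> F0 / \<kappa> ^ jj w" for w unfolding jj_def using ex by (rule LeastI_ex)
    have weight: "spectral_norm (wm w) powr (- s) \<le> r ^ jj w / r" for w
    proof (cases "jj w")
      case 0
      have "spectral_norm (wm w) powr (- s) \<le> spectral_norm (wm w) powr 0"
        using s0 sn_ge_1 by (intro powr_mono) auto
      then have "spectral_norm (wm w) powr (- s) \<le> 1" using sn_pos[of w] by simp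
      also have "1 \<le> 1 / r" using r0 by simp
      finally show ?thesis using 0 by simp
    next
      case (Suc j)
      have "\<not> frob (wm w) \<le> F0 / \<kappa> ^ j" using not_less_Least[of j "\<lambda>j. frob (wm w) \<le> F0 / \<kappa> ^ j"] Suc
        by (simp add: jj_def)
      \<comment> \<open>Here \<open>F0 \<ge> 2\<close> offsets the factor 2 in
        \<open>frob_le_spectral_norm_sq\<close>.\<close>
      then have "2 / \<kappa> ^ j \<le> frob (wm w)" using F0 \<kappa> divide_right_mono[of 2 F0 "\<kappa> ^ j"] by simp
      then have "2 * (1 / \<kappa> ^ j) \<le> 2 * (spectral_norm (wm w))\<^sup>2" using frob_le_spectral_norm_sq[of "wm w"] by simp
      then have sq: "1 / \<kappa> ^ j \<le> (spectral_norm (wm w))\<^sup>2" by simp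
      have "spectral_norm (wm w) powr (- s) = ((spectral_norm (wm w))\<^sup>2) powr (- (s / 2))"
        using sn_pos[of w] by (simp add: powr_powr flip: powr_numeral)
      also have "\<dots> \<le> (1 / \<kappa> ^ j) powr (- (s / 2))"
        using sq s0 \<kappa> by (intro powr_mono2') auto
      also have "\<dots> = r ^ j"
        using \<kappa> by (simp add: r_def powr_minus powr_divide powr_powr mult.commute flip: powr_realpow)
      also have "\<dots> = r ^ jj w / r" using Suc r0 by simp
      finally show ?thesis .
    qed
    define m where "m = Max (jj ` word_set n)"
    have jm: "jj w \<in> {..m}" if "w \<in> word_set n" for w using that by (auto simp: m_def)
    have "partition_sum (- s) n \<le> (\<Sum>w\<in>word_set n. r ^ jj w / r)"
      unfolding partition_sum_def by (rule sum_mono) (rule weight)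
    also have "\<dots> = (\<Sum>j\<in>{..m}. \<Sum>w\<in>{w \<in> word_set n. jj w = j}. r ^ jj w / r)"
      by (rule sum.group[symmetric]) (use jm in auto)
    also have "\<dots> = (\<Sum>j\<in>{..m}. real (card {w \<in> word_set n. jj w = j}) * (r ^ j / r))"
      by (intro sum.cong refl) simp
    also have "\<dots> \<le> (\<Sum>j\<in>{..m}. exp (h * L) / r * exp (h * n) * (1 / 2) ^ j)"
    proof (rule sum_mono)
      fix j
      have "card {w \<in> word_set n. jj w = j} \<le> card {w \<in> word_set n. frob (wm w) \<le> F0 / \<kappa> ^ j}"
        using jj by (intro card_mono) auto
      then have "card {w \<in> word_set n. jj w = j} \<le> card (bounded_words F0 (n + j * K))" using count[rule_format, of n j] by linarith
      then have "real (card {w \<in> word_set n. jj w = j}) \<le> exp (h * (n + j * K + L))"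
        using c[of "n + j * K"] n unfolding c_def by simp
      then have "real (card {w \<in> word_set n. jj w = j}) * (r ^ j / r) \<le> exp (h * (n + j * K + L)) * (r ^ j / r)"
        using r0 by (intro mult_right_mono) auto
      also have "exp (h * (n + j * K + L)) = exp (h * n) * exp (h * L) * exp (h * K) ^ j"
        by (simp add: algebra_simps exp_add flip: exp_of_nat_mult)
      also have "exp (h * n) * exp (h * L) * exp (h * K) ^ j * (r ^ j / r) = exp (h * L) / r * exp (h * n) * (r * exp (h * K)) ^ j"
        by (simp add: power_mult_distrib)
      also have "\<dots> \<le> exp (h * L) / r * exp (h * n) * (1 / 2) ^ j"
        using rh r0 by (intro mult_left_mono power_mono) auto
      finally show "real (card {w \<in> word_set n. jj w = j}) * (r ^ j / r) \<le> exp (h * L) / r * exp (h * n) * (1 / 2) ^ j" .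
    qed
    also have "\<dots> = exp (h * L) / r * exp (h * n) * (\<Sum>j\<in>{..m}. (1 / 2) ^ j)" by (simp add: sum_distrib_left)
    also have "\<dots> \<le> exp (h * L) / r * exp (h * n) * 2"
    proof (rule mult_left_mono)
      show "(\<Sum>j\<in>{..m}. (1 / 2 :: real) ^ j) \<le> 2" by (simp add: sum_gp0)
    qed (use r0 in simp)
    also have "exp (h * L) / r * exp (h * n) * 2 = C * exp (h * n)" by (simp add: C_def)
    finally show ?thesis .
  qed
  have "P (- s) \<le> h"
  proof (rule LIMSEQ_le[OF P_LIMSEQ])
    have "(\<lambda>n. ln C / real n + h) \<longlonglongrightarrow> 0 + h" by (intro tendsto_intros lim_const_over_n)
    then show "(\<lambda>n. ln C / real n + h) \<longlonglongrightarrow> h" by simp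
    show "\<exists>N. \<forall>n\<ge>N. ln (partition_sum (- s) n) / n \<le> ln C / real n + h"
    proof (intro exI[of _ 1] allI impI)
      fix n :: nat assume n: "1 \<le> n"
      have "ln (partition_sum (- s) n) \<le> ln (C * exp (h * n))"
        using bound[of n] n partition_sum_pos C by (subst ln_le_cancel_iff) auto
      also have "\<dots> = ln C + h * n" using C by (simp add: ln_mult_pos)
      finally have "ln (partition_sum (- s) n) / n \<le> (ln C + h * n) / n" by (rule divide_right_mono) simp
      then show "ln (partition_sum (- s) n) / n \<le> ln C / real n + h" using n by (simp add: add_divide_distrib)
    qed
  qed
  with h show thesis by (rule that)
qed

end

section \<open>One-sided identity principle and the transition point\<close>

lemma analytic_constant_on_left:
  assumes f: "(\<lambda>t. f (x + t)) has_fps_expansion F" and left: "\<And>t. t \<le> 0 \<Longrightarrow> f (x + t) = (c :: real)"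
  shows "\<exists>t>0. f (x + t) = c"
proof -
  have g: "(\<lambda>t. f (x + t) - c) has_fps_expansion F - fps_const c"
    using f by (intro fps_expansion_intros)
  define G where "G = F - fps_const c"
  have "\<forall>\<^sub>F t in nhds 0. eval_fps G t = f (x + t) - c" and rad: "fps_conv_radius G > 0"
    using g by (auto simp: has_fps_expansion_def G_def)
  then obtain e where e: "e > 0" "\<And>t. \<bar>t\<bar> < e \<Longrightarrow> eval_fps G t = f (x + t) - c"
    unfolding eventually_nhds_metric by (auto simp: dist_real_def)
  have "G = 0"
  proof (rule ccontr)
    assume "G \<noteq> 0"
    \<comment> \<open>Were the series of \<open>f - c\<close> nonzero, dividing by its leading power
      would leave a series that vanishes just left of 0 but has a nonzero constant term, against
      continuity at 0.\<close>
    define d where "d = subdegree G"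
    define H where "H = fps_shift d G"
    have GH: "G = H * fps_X ^ d" unfolding H_def d_def by (rule fps_shift_times_fps_X_power[symmetric]) simp
    have radH: "fps_conv_radius H > 0" using rad by (simp add: H_def)
    have H0: "fps_nth H 0 \<noteq> 0" using \<open>G \<noteq> 0\<close> by (simp add: H_def d_def)

    have "isCont (eval_fps H) 0"
      by (rule continuous_eval_fps) (use radH in \<open>auto simp: zero_ereal_def\<close>)
    then have "(eval_fps H \<longlongrightarrow> fps_nth H 0) (at 0)" by (simp add: isCont_def eval_fps_at_0)
    then have "(eval_fps H \<longlongrightarrow> fps_nth H 0) (at_left 0)" by (rule tendsto_mono[rotated]) (simp add: at_le)
    moreover have "\<forall>\<^sub>F t in at_left (0::real). eval_fps H t = 0"
    proof -
      obtain \<rho> where \<rho>: "0 < ereal \<rho>" "ereal \<rho> < fps_conv_radius H" using ereal_dense2[OF radH] by blast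
      have "\<forall>\<^sub>F t in at_left (0::real). - min e \<rho> < t \<and> t < 0"
        using e(1) \<rho>(1) by (intro eventually_conj) (auto simp: eventually_at_left_field intro: exI[of _ "-1"] exI[of _ "- min e \<rho>"])
      then show ?thesis
      proof eventually_elim
        case (elim t)
        have "\<bar>t\<bar> < \<rho>" using elim by linarith
        then have "ereal (norm t) < ereal \<rho>" by simp
        then have conv: "ereal (norm t) < fps_conv_radius H" using \<rho>(2) by (rule less_trans)
        have "eval_fps G t = eval_fps H t * t ^ d"
          unfolding GH using conv by (subst eval_fps_mult) (auto simp: eval_fps_power)
        moreover have "\<bar>t\<bar> < e" using elim by linarith
        then have "eval_fps G t = 0" using e(2)[of t] left[of t] elim by simp
        ultimately show ?case using elim by simp
      qed
    qed
    then have "(eval_fps H \<longlongrightarrow> 0) (at_left 0)" by (rule tendsto_eventually)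
    ultimately have "fps_nth H 0 = 0" using tendsto_unique[OF trivial_limit_at_left_real] by blast
    then show False using H0 by simp
  qed
  then have "f (x + e / 2) - c = 0" using e(2)[of "e / 2"] e(1) by simp
  then show ?thesis using e(1) by (intro exI[of _ "e / 2"]) simp
qed

theorem proposition10p1:
  fixes lam \<theta> :: real
  assumes "lam > 1" and "\<theta> \<notin> \<rat>"
  defines "A \<equiv> generators lam \<theta>"
  shows "(\<exists>C>0.
      (\<forall>t\<le>-C. ereal (pressure (potential A t)) =
         (SUP \<mu>\<in>{\<mu> \<in> invariant_measures. top_lyapunov A \<mu> = 0}. ks_entropy \<mu> left_shift)) \<and>
      (\<forall>t>-C. ereal (pressure (potential A t)) >
         (SUP \<mu>\<in>{\<mu> \<in> invariant_measures. top_lyapunov A \<mu> = 0}. ks_entropy \<mu> left_shift))) \<and>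
    \<not> real_analytic_on (\<lambda>t. pressure (potential A t)) UNIV"
proof -
  interpret hyperbolic_rotation lam \<theta> by unfold_locales (use assms in auto)
  obtain s h where h: "zero_exponent_entropy = ereal h" and Ps: "P (- s) \<le> h"
    by (rule zero_exponent_entropy_attained)
  have P_ge: "h \<le> P t" for t using zero_exponent_entropy_le_P[of t] by (simp add: h)
  have P0: "h < P 0" using P_ge[of "-2"] P_minus_2_less by (simp add: P_0)
  have lnlam: "ln lam > 0" using lam by simp
  define T where "T = {t. P t \<le> h}"
  \<comment> \<open>By the Lipschitz bound the pressure needs at least this distance to descend from
    \<open>P 0\<close> to \<open>h\<close>, which keeps the transition point strictly
    negative.\<close>
  define d where "d = (P 0 - h) / ln lam"
  have d: "d > 0" using P0 lnlam by (simp add: d_def)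
  have T_le: "t \<le> - d" if "t \<in> T" for t
  proof -
    have "t \<le> 0"
    proof (rule ccontr)
      assume "\<not> t \<le> 0"
      then have "P 0 \<le> P t" by (intro P_mono) simp
      then show False using that P0 by (simp add: T_def)
    qed
    then have "P 0 \<le> P t + (0 - t) * ln lam" by (rule P_lipschitz)
    then have "P 0 - h \<le> - t * ln lam" using that by (simp add: T_def)
    then have "d \<le> - t" using lnlam by (simp add: d_def pos_divide_le_eq)
    then show ?thesis by simp
  qed
  have "bdd_above T" using T_le by (rule bdd_aboveI)
  moreover have "- s \<in> T" using Ps by (simp add: T_def)
  ultimately have T: "- s \<in> T" "bdd_above T" by simp_all
  define C where "C = - Sup T"
  have "Sup T \<le> - d" by (rule cSup_least) (use T T_le in auto)
  then have C: "C > 0" using d by (simp add: C_def)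
  \<comment> \<open>The supremum of \<open>T\<close> belongs to \<open>T\<close>: the Lipschitz
    bound transfers the inequality from nearby points of \<open>T\<close>.\<close>
  have "P (- C) \<le> h"
  proof (rule field_le_epsilon)
    fix e :: real assume e: "e > 0"
    have "Sup T - e / ln lam < Sup T" using e lnlam by simp
    then obtain t where t: "t \<in> T" "Sup T - e / ln lam < t" using less_cSupD[of T] T(1) by blast
    have "t \<le> Sup T" using t(1) T(2) by (rule cSup_upper)
    then have "P (Sup T) \<le> P t + (Sup T - t) * ln lam" by (rule P_lipschitz)
    also have "(Sup T - t) * ln lam \<le> (e / ln lam) * ln lam" using t(2) lnlam by (intro mult_right_mono) auto
    finally show "P (- C) \<le> h + e" using t(1) lnlam by (simp add: C_def T_def)
  qed
  then have left: "P t = h" if "t \<le> - C" for t using P_mono[OF that] P_ge[of t] by linarith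
  have right: "h < P t" if "t > - C" for t
  proof (rule ccontr)
    assume "\<not> h < P t"
    then have "t \<in> T" by (simp add: T_def)
    then have "t \<le> Sup T" using T(2) by (rule cSup_upper)
    then show False using that by (simp add: C_def)
  qed
  have sup: "(SUP \<mu>\<in>{\<mu> \<in> invariant_measures. top_lyapunov A \<mu> = 0}. ks_entropy \<mu> left_shift) = ereal h"
    using h by (simp add: zero_exponent_entropy_def A_def)
  have pressure: "pressure (potential A t) = P t" for t unfolding A_def by (rule P_eq)
  have "\<not> real_analytic_on P UNIV"
  proof
    assume "real_analytic_on P UNIV"
    then obtain F where "(\<lambda>t. P (- C + t)) has_fps_expansion F"
      unfolding real_analytic_on_def by blast
    from analytic_constant_on_left[OF this, of h] left obtain t where "t > 0" "P (- C + t) = h" by auto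
    then show False using right[of "- C + t"] by simp
  qed
  then show ?thesis
    unfolding sup pressure using C left right by (intro conjI exI[of _ C]) auto
qed

end
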